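(* Let $m\ge 4$ be an integer and let $\mathrm{NC}_4(m)$ be any neighborly cubical $4$-polytope, that is, a $4$-dimensional convex polytope whose graph is isomorphic to the graph $C_m$ of the $m$-cube and all of whose facets are combinatorial $3$-cubes. Let $\mathrm{NC}_4(m)''$ be the polytope obtained from $\mathrm{NC}_4(m)$ by cutting off all of its vertices, and then cutting off the original edges. Then $\mathrm{NC}_4(m)''$ is a simple $4$-dimensional polytope with exactly $n:=(6m-12)2^m$ vertices. Moreover, for every fixed separation constant $c$ with $0<c<\tfrac12$, every separator of the graph of $\mathrm{NC}_4(m)''$ (with separation constant $c$) has size at least $$\Omega\Big(\frac{n}{\log^{3/2} n}\Big),$$ while the graph of $\mathrm{NC}_4(m)''$ does have separators (with separation constant $c$) of size $$O\Big(\frac{n}{\log n}\Big).$$ Here the asymptotics are for $m\to\infty$, and the implied constants may depend on $c$ but not on $m$ or on the choice of the neighborly cubical polytope $\mathrm{NC}_4(m)$.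
   Context: Polytopes are convex polytopes; the graph of a polytope is its $1$-skeleton (vertices and edges). A $d$-polytope is simple if every vertex lies on exactly $d$ edges. The graph $C_m$ of the $m$-cube has vertex set $\{0,1\}^m$, two vertices being adjacent if and only if they differ in exactly one coordinate. A combinatorial $3$-cube is a $3$-polytope whose face lattice is isomorphic to that of the $3$-cube. It is known (Joswig and Ziegler) that for each $m\ge 4$ at least one neighborly cubical $4$-polytope $\mathrm{NC}_4(m)$ as described in the claim exists; there are in general many combinatorial types. Cutting off: to cut off a proper face $F$ of a polytope $P$ means to intersect $P$ with a closed half-space whose bounding hyperplane strictly separates the vertices of $F$ (which are removed) from all other vertices of $P$ (which are kept). To cut off several pairwise disjoint faces of $P$, one does this for all of them, choosing the hyperplanes close enough to the respective faces that the closed pieces cut off are pairwise disjoint. Let $P=\mathrm{NC}_4(m)$ and let $P'$ be the result of cutting off all vertices of $P$. Each edge $e$ of $P$ gives a shortened edge $e\cap P'$ of $P'$, and these shortened edges are pairwise disjoint. "Then cutting off the original edges" means cutting off from $P'$ all the edges $e\cap P'$, where $e$ ranges over the edges of $P$. The result is $P''=\mathrm{NC}_4(m)''$; its combinatorial type does not depend on the choices of the hyperplanes. Separators: fix a separation constant $c$ with $0<c<\tfrac12$. A separator of a graph on $n$ vertices is a set $C$ of vertices for which the vertex set can be partitioned into three sets $A,B,C$ with $cn\le |A|\le |B|\le (1-c)n$ such that there are no edges between $A$ and $B$. The size of the separator is $|C|$. *)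

theory Defs
  imports "HOL-Analysis.Analysis"
begin

section \<open>Graphs\<close>

text \<open>A simple graph is given by its vertex set and its adjacency relation.\<close>

definition graph_isomorphic ::
    "'a set \<Rightarrow> ('a \<Rightarrow> 'a \<Rightarrow> bool) \<Rightarrow> 'b set \<Rightarrow> ('b \<Rightarrow> 'b \<Rightarrow> bool) \<Rightarrow> bool" where
  "graph_isomorphic V E W F \<longleftrightarrow>
     (\<exists>f. bij_betw f V W \<and> (\<forall>u\<in>V. \<forall>v\<in>V. E u v \<longleftrightarrow> F (f u) (f v)))"

definition cube_vertices :: "nat \<Rightarrow> bool list set" where
  "cube_vertices m = {x. length x = m}"

definition cube_adj :: "nat \<Rightarrow> bool list \<Rightarrow> bool list \<Rightarrow> bool" where
  "cube_adj m x y \<longleftrightarrow> card {i. i < m \<and> x ! i \<noteq> y ! i} = 1"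

definition separator :: "real \<Rightarrow> 'a set \<Rightarrow> ('a \<Rightarrow> 'a \<Rightarrow> bool) \<Rightarrow> 'a set \<Rightarrow> bool" where
  "separator c V E C \<longleftrightarrow>
     (\<exists>A B. A \<union> B \<union> C = V \<and> A \<inter> B = {} \<and> A \<inter> C = {} \<and> B \<inter> C = {} \<and>
        c * real (card V) \<le> real (card A) \<and> card A \<le> card B \<and>
        real (card B) \<le> (1 - c) * real (card V) \<and>
        (\<forall>a\<in>A. \<forall>b\<in>B. \<not> E a b \<and> \<not> E b a))"


section \<open>Polytopes\<close>

definition polytope_vertices :: "'a::euclidean_space set \<Rightarrow> 'a set" where
  "polytope_vertices P = {v. v extreme_point_of P}"

definition polytope_adj :: "'a::euclidean_space set \<Rightarrow> 'a \<Rightarrow> 'a \<Rightarrow> bool" where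
  "polytope_adj P u v \<longleftrightarrow>
     u \<in> polytope_vertices P \<and> v \<in> polytope_vertices P \<and> u \<noteq> v \<and>
     closed_segment u v edge_of P"

definition simple_polytope :: "nat \<Rightarrow> 'a::euclidean_space set \<Rightarrow> bool" where
  "simple_polytope d P \<longleftrightarrow>
     polytope P \<and> aff_dim P = int d \<and>
     (\<forall>v \<in> polytope_vertices P. card {e. e edge_of P \<and> v \<in> e} = d)"

text \<open>Isomorphism of face lattices, including the empty face and the polytope itself.\<close>

definition combinatorially_equivalent ::
    "'a::euclidean_space set \<Rightarrow> 'b::euclidean_space set \<Rightarrow> bool" where
  "combinatorially_equivalent P Q \<longleftrightarrow>
     (\<exists>f. bij_betw f {F. F face_of P} {G. G face_of Q} \<and>
          (\<forall>F G. F face_of P \<longrightarrow> G face_of P \<longrightarrow> (F \<subseteq> G \<longleftrightarrow> f F \<subseteq> f G)))"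

definition combinatorial_3_cube :: "'a::euclidean_space set \<Rightarrow> bool" where
  "combinatorial_3_cube P \<longleftrightarrow>
     polytope P \<and> aff_dim P = 3 \<and> combinatorially_equivalent P (cbox 0 (1 :: real ^ 3))"

definition neighborly_cubical_4_polytope :: "nat \<Rightarrow> 'a::euclidean_space set \<Rightarrow> bool" where
  "neighborly_cubical_4_polytope m P \<longleftrightarrow>
     polytope P \<and> aff_dim P = 4 \<and>
     graph_isomorphic (polytope_vertices P) (polytope_adj P) (cube_vertices m) (cube_adj m) \<and>
     (\<forall>F. F facet_of P \<longrightarrow> combinatorial_3_cube F)"


section \<open>Cutting off faces\<close>

text \<open>
  \<open>cut_off P \<F> Q\<close> says that \<open>Q\<close> is a possible result of cutting off all faces in \<open>\<F>\<close> from \<open>P\<close>.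
  It is a relation because the hyperplanes \<open>{x. a F \<bullet> x = b F}\<close> can be chosen in many ways.
\<close>

definition cut_off :: "'a::euclidean_space set \<Rightarrow> 'a set set \<Rightarrow> 'a set \<Rightarrow> bool" where
  "cut_off P \<F> Q \<longleftrightarrow>
     (\<forall>F\<in>\<F>. F face_of P \<and> F \<noteq> {} \<and> F \<noteq> P) \<and> pairwise disjnt \<F> \<and>
     (\<exists>a b.
        (\<forall>F\<in>\<F>. \<forall>v \<in> polytope_vertices P.
           (v \<in> F \<longrightarrow> a F \<bullet> v > b F) \<and> (v \<notin> F \<longrightarrow> a F \<bullet> v < b F)) \<and>
        (\<forall>F\<in>\<F>. \<forall>G\<in>\<F>. F \<noteq> G \<longrightarrow>
           disjnt (P \<inter> {x. a F \<bullet> x \<ge> b F}) (P \<inter> {x. a G \<bullet> x \<ge> b G})) \<and>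
        Q = P \<inter> (\<Inter>F\<in>\<F>. {x. a F \<bullet> x \<le> b F}))"

definition vertex_edge_truncation :: "'a::euclidean_space set \<Rightarrow> 'a set \<Rightarrow> bool" where
  "vertex_edge_truncation P Q \<longleftrightarrow>
     (\<exists>P'. cut_off P {{v} | v. v \<in> polytope_vertices P} P' \<and>
           cut_off P' {e \<inter> P' | e. e edge_of P} Q)"

end

theory Submission
  imports Defs
begin

text \<open>
  Write \<open>P\<close> for the neighborly cubical polytope, \<open>P'\<close> for the polytope after the vertices are cut off
  and \<open>Q\<close> for the final one.

  Cutting off pairwise disjoint faces has a simple effect on the face lattice: a face \<open>G\<close> survives
  as \<open>G \<inter> Q\<close> with its dimension unless it lies in a removed face, and every hyperplane that cuts
  through \<open>G\<close> adds the new face \<open>G \<inter> H\<close>, of one dimension less (\<open>cutting.faces_of_dim_Q\<close>). Applied twice,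
  this shows that the vertices of \<open>Q\<close> are the points \<open>f \<inter> H\<^sub>v \<inter> H\<^sub>e\<close> for the flags \<open>v \<in> e \<subseteq> f\<close> of a
  vertex, an edge and a 2-face of \<open>P\<close>, and that an edge of \<open>Q\<close> changes exactly one of \<open>v\<close>, \<open>e\<close>, \<open>f\<close>.
  A flag can be changed at \<open>v\<close> and at \<open>e\<close> in one way each, and at \<open>f\<close> in two ways, one for
  each of the two facets that contain \<open>f\<close> (\<open>ridge_in_two_facets\<close>). So \<open>Q\<close> is simple.

  To count the flags at a vertex \<open>v\<close>, apply Euler's formula to the vertex figure, a 3-polytope with \<open>m\<close>
  vertices, \<open>E\<close> edges and \<open>F\<close> facets. It is simplicial because three 2-faces of a 3-cube meet
  at each vertex; thus \<open>2 E = 3 F\<close>, which with \<open>m - E + F = 2\<close> yields \<open>2 E = 6 m - 12\<close>, and \<open>2 E\<close> is the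
  number of flags at \<open>v\<close> (\<open>card_flags_at_vertex\<close>). Hence the vertices of \<open>Q\<close> fall into \<open>2\<^sup>m\<close> clusters of equal size, one for each
  vertex of the cube graph. Euler's formula itself is obtained by sweeping a generic hyperplane across the
  3-polytope, since its sections are polygons, which have as many vertices as edges.

  Lower bound: a cluster is the vertex set of a facet of \<open>Q\<close>, so it is connected
  (\<open>polytope_graph_connected\<close>) and a separator that misses it leaves it on one side. The clusters met by
  a separator therefore form a separator of the cube graph of at most the same size and with essentially
  the same balance. In the cube such a set has at least of the order of \<open>2\<^sup>m / \<surd>m\<close> elements, by
  an isoperimetric inequality that is proved by induction on the dimension (\<open>cube_surface_inequality\<close>).
  As \<open>ln n\<close> is of the order of \<open>m\<close>, this is of the order of \<open>n / (ln n) powr (3 / 2)\<close>.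

  Upper bound: two clusters are joined only along edges of \<open>P\<close>, and each flag has a unique edge, which
  belongs to one of the \<open>m\<close> directions of the cube. So for some direction at most \<open>n / m\<close> flags have their edge in that
  direction. Removing those of them on one side of the cube separates the two halves.
\<close>

section \<open>Faces of polytopes\<close>

definition faces_of_dim :: "'a::euclidean_space set \<Rightarrow> int \<Rightarrow> 'a set set" where
  "faces_of_dim S k = {G. G face_of S \<and> aff_dim G = k}"

lemma finite_faces_of_dim: "polytope S \<Longrightarrow> finite (faces_of_dim S k)"
  unfolding faces_of_dim_def by (rule finite_subset[OF _ finite_polytope_faces]) auto

text \<open>
  The carrier of \<open>x\<close> is the intersection of all faces that contain \<open>x\<close>: if \<open>x\<close> were on its relative boundary, one of its
  facets would be a smaller face containing \<open>x\<close>. Faces of sections and of truncations are identified below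
  through the carrier of one of their relative interior points.
\<close>

lemma polytope_carrier_face:
  fixes S :: "'a::euclidean_space set"
  assumes "polytope S" "x \<in> S"
  obtains G where "G face_of S" "x \<in> rel_interior G"
proof -
  define G where "G = \<Inter>{F. F face_of S \<and> x \<in> F}"
  have S: "S face_of S"
    using assms by (simp add: face_of_refl polytope_imp_convex)
  have G: "G face_of S"
    unfolding G_def by (rule face_of_Inter) (use S assms in auto)
  have xG: "x \<in> G" unfolding G_def by auto
  have "polyhedron G"
    using G assms(1) face_of_polytope_polytope polytope_imp_polyhedron by blast
  have "x \<in> rel_interior G"
  proof (rule ccontr)
    assume "x \<notin> rel_interior G"
    then obtain F where F: "F facet_of G" "x \<in> F"
      using rel_interior_of_polyhedron[OF \<open>polyhedron G\<close>] xG by auto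
    then have "F face_of S"
      using G face_of_trans facet_of_imp_face_of by blast
    then have "G \<subseteq> F" using F unfolding G_def by blast
    then show False
      using F facet_of_imp_subset[OF F(1)] by (metis facet_of_irrefl subset_antisym)
  qed
  with G that show ?thesis by blast
qed

lemma face_subset_if_rel_interior_meets:
  fixes S :: "'a::euclidean_space set"
  assumes "G face_of S" "G' face_of S" "x \<in> rel_interior G" "x \<in> G'"
  shows "G \<subseteq> G'"
  using subset_of_face_of[OF assms(2) face_of_imp_subset[OF assms(1)]] assms(3,4) by blast

lemma face_subset_aff_dim_eq:
  fixes S :: "'a::euclidean_space set"
  assumes "G face_of S" "G' face_of S" "G \<subseteq> G'" "aff_dim G = aff_dim G'"
  shows "G = G'"
  using assms face_of_aff_dim_lt[of G' G] face_of_face face_of_imp_convex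
  by (metis order_less_irrefl)

lemma polytope_eq_hull_vertices:
  "polytope S \<Longrightarrow> S = convex hull (polytope_vertices S)"
  unfolding polytope_vertices_def
  by (simp add: Krein_Milman_Minkowski polytope_imp_compact polytope_imp_convex)

lemma finite_polytope_vertices: "polytope S \<Longrightarrow> finite (polytope_vertices S)"
  unfolding polytope_vertices_def
  by (simp add: finite_polyhedron_extreme_points polytope_imp_polyhedron)

lemma polytope_vertices_subset: "polytope_vertices S \<subseteq> S"
  unfolding polytope_vertices_def extreme_point_of_def by auto

lemma polytope_vertices_face:
  "G face_of S \<Longrightarrow> polytope_vertices G = polytope_vertices S \<inter> G"
  unfolding polytope_vertices_def by (auto simp: extreme_point_of_face)

lemma singleton_face_iff: "{v} face_of S \<longleftrightarrow> v \<in> polytope_vertices S"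
  unfolding polytope_vertices_def by (simp add: face_of_singleton)

lemma faces_of_dim_0: "faces_of_dim S 0 = (\<lambda>v. {v}) ` polytope_vertices S"
  unfolding faces_of_dim_def by (auto simp: aff_dim_eq_0 singleton_face_iff)

lemma card_faces_of_dim_0: "card (faces_of_dim S 0) = card (polytope_vertices S)"
  unfolding faces_of_dim_0 by (rule card_image) auto

lemma polytope_vertex_exists:
  "polytope S \<Longrightarrow> S \<noteq> {} \<Longrightarrow> polytope_vertices S \<noteq> {}"
  using polytope_eq_hull_vertices[of S] by auto

lemma polytope_vertices_lt:
  assumes "polytope S" "\<And>v. v \<in> polytope_vertices S \<Longrightarrow> a \<bullet> v < b" "x \<in> S"
  shows "a \<bullet> x < (b::real)"
proof -
  have "convex hull (polytope_vertices S) \<subseteq> {x. a \<bullet> x < b}"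
    by (rule hull_minimal) (use assms in \<open>auto simp: convex_halfspace_lt\<close>)
  then show ?thesis using polytope_eq_hull_vertices[OF assms(1)] assms(3) by auto
qed

lemma polytope_vertices_gt:
  assumes "polytope S" "\<And>v. v \<in> polytope_vertices S \<Longrightarrow> a \<bullet> v > b" "x \<in> S"
  shows "a \<bullet> x > (b::real)"
  using polytope_vertices_lt[of S "-a" "-b" x] assms by auto

lemma polytope_vertices_le:
  assumes "polytope S" "\<And>v. v \<in> polytope_vertices S \<Longrightarrow> a \<bullet> v \<le> b" "x \<in> S"
  shows "a \<bullet> x \<le> (b::real)"
proof -
  have "convex hull (polytope_vertices S) \<subseteq> {x. a \<bullet> x \<le> b}"
    by (rule hull_minimal) (use assms in \<open>auto simp: convex_halfspace_le\<close>)
  then show ?thesis using polytope_eq_hull_vertices[OF assms(1)] assms(3) by auto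
qed

lemma one_dim_polytope_segment:
  fixes S :: "'a::euclidean_space set"
  assumes "polytope S" "aff_dim S = 1"
  obtains u w where "u \<noteq> w" "S = closed_segment u w" "polytope_vertices S = {u, w}"
proof -
  have ne: "S \<noteq> {}" using assms by auto
  have "collinear S" by (simp add: collinear_aff_dim assms)
  then obtain u w where S: "S = closed_segment u w"
    using compact_convex_collinear_segment[OF ne] polytope_imp_compact polytope_imp_convex assms
    by metis
  have "u \<noteq> w" using S assms by auto
  moreover have "polytope_vertices S = {u, w}"
    unfolding polytope_vertices_def S by (auto simp: extreme_point_of_segment)
  ultimately show ?thesis using S that by blast
qed

lemma card_vertices_one_dim:
  fixes S :: "'a::euclidean_space set"
  assumes "polytope S" "aff_dim S = 1"
  shows "card (polytope_vertices S) = 2"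
  using one_dim_polytope_segment[OF assms] by (metis card_2_iff)

section \<open>Hyperplane sections\<close>

definition crosses :: "'a::euclidean_space \<Rightarrow> real \<Rightarrow> 'a set \<Rightarrow> bool" where
  "crosses a b G \<longleftrightarrow> (\<exists>u\<in>G. a \<bullet> u < b) \<and> (\<exists>w\<in>G. a \<bullet> w > b)"

text \<open>
  On the way from a relative interior point to a point on the other side of the hyperplane, one stays in
  the relative interior until the very end.
\<close>

lemma crosses_rel_interior:
  fixes G :: "'a::euclidean_space set"
  assumes "convex G" "crosses a b G"
  obtains x where "x \<in> rel_interior G" "a \<bullet> x = b"
proof -
  obtain u w where u: "u \<in> G" "a \<bullet> u < b" and w: "w \<in> G" "a \<bullet> w > b"
    using assms unfolding crosses_def by auto
  have "rel_interior G \<noteq> {}"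
    using assms(1) u rel_interior_eq_empty by blast
  then obtain z where z: "z \<in> rel_interior G" by auto
  have pt: "\<exists>x\<in>rel_interior G. a \<bullet> x = b" if y: "y \<in> G" and
    *: "(a \<bullet> z < b \<and> b < a \<bullet> y) \<or> (a \<bullet> y < b \<and> b < a \<bullet> z)" for y
  proof -
    define t where "t = (b - a \<bullet> z) / (a \<bullet> y - a \<bullet> z)"
    have t: "0 < t" "t < 1" using * unfolding t_def by (auto simp: divide_simps)
    define x where "x = (1 - t) *\<^sub>R z + t *\<^sub>R y"
    have "x \<in> open_segment z y"
      unfolding in_segment x_def using t * by (auto intro!: exI[of _ t])
    moreover have "open_segment z y \<subseteq> rel_interior G"
      using rel_interior_closure_convex_segment[OF assms(1) z] y closure_subset by blast
    moreover have "a \<bullet> x = a \<bullet> z + t * (a \<bullet> y - a \<bullet> z)"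
      unfolding x_def by (simp add: inner_add_right algebra_simps)
    moreover have "t * (a \<bullet> y - a \<bullet> z) = b - a \<bullet> z" unfolding t_def using * by auto
    ultimately show ?thesis by (intro bexI[of _ x]) auto
  qed
  consider "a \<bullet> z < b" | "a \<bullet> z = b" | "a \<bullet> z > b" by linarith
  then have "\<exists>x\<in>rel_interior G. a \<bullet> x = b"
    by cases (use pt[OF w(1)] pt[OF u(1)] u w z in auto)
  then show ?thesis using that by blast
qed

text \<open>
  A segment of \<open>G\<close> that ends in a relative interior point \<open>x\<close> can be prolonged beyond \<open>x\<close>, which leads to the
  other side of a hyperplane through \<open>x\<close>.
\<close>

lemma rel_interior_crosses:
  fixes G :: "'a::euclidean_space set"
  assumes "convex G" "x \<in> rel_interior G" "a \<bullet> x = b" "\<not> G \<subseteq> {x. a \<bullet> x = b}"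
  shows "crosses a b G"
proof -
  obtain y where y: "y \<in> G" "a \<bullet> y \<noteq> b" using assms(4) by auto
  have ne: "G \<noteq> {}" using y by auto
  obtain e where e: "e > 1" "(1 - e) *\<^sub>R y + e *\<^sub>R x \<in> G"
    using convex_rel_interior_iff[OF assms(1) ne] assms(2) y(1) by blast
  define z where "z = (1 - e) *\<^sub>R y + e *\<^sub>R x"
  have "a \<bullet> z - b = (e - 1) * (b - a \<bullet> y)"
    unfolding z_def using assms(3) by (simp add: inner_add_right algebra_simps)
  then have "(a \<bullet> y < b \<longrightarrow> a \<bullet> z > b) \<and> (a \<bullet> y > b \<longrightarrow> a \<bullet> z < b)"
    using e(1) by (metis diff_gt_0_iff_gt diff_less_0_iff_less mult_pos_neg mult_pos_pos)
  then show ?thesis unfolding crosses_def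
    using y e(2) z_def by (metis linorder_neqE_linordered_idom)
qed

text \<open>
  Near a relative interior point, \<open>G\<close> coincides with its affine hull, so the section has the dimension of
  the section of the affine hull.
\<close>

lemma aff_dim_section:
  fixes G :: "'a::euclidean_space set"
  assumes "convex G" "crosses a b G"
  shows "aff_dim (G \<inter> {x. a \<bullet> x = b}) = aff_dim G - 1"
proof -
  let ?H = "{x. a \<bullet> x = b}"
  obtain x where x: "x \<in> rel_interior G" "a \<bullet> x = b"
    using crosses_rel_interior[OF assms] by blast
  obtain T where T: "open T" "rel_interior G = affine hull G \<inter> T"
    using openin_rel_interior[of G] unfolding openin_open by auto
  let ?A = "affine hull G \<inter> ?H"
  have A: "affine ?A" by (simp add: affine_Int affine_hyperplane)
  have "?A \<inter> T \<noteq> {}" using x T by auto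
  then have 1: "aff_dim (?A \<inter> T) = aff_dim ?A"
    using aff_dim_convex_Int_open[of ?A T] A T affine_imp_convex by blast
  have "\<not> affine hull G \<subseteq> ?H"
    using assms(2) hull_subset[of G affine] unfolding crosses_def by force
  moreover have "?A \<noteq> {}" using x T by auto
  ultimately have 2: "aff_dim ?A = aff_dim G - 1"
    using aff_dim_affine_Int_hyperplane[of "affine hull G" a b] by auto
  have "?A \<inter> T \<subseteq> G \<inter> ?H" using T rel_interior_subset[of G] by auto
  then have "aff_dim (?A \<inter> T) \<le> aff_dim (G \<inter> ?H)" by (rule aff_dim_subset)
  moreover have "G \<inter> ?H \<subseteq> ?A" using hull_subset[of G affine] by auto
  then have "aff_dim (G \<inter> ?H) \<le> aff_dim ?A" by (rule aff_dim_subset)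
  ultimately show ?thesis using 1 2 by linarith
qed

text \<open>
  Let \<open>G\<close> be the carrier in \<open>S\<close> of a relative interior point of \<open>K\<close>. This point is in the relative
  interior of \<open>K\<close> and of the section of \<open>G\<close>; two faces with a common relative interior point are equal.
\<close>

lemma section_face_cases:
  fixes S :: "'a::euclidean_space set"
  assumes S: "polytope S" and K: "K face_of (S \<inter> {x. a \<bullet> x = b})" "K \<noteq> {}"
  obtains G where "G face_of S" "K = G \<inter> {x. a \<bullet> x = b}"
    "G \<subseteq> {x. a \<bullet> x = b} \<or> crosses a b G"
proof -
  let ?H = "{x. a \<bullet> x = b}"
  have "convex K" using K face_of_imp_convex by blast
  then obtain x where x: "x \<in> rel_interior K"
    using K(2) rel_interior_eq_empty by blast
  then have "x \<in> K" using rel_interior_subset by auto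
  then have xSH: "x \<in> S" "x \<in> ?H"
    using K face_of_imp_subset by blast+
  obtain G where G: "G face_of S" "x \<in> rel_interior G"
    using polytope_carrier_face[OF S xSH(1)] by blast
  have cG: "convex G" using G face_of_imp_convex by blast
  have face: "G \<inter> ?H face_of S \<inter> ?H"
    by (rule face_of_slice[OF G(1)]) (simp add: convex_hyperplane)
  have "rel_interior (G \<inter> ?H) = rel_interior G \<inter> ?H"
    by (rule convex_affine_rel_interior_Int[OF cG affine_hyperplane]) (use G xSH in auto)
  then have "x \<in> rel_interior (G \<inter> ?H)" using G xSH by auto
  then have "K = G \<inter> ?H" using face_of_eq[OF K(1) face] x by blast
  moreover have "G \<subseteq> ?H \<or> crosses a b G"
    using rel_interior_crosses[OF cG G(2)] xSH by auto
  ultimately show ?thesis using that G by blast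
qed

lemma section_face:
  fixes S :: "'a::euclidean_space set"
  assumes "G face_of S"
  shows "G \<inter> {x. a \<bullet> x = b} face_of S \<inter> {x. a \<bullet> x = b}"
  by (rule face_of_slice[OF assms]) (simp add: convex_hyperplane)

lemma section_subset_face:
  fixes S :: "'a::euclidean_space set"
  assumes "G face_of S" "G' face_of S" "crosses a b G" "G \<inter> {x. a \<bullet> x = b} \<subseteq> G'"
  shows "G \<subseteq> G'"
proof -
  obtain x where "x \<in> rel_interior G" "a \<bullet> x = b"
    using crosses_rel_interior assms face_of_imp_convex by metis
  then show ?thesis
    using face_subset_if_rel_interior_meets[OF assms(1,2)] assms(4) rel_interior_subset by blast
qed

lemma polytope_section:
  fixes S :: "'a::euclidean_space set"
  shows "polytope S \<Longrightarrow> polytope (S \<inter> {x. a \<bullet> x = b})"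
  by (simp add: polytope_Int_polyhedron polyhedron_hyperplane)

text \<open>
  A generic hyperplane shifts dimensions by one. The second part of the domain takes care of hyperplanes that
  contain faces, as it happens when a sweeping hyperplane passes through a vertex.
\<close>

lemma faces_of_section_general:
  fixes S :: "'a::euclidean_space set"
  assumes S: "polytope S" and k: "0 \<le> k"
  shows "bij_betw (\<lambda>G. G \<inter> {x. a \<bullet> x = b})
           ({G \<in> faces_of_dim S (k + 1). crosses a b G} \<union> {G \<in> faces_of_dim S k. G \<subseteq> {x. a \<bullet> x = b}})
           (faces_of_dim (S \<inter> {x. a \<bullet> x = b}) k)"
proof -
  let ?H = "{x. a \<bullet> x = b}"
  let ?D = "{G \<in> faces_of_dim S (k + 1). crosses a b G} \<union> {G \<in> faces_of_dim S k. G \<subseteq> ?H}"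
  have dim: "aff_dim (G \<inter> ?H) = aff_dim G - 1" if "G face_of S" "crosses a b G" for G
    using aff_dim_section that face_of_imp_convex by blast
  have sub: "G \<subseteq> G'" if "G \<in> ?D" "G' \<in> ?D" "G \<inter> ?H = G' \<inter> ?H" for G G'
    using that section_subset_face[of G S G' a b] unfolding faces_of_dim_def by blast
  show ?thesis unfolding bij_betw_def
  proof
    show "inj_on (\<lambda>G. G \<inter> ?H) ?D"
      using sub by (intro inj_onI equalityI) auto
    show "(\<lambda>G. G \<inter> ?H) ` ?D = faces_of_dim (S \<inter> ?H) k"
    proof (intro equalityI subsetI)
      fix K assume K: "K \<in> faces_of_dim (S \<inter> ?H) k"
      then have "K face_of S \<inter> ?H" "K \<noteq> {}" using k unfolding faces_of_dim_def by auto
      then obtain G where G: "G face_of S" "K = G \<inter> ?H" "G \<subseteq> ?H \<or> crosses a b G"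
        using section_face_cases[OF S] by metis
      show "K \<in> (\<lambda>G. G \<inter> ?H) ` ?D"
      proof (cases "G \<subseteq> ?H")
        case True
        then have "K = G" using G by auto
        then show ?thesis using G K True unfolding faces_of_dim_def by auto
      next
        case False
        then show ?thesis using G K dim[OF G(1)] unfolding faces_of_dim_def by auto
      qed
    next
      fix K assume "K \<in> (\<lambda>G. G \<inter> ?H) ` ?D"
      then obtain G where G: "G \<in> ?D" "K = G \<inter> ?H" by blast
      show "K \<in> faces_of_dim (S \<inter> ?H) k"
      proof (cases "crosses a b G")
        case True
        then have "G \<in> faces_of_dim S (k + 1)" using G unfolding crosses_def by force
        then show ?thesis using dim True section_face G unfolding faces_of_dim_def by auto
      next
        case False
        then have "G face_of S" "aff_dim G = k" "G \<inter> ?H = G"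
          using G unfolding faces_of_dim_def by auto
        then show ?thesis using section_face[of G S a b] G unfolding faces_of_dim_def by simp
      qed
    qed
  qed
qed

lemma faces_of_section:
  fixes S :: "'a::euclidean_space set"
  assumes S: "polytope S" and k: "0 \<le> k"
    and no: "\<And>G. G \<in> faces_of_dim S k \<Longrightarrow> \<not> G \<subseteq> {x. a \<bullet> x = b}"
  shows "bij_betw (\<lambda>G. G \<inter> {x. a \<bullet> x = b}) {G \<in> faces_of_dim S (k + 1). crosses a b G}
           (faces_of_dim (S \<inter> {x. a \<bullet> x = b}) k)"
proof -
  have "{G \<in> faces_of_dim S k. G \<subseteq> {x. a \<bullet> x = b}} = {}" using no by blast
  then show ?thesis using faces_of_section_general[OF S k, of a b] by (simp only: Un_empty_right)
qed

lemma card_faces_of_section: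
  fixes S :: "'a::euclidean_space set"
  assumes S: "polytope S" and k: "0 \<le> k"
  shows "card (faces_of_dim (S \<inter> {x. a \<bullet> x = b}) k) =
    card {G \<in> faces_of_dim S (k + 1). crosses a b G} +
    card {G \<in> faces_of_dim S k. G \<subseteq> {x. a \<bullet> x = b}}"
proof -
  have "{G \<in> faces_of_dim S (k + 1). crosses a b G} \<inter> {G \<in> faces_of_dim S k. G \<subseteq> {x. a \<bullet> x = b}} = {}"
    unfolding faces_of_dim_def by auto
  then have "card ({G \<in> faces_of_dim S (k + 1). crosses a b G} \<union> {G \<in> faces_of_dim S k. G \<subseteq> {x. a \<bullet> x = b}})
     = card {G \<in> faces_of_dim S (k + 1). crosses a b G} +
       card {G \<in> faces_of_dim S k. G \<subseteq> {x. a \<bullet> x = b}}"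
    by (intro card_Un_disjoint) (auto simp: finite_faces_of_dim S)
  then show ?thesis
    using bij_betw_same_card[OF faces_of_section_general[OF S k, of a b]] by simp
qed

section \<open>Vertex figures and the diamond property\<close>

definition cuts_vertex :: "'a::euclidean_space set \<Rightarrow> 'a \<Rightarrow> 'a \<Rightarrow> real \<Rightarrow> bool" where
  "cuts_vertex S v a b \<longleftrightarrow> v \<in> polytope_vertices S \<and> a \<bullet> v > b \<and>
     (\<forall>w\<in>polytope_vertices S. w \<noteq> v \<longrightarrow> a \<bullet> w < b)"

text \<open>
  A hyperplane that supports \<open>S\<close> in \<open>v\<close> only is pushed inwards, half of the way to the highest remaining vertex.
\<close>

lemma cuts_vertex_exists:
  fixes S :: "'a::euclidean_space set"
  assumes S: "polytope S" and v: "v \<in> polytope_vertices S"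
  obtains a b where "cuts_vertex S v a b"
proof -
  have "{v} exposed_face_of S"
    using v singleton_face_iff exposed_face_of_polyhedron polytope_imp_polyhedron[OF S] by blast
  then obtain a c where a: "S \<subseteq> {x. a \<bullet> x \<le> c}" "{v} = S \<inter> {x. a \<bullet> x = c}"
    unfolding exposed_face_of_def by blast
  let ?W = "polytope_vertices S - {v}"
  have lt: "a \<bullet> w < c" if "w \<in> ?W" for w
    using a that polytope_vertices_subset[of S] by (auto simp: order.strict_iff_order)
  have fin: "finite ?W" using finite_polytope_vertices[OF S] by auto
  have "a \<bullet> v = c" using a by auto
  define b where "b = (c + Max (insert (c - 1) ((\<bullet>) a ` ?W))) / 2"
  have M: "Max (insert (c - 1) ((\<bullet>) a ` ?W)) < c"
    using fin lt by (subst Max_less_iff) auto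
  moreover have "a \<bullet> w \<le> Max (insert (c - 1) ((\<bullet>) a ` ?W))" if "w \<in> ?W" for w
    using fin that by (intro Max_ge) auto
  ultimately have "cuts_vertex S v a b"
    unfolding cuts_vertex_def b_def using v \<open>a \<bullet> v = c\<close> by force
  then show ?thesis using that by blast
qed

lemma cuts_vertex_crosses_iff:
  fixes S :: "'a::euclidean_space set"
  assumes S: "polytope S" and c: "cuts_vertex S v a b" and G: "G face_of S"
  shows "crosses a b G \<longleftrightarrow> v \<in> G \<and> G \<noteq> {v}"
proof
  have pG: "polytope G" using S G face_of_polytope_polytope by blast
  have vG: "polytope_vertices G = polytope_vertices S \<inter> G" using G polytope_vertices_face by blast
  {
    assume cr: "crosses a b G"
    have "v \<in> G"
    proof (rule ccontr)
      assume "v \<notin> G"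
      then have "a \<bullet> w < b" if "w \<in> polytope_vertices G" for w
        using c that vG unfolding cuts_vertex_def by auto
      then have "a \<bullet> x < b" if "x \<in> G" for x using polytope_vertices_lt[OF pG _ that] by blast
      then show False using cr unfolding crosses_def by force
    qed
    then show "v \<in> G \<and> G \<noteq> {v}"
      using cr c unfolding crosses_def cuts_vertex_def by force
  }
  assume v: "v \<in> G \<and> G \<noteq> {v}"
  have "polytope_vertices G \<noteq> {v}"
    using polytope_eq_hull_vertices[OF pG] v by auto
  moreover have "v \<in> polytope_vertices G" using v vG c unfolding cuts_vertex_def by auto
  ultimately obtain w where "w \<in> polytope_vertices G" "w \<noteq> v" by blast
  then show "crosses a b G"
    using c vG v unfolding crosses_def cuts_vertex_def by blast
qed

lemma cuts_vertex_no_face_in_hyperplane: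
  fixes S :: "'a::euclidean_space set"
  assumes S: "polytope S" and c: "cuts_vertex S v a b" and G: "G face_of S" "G \<noteq> {}"
  shows "\<not> G \<subseteq> {x. a \<bullet> x = b}"
proof -
  have "polytope G" using S G face_of_polytope_polytope by blast
  then obtain w where "w \<in> polytope_vertices G" using G polytope_vertex_exists by blast
  then have "w \<in> polytope_vertices S" "w \<in> G" using G polytope_vertices_face by blast+
  then show ?thesis using c unfolding cuts_vertex_def by force
qed

text \<open>
  The faces of the vertex figure at \<open>v\<close> are the faces through \<open>v\<close>, with dimension lowered by one.
\<close>

lemma vertex_figure_faces:
  fixes S :: "'a::euclidean_space set"
  assumes S: "polytope S" and c: "cuts_vertex S v a b" and k: "0 \<le> k"
  shows "bij_betw (\<lambda>G. G \<inter> {x. a \<bullet> x = b}) {G \<in> faces_of_dim S (k + 1). v \<in> G}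
           (faces_of_dim (S \<inter> {x. a \<bullet> x = b}) k)"
proof -
  have "{G \<in> faces_of_dim S (k + 1). v \<in> G} = {G \<in> faces_of_dim S (k + 1). crosses a b G}"
    using cuts_vertex_crosses_iff[OF S c] k unfolding faces_of_dim_def by auto
  moreover have "\<not> G \<subseteq> {x. a \<bullet> x = b}" if "G \<in> faces_of_dim S k" for G
  proof -
    have "G face_of S" "G \<noteq> {}" using that k unfolding faces_of_dim_def by auto
    then show ?thesis using cuts_vertex_no_face_in_hyperplane[OF S c] by blast
  qed
  ultimately show ?thesis using faces_of_section[OF S k] by auto
qed

lemma vertex_figure_subset_iff:
  fixes S :: "'a::euclidean_space set"
  assumes S: "polytope S" and c: "cuts_vertex S v a b"
    and G: "G face_of S" "v \<in> G" "G \<noteq> {v}" and G': "G' face_of S"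
  shows "G \<inter> {x. a \<bullet> x = b} \<subseteq> G' \<inter> {x. a \<bullet> x = b} \<longleftrightarrow> G \<subseteq> G'"
  using section_subset_face[OF G(1) G'] cuts_vertex_crosses_iff[OF S c G(1)] G by blast

lemma aff_dim_vertex_figure:
  fixes S :: "'a::euclidean_space set"
  assumes S: "polytope S" and c: "cuts_vertex S v a b" and G: "G face_of S" "v \<in> G" "G \<noteq> {v}"
  shows "aff_dim (G \<inter> {x. a \<bullet> x = b}) = aff_dim G - 1"
  using aff_dim_section cuts_vertex_crosses_iff[OF S c G(1)] G face_of_imp_convex by blast

text \<open>
  The vertex figure of a polygon is a segment, and its two endpoints are the traces of the edges at \<open>v\<close>.
\<close>

lemma polygon_two_edges_at_vertex:
  fixes S :: "'a::euclidean_space set"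
  assumes S: "polytope S" "aff_dim S = 2" and v: "v \<in> polytope_vertices S"
  shows "card {F \<in> faces_of_dim S 1. v \<in> F} = 2"
proof -
  obtain a b where c: "cuts_vertex S v a b" using cuts_vertex_exists[OF S(1) v] by blast
  let ?H = "{x. a \<bullet> x = b}"
  have "v \<in> S" using v polytope_vertices_subset by auto
  moreover have "S \<noteq> {v}" using S by auto
  ultimately have "aff_dim (S \<inter> ?H) = 1"
    using aff_dim_vertex_figure[OF S(1) c face_of_refl] S polytope_imp_convex by fastforce
  then have "card (faces_of_dim (S \<inter> ?H) 0) = 2"
    by (simp add: card_faces_of_dim_0 card_vertices_one_dim polytope_section S)
  then show ?thesis
    using bij_betw_same_card[OF vertex_figure_faces[OF S(1) c, of 0]] by simp
qed

text \<open>
  Passing to the vertex figure at a vertex of the ridge \<open>G\<close> lowers the dimensions of \<open>G\<close> and \<open>S\<close> by one and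
  keeps the facets through \<open>G\<close>. After finitely many such steps \<open>G\<close> is a vertex of a polygon.
\<close>

theorem ridge_in_two_facets:
  fixes S :: "'a::euclidean_space set"
  assumes "polytope S" "G \<in> faces_of_dim S (aff_dim S - 2)" "aff_dim S \<ge> 2"
  shows "card {F \<in> faces_of_dim S (aff_dim S - 1). G \<subseteq> F} = 2"
  using assms
proof (induction "nat (aff_dim S - 2)" arbitrary: S G)
  case 0
  then have d: "aff_dim S = 2" by simp
  then obtain v where v: "v \<in> polytope_vertices S" "G = {v}"
    using 0 faces_of_dim_0[of S] by auto
  show ?case using polygon_two_edges_at_vertex[OF 0(2) d v(1)] d v by simp
next
  case (Suc n)
  note S = Suc(3)
  let ?d = "aff_dim S"
  have d: "?d \<ge> 3" using Suc(2) by linarith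
  have G: "G face_of S" "aff_dim G = ?d - 2" using Suc(4) unfolding faces_of_dim_def by auto
  then have "polytope G" "G \<noteq> {}"
    using S face_of_polytope_polytope d by (blast, force)
  then obtain v where "v \<in> polytope_vertices G" using polytope_vertex_exists by blast
  then have v: "v \<in> polytope_vertices S" "v \<in> G" using G polytope_vertices_face by blast+
  obtain a b where c: "cuts_vertex S v a b" using cuts_vertex_exists[OF S v(1)] by blast
  let ?H = "{x. a \<bullet> x = b}"
  let ?R = "S \<inter> ?H"
  have SS: "S face_of S" using S face_of_refl polytope_imp_convex by blast
  have nv: "G \<noteq> {v}" "S \<noteq> {v}" using G d by auto
  have dR: "aff_dim ?R = ?d - 1"
    using aff_dim_vertex_figure[OF S c SS] nv v polytope_vertices_subset by blast
  have "aff_dim (G \<inter> ?H) = ?d - 3"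
    using aff_dim_vertex_figure[OF S c G(1)] nv v G by simp
  then have GR: "G \<inter> ?H \<in> faces_of_dim ?R (aff_dim ?R - 2)"
    using dR section_face[OF G(1)] unfolding faces_of_dim_def by auto
  have "card {F \<in> faces_of_dim ?R (aff_dim ?R - 1). G \<inter> ?H \<subseteq> F} = 2"
    by (rule Suc(1)) (use GR dR Suc(2) d polytope_section[OF S] in auto)
  moreover have bij: "bij_betw (\<lambda>F. F \<inter> ?H) {F \<in> faces_of_dim S (?d - 1). G \<subseteq> F}
      {F \<in> faces_of_dim ?R (aff_dim ?R - 1). G \<inter> ?H \<subseteq> F}"
  proof -
    have b: "bij_betw (\<lambda>F. F \<inter> ?H) {F \<in> faces_of_dim S (?d - 1). v \<in> F} (faces_of_dim ?R (?d - 2))"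
      using vertex_figure_faces[OF S c, of "?d - 2"] d by (simp add: algebra_simps)
    have sub: "G \<inter> ?H \<subseteq> F \<inter> ?H \<longleftrightarrow> G \<subseteq> F" if "F \<in> faces_of_dim S (?d - 1)" for F
      using vertex_figure_subset_iff[OF S c G(1) v(2) nv(1)] that
      unfolding faces_of_dim_def by auto
    show ?thesis
    proof (rule bij_betw_subset[OF b, THEN bij_betw_cong[THEN iffD1, rotated]])
      show "(\<lambda>F. F \<inter> ?H) ` {F \<in> faces_of_dim S (?d - 1). G \<subseteq> F} =
        {F \<in> faces_of_dim ?R (aff_dim ?R - 1). G \<inter> ?H \<subseteq> F}"
      proof (intro equalityI subsetI)
        fix K assume K: "K \<in> {F \<in> faces_of_dim ?R (aff_dim ?R - 1). G \<inter> ?H \<subseteq> F}"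
        then have "K \<in> faces_of_dim ?R (?d - 2)" using dR by simp
        then have "K \<in> (\<lambda>F. F \<inter> ?H) ` {F \<in> faces_of_dim S (?d - 1). v \<in> F}"
          using b unfolding bij_betw_def by simp
        then obtain F where F: "K = F \<inter> ?H" "F \<in> faces_of_dim S (?d - 1)" by blast
        then show "K \<in> (\<lambda>F. F \<inter> ?H) ` {F \<in> faces_of_dim S (?d - 1). G \<subseteq> F}"
          using sub[OF F(2)] K by blast
      next
        fix K assume "K \<in> (\<lambda>F. F \<inter> ?H) ` {F \<in> faces_of_dim S (?d - 1). G \<subseteq> F}"
        then obtain F where F: "K = F \<inter> ?H" "F \<in> faces_of_dim S (?d - 1)" "G \<subseteq> F" by blast
        then have "v \<in> F" using v by blast
        then have "K \<in> faces_of_dim ?R (?d - 2)"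
          using b F unfolding bij_betw_def by blast
        then show "K \<in> {F \<in> faces_of_dim ?R (aff_dim ?R - 1). G \<inter> ?H \<subseteq> F}"
          using F dR by auto
      qed
    qed (use v in auto)
  qed
  ultimately show ?case using bij_betw_same_card[OF bij] by (simp only:)
qed

lemma sum_card_incidence:
  assumes "finite A" "finite B"
  shows "(\<Sum>x\<in>A. card {y \<in> B. R x y}) = (\<Sum>y\<in>B. card {x \<in> A. R x y})"
  unfolding card_eq_sum using sum.swap_restrict[OF assms, of "\<lambda>_ _. 1::nat" R] by simp

text \<open>
  Both sides are half of the number of incident pairs of a vertex and an edge.
\<close>

lemma polygon_vertices_eq_edges:
  fixes S :: "'a::euclidean_space set"
  assumes S: "polytope S" "aff_dim S = 2"
  shows "card (faces_of_dim S 0) = card (faces_of_dim S 1)"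
proof -
  let ?V = "polytope_vertices S" and ?E = "faces_of_dim S 1"
  have "card {v \<in> ?V. v \<in> F} = 2" if "F \<in> ?E" for F
  proof -
    have F: "F face_of S" "aff_dim F = 1" using that unfolding faces_of_dim_def by auto
    have "{v \<in> ?V. v \<in> F} = polytope_vertices F" using polytope_vertices_face[OF F(1)] by auto
    then show ?thesis
      using card_vertices_one_dim face_of_polytope_polytope[OF S(1) F(1)] F by auto
  qed
  then have "(\<Sum>v\<in>?V. card {F \<in> ?E. v \<in> F}) = (\<Sum>F\<in>?E. 2)"
    by (subst sum_card_incidence) (auto simp: finite_polytope_vertices finite_faces_of_dim S)
  then show ?thesis
    using polygon_two_edges_at_vertex[OF S] by (simp add: card_faces_of_dim_0)
qed

section \<open>Euler's formula for 3-polytopes\<close>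

text \<open>
  The functionals that identify two given points form a null set.
\<close>

lemma functional_injective_on_finite:
  fixes V :: "'a::euclidean_space set"
  assumes "finite V"
  obtains c where "inj_on (\<lambda>v. c \<bullet> v) V"
proof -
  let ?N = "\<Union>(u, w)\<in>{(u, w) \<in> V \<times> V. u \<noteq> w}. {c. (u - w) \<bullet> c = 0}"
  have fin: "finite {(u, w) \<in> V \<times> V. u \<noteq> w}"
    by (rule finite_subset[of _ "V \<times> V"]) (use assms in auto)
  have "negligible ?N"
    by (rule negligible_Union[OF finite_imageI[OF fin]])
      (auto intro!: negligible_hyperplane)
  then have "?N \<noteq> UNIV" by (metis non_negligible_UNIV)
  then obtain c where c: "c \<notin> ?N" by auto
  have "inj_on (\<lambda>v. c \<bullet> v) V"
  proof (rule inj_onI)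
    fix u w assume "u \<in> V" "w \<in> V" "c \<bullet> u = c \<bullet> w"
    then show "u = w" using c by (auto simp: inner_diff_left inner_commute[of c])
  qed
  then show ?thesis using that by blast
qed

lemma height_range_of_face:
  fixes S :: "'a::euclidean_space set"
  assumes S: "polytope S" and inj: "inj_on (\<lambda>v. c \<bullet> v) (polytope_vertices S)"
    and G: "G face_of S" "aff_dim G \<ge> 1"
  obtains l h where "l \<in> polytope_vertices S" "h \<in> polytope_vertices S" "l \<in> G" "h \<in> G"
    "c \<bullet> l < c \<bullet> h" "\<And>s. crosses c s G \<longleftrightarrow> c \<bullet> l < s \<and> s < c \<bullet> h"
proof -
  let ?W = "polytope_vertices G"
  have pG: "polytope G" using S G face_of_polytope_polytope by blast
  have W: "?W = polytope_vertices S \<inter> G" using G polytope_vertices_face by blast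
  have fin: "finite ?W" using finite_polytope_vertices[OF pG] .
  have "G \<noteq> {}" using G by auto
  then have ne: "?W \<noteq> {}" using polytope_vertex_exists pG by blast
  obtain l where l: "l \<in> ?W" "\<And>w. w \<in> ?W \<Longrightarrow> c \<bullet> l \<le> c \<bullet> w"
    using ex_is_arg_min_if_finite[OF fin ne, of "(\<bullet>) c"] unfolding is_arg_min_def
    by (metis linorder_not_less)
  obtain h where h: "h \<in> ?W" "\<And>w. w \<in> ?W \<Longrightarrow> c \<bullet> w \<le> c \<bullet> h"
    using ex_is_arg_min_if_finite[OF fin ne, of "\<lambda>x. - (c \<bullet> x)"] unfolding is_arg_min_def
    by (metis linorder_not_less neg_less_iff_less)
  have "\<not> ?W \<subseteq> {l}"
  proof
    assume "?W \<subseteq> {l}"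
    then have "G = {l}" using polytope_eq_hull_vertices[OF pG] l by (metis convex_hull_singleton insert_absorb subset_singletonD empty_iff)
    then show False using G by simp
  qed
  then obtain w where "w \<in> ?W" "w \<noteq> l" by blast
  then have "c \<bullet> l < c \<bullet> w"
    using l W inj by (metis Int_iff inj_onD order_less_le)
  then have lh: "c \<bullet> l < c \<bullet> h" using h(2)[OF \<open>w \<in> ?W\<close>] by linarith
  have up: "c \<bullet> x \<le> c \<bullet> h" if "x \<in> G" for x using polytope_vertices_le[OF pG h(2) that] by blast
  have lo: "c \<bullet> l \<le> c \<bullet> x" if "x \<in> G" for x
    using polytope_vertices_le[OF pG, of "- c" "- (c \<bullet> l)"] l(2) that by auto
  have "crosses c s G \<longleftrightarrow> c \<bullet> l < s \<and> s < c \<bullet> h" for s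
  proof
    assume "crosses c s G"
    then obtain u u' where "u \<in> G" "c \<bullet> u < s" "u' \<in> G" "s < c \<bullet> u'" unfolding crosses_def by blast
    then show "c \<bullet> l < s \<and> s < c \<bullet> h" using up[of u'] lo[of u] by linarith
  next
    assume "c \<bullet> l < s \<and> s < c \<bullet> h"
    then show "crosses c s G" unfolding crosses_def using l h W by blast
  qed
  then show ?thesis using that l h W lh by blast
qed

text \<open>
  Levels \<open>t v\<close> in the gap between the height of \<open>v\<close> and the next greater height. For a highest \<open>v\<close> any level above \<open>v\<close> will do.
\<close>

lemma levels_just_above:
  fixes f :: "'a \<Rightarrow> real"
  assumes "finite V"
  obtains t where "\<And>v. v \<in> V \<Longrightarrow> f v < t v" "\<And>v w. v \<in> V \<Longrightarrow> w \<in> V \<Longrightarrow> f v < f w \<Longrightarrow> t v < f w"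
proof -
  have "\<exists>t. f v < t \<and> (\<forall>w\<in>V. f v < f w \<longrightarrow> t < f w)" for v
  proof -
    let ?M = "Min (insert (f v + 1) (f ` {w \<in> V. f v < f w}))"
    have fin: "finite (f ` {w \<in> V. f v < f w})" using assms by simp
    have M: "f v < ?M" using fin by (subst Min_gr_iff) auto
    have M2: "?M \<le> f w" if "w \<in> V" "f v < f w" for w
      using fin that by (intro Min_le) auto
    have "f v < (f v + ?M) / 2" using M by simp
    moreover have "(f v + ?M) / 2 < f w" if "w \<in> V" "f v < f w" for w
    proof -
      have "f v + ?M < f w + f w" by (rule add_less_le_mono[OF that(2) M2[OF that]])
      then show ?thesis by simp
    qed
    ultimately show ?thesis by blast
  qed
  then obtain t where "\<And>v. f v < t v \<and> (\<forall>w\<in>V. f v < f w \<longrightarrow> t v < f w)" by metis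
  then show ?thesis using that by blast
qed

text \<open>
  Let \<open>c\<close> be a linear functional that takes distinct values at the vertices, and compare, for each vertex \<open>v\<close>, the section at the
  height of \<open>v\<close> with the section just above \<open>v\<close>. An edge or a 2-face meets one more of the sections of the second
  kind than of the first kind in a crossing position: the section just above its lowest vertex. Hence the number of edges is the
  number of edge crossings of the second kind minus that of the first kind, and the same is true of the
  2-faces. Every section that is not empty or a single point is a polygon, and it has as many vertices
  as edges. So just above a vertex as many edges as 2-faces are crossed, whereas at the height of
  a vertex that is neither the lowest nor the highest one this vertex is itself a vertex of the polygon, and one more
  2-face than edges is crossed. Summing up, there are \<open>V - 2\<close> more edges than 2-faces.
\<close>

theorem euler_formula_3_polytope:
  fixes S :: "'a::euclidean_space set"
  assumes S: "polytope S" "aff_dim S = 3"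
  shows "card (faces_of_dim S 0) + card (faces_of_dim S 2) = card (faces_of_dim S 1) + 2"
proof -
  let ?V = "polytope_vertices S" and ?E = "faces_of_dim S 1" and ?F = "faces_of_dim S 2"
  have finV: "finite ?V" using finite_polytope_vertices S by blast
  note finE = finite_faces_of_dim[OF S(1), of 1]
  note finF = finite_faces_of_dim[OF S(1), of 2]
  have cS: "convex S" using S polytope_imp_convex by blast
  obtain c where inj: "inj_on (\<lambda>v. c \<bullet> v) ?V" using functional_injective_on_finite[OF finV] .
  obtain t where t: "\<And>v. v \<in> ?V \<Longrightarrow> c \<bullet> v < t v"
    "\<And>v w. v \<in> ?V \<Longrightarrow> w \<in> ?V \<Longrightarrow> c \<bullet> v < c \<bullet> w \<Longrightarrow> t v < c \<bullet> w"
    using levels_just_above[OF finV, of "\<lambda>v. c \<bullet> v"] by blast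
  \<comment> \<open>The additional crossing is just above the lowest vertex of \<open>G\<close>.\<close>
  have gap_level: "card {v \<in> ?V. crosses c (t v) G} = card {v \<in> ?V. crosses c (c \<bullet> v) G} + 1"
    if G: "G face_of S" "aff_dim G \<ge> 1" for G
  proof -
    obtain l h where lh: "l \<in> ?V" "h \<in> ?V" "c \<bullet> l < c \<bullet> h"
      and cr: "\<And>s. crosses c s G \<longleftrightarrow> c \<bullet> l < s \<and> s < c \<bullet> h"
      using height_range_of_face[OF S(1) inj G] by metis
    have "crosses c (t v) G \<longleftrightarrow> v = l \<or> crosses c (c \<bullet> v) G" if "v \<in> ?V" for v
    proof -
      have "c \<bullet> v < c \<bullet> l \<or> v = l \<or> c \<bullet> l < c \<bullet> v"
        using inj that lh(1) by (metis inj_onD linorder_neqE_linordered_idom)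
      then show ?thesis
        using t(1)[OF that] t(2)[OF that lh(1)] t(2)[OF that lh(2)] lh(3) cr by fastforce
    qed
    then have "{v \<in> ?V. crosses c (t v) G} = insert l {v \<in> ?V. crosses c (c \<bullet> v) G}"
      using lh(1) by auto
    moreover have "\<not> crosses c (c \<bullet> l) G" using cr by auto
    ultimately show ?thesis using finV by simp
  qed
  have no_edge: "\<not> e \<subseteq> {x. c \<bullet> x = s}" if "e \<in> ?E" for e s
  proof
    assume sub: "e \<subseteq> {x. c \<bullet> x = s}"
    have "e face_of S" "aff_dim e \<ge> 1" using that unfolding faces_of_dim_def by auto
    then obtain l h where "l \<in> e" "h \<in> e" "c \<bullet> l < c \<bullet> h"
      using height_range_of_face[OF S(1) inj] by metis
    moreover have "c \<bullet> l = s" "c \<bullet> h = s" using sub calculation by blast+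
    ultimately show False by simp
  qed
  have mono: "crosses c s G \<Longrightarrow> G face_of S \<Longrightarrow> crosses c s S" for s G
    using face_of_imp_subset unfolding crosses_def by blast
  \<comment> \<open>The vertices of the polygon are traces of edges, or vertices of \<open>S\<close> at this height;
    its edges are traces of 2-faces.\<close>
  have sec: "card {e \<in> ?E. crosses c s e} + card {v \<in> faces_of_dim S 0. v \<subseteq> {x. c \<bullet> x = s}}
      = card {f \<in> ?F. crosses c s f}" if cr: "crosses c s S" for s
  proof -
    let ?T = "S \<inter> {x. c \<bullet> x = s}"
    have T: "polytope ?T" "aff_dim ?T = 2"
      using polytope_section S aff_dim_section[OF cS cr] by auto
    have "{G \<in> faces_of_dim S 1. G \<subseteq> {x. c \<bullet> x = s}} = {}" using no_edge by blast
    then have "card (faces_of_dim ?T 1) = card {f \<in> ?F. crosses c s f}"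
      using card_faces_of_section[OF S(1), of 1 c s] by (simp only:) simp
    then show ?thesis
      using polygon_vertices_eq_edges[OF T] card_faces_of_section[OF S(1), of 0 c s] by simp
  qed
  have gap: "card {e \<in> ?E. crosses c (t v) e} = card {f \<in> ?F. crosses c (t v) f}"
    if v: "v \<in> ?V" for v
  proof (cases "crosses c (t v) S")
    case True
    have "c \<bullet> w \<noteq> t v" if "w \<in> ?V" for w
      using t(1)[OF v] t(2)[OF v that] by force
    then have "{w \<in> faces_of_dim S 0. w \<subseteq> {x. c \<bullet> x = t v}} = {}"
      unfolding faces_of_dim_0 by auto
    then show ?thesis using sec[OF True] by (simp only:) simp
  next
    case False
    then have "{e \<in> ?E. crosses c (t v) e} = {}" "{f \<in> ?F. crosses c (t v) f} = {}"
      using mono unfolding faces_of_dim_def by blast+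
    then show ?thesis by (simp only:)
  qed
  have level: "card {f \<in> ?F. crosses c (c \<bullet> v) f} = card {e \<in> ?E. crosses c (c \<bullet> v) e} +
      (if crosses c (c \<bullet> v) S then 1 else 0)" if v: "v \<in> ?V" for v
  proof (cases "crosses c (c \<bullet> v) S")
    case True
    have "{w \<in> faces_of_dim S 0. w \<subseteq> {x. c \<bullet> x = c \<bullet> v}} = {{v}}"
      unfolding faces_of_dim_0 using v inj by (auto dest: inj_onD)
    then show ?thesis using sec[OF True] True by simp
  next
    case False
    then have "{e \<in> ?E. crosses c (c \<bullet> v) e} = {}" "{f \<in> ?F. crosses c (c \<bullet> v) f} = {}"
      using mono unfolding faces_of_dim_def by blast+
    then show ?thesis using False by (simp only: if_False card.empty add_0)
  qed
  have inner: "card {v \<in> ?V. crosses c (c \<bullet> v) S} + 2 = card ?V"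
  proof -
    obtain l h where lh: "l \<in> ?V" "h \<in> ?V" "c \<bullet> l < c \<bullet> h"
      and cr: "\<And>s. crosses c s S \<longleftrightarrow> c \<bullet> l < s \<and> s < c \<bullet> h"
    proof -
      have "aff_dim S \<ge> 1" using S(2) by simp
      then show ?thesis using height_range_of_face[OF S(1) inj face_of_refl[OF cS]] that by metis
    qed
    have "c \<bullet> l \<le> c \<bullet> v \<and> c \<bullet> v \<le> c \<bullet> h" if "v \<in> ?V" for v
    proof -
      have "v \<in> S" using that polytope_vertices_subset by auto
      have "l \<in> S" "h \<in> S" using lh polytope_vertices_subset by auto
      then have "\<not> crosses c (c \<bullet> l) S" "\<not> crosses c (c \<bullet> h) S" using cr by auto
      then show ?thesis using \<open>v \<in> S\<close> \<open>l \<in> S\<close> \<open>h \<in> S\<close> lh(3) unfolding crosses_def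
        by (metis linorder_not_less)
    qed
    then have "{v \<in> ?V. crosses c (c \<bullet> v) S} = ?V - {l, h}"
      using cr lh inj by (auto simp: order_less_le dest: inj_onD)
    moreover have "card ?V = card (?V - {l, h}) + card {l, h}"
      using lh finV by (metis card_Diff_subset card_mono empty_subsetI finite.emptyI finite.insertI insert_subset le_add_diff_inverse2)
    moreover have "l \<noteq> h" using lh by auto
    ultimately show ?thesis by simp
  qed
  have count: "(\<Sum>v\<in>?V. card {G \<in> faces_of_dim S k. crosses c (t v) G}) =
      (\<Sum>v\<in>?V. card {G \<in> faces_of_dim S k. crosses c (c \<bullet> v) G}) + card (faces_of_dim S k)"
    if k: "k \<ge> 1" for k
  proof -
    have "(\<Sum>v\<in>?V. card {G \<in> faces_of_dim S k. crosses c (t v) G}) =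
        (\<Sum>G\<in>faces_of_dim S k. card {v \<in> ?V. crosses c (t v) G})"
      by (rule sum_card_incidence[OF finV finite_faces_of_dim[OF S(1)]])
    also have "\<dots> = (\<Sum>G\<in>faces_of_dim S k. card {v \<in> ?V. crosses c (c \<bullet> v) G} + 1)"
      by (rule sum.cong) (use gap_level k in \<open>auto simp: faces_of_dim_def\<close>)
    also have "\<dots> = (\<Sum>G\<in>faces_of_dim S k. card {v \<in> ?V. crosses c (c \<bullet> v) G}) + card (faces_of_dim S k)"
      by (simp only: sum.distrib) simp
    also have "(\<Sum>G\<in>faces_of_dim S k. card {v \<in> ?V. crosses c (c \<bullet> v) G}) =
        (\<Sum>v\<in>?V. card {G \<in> faces_of_dim S k. crosses c (c \<bullet> v) G})"
      by (rule sum_card_incidence[OF finV finite_faces_of_dim[OF S(1)], symmetric])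
    finally show ?thesis .
  qed
  have "(\<Sum>v\<in>?V. card {f \<in> ?F. crosses c (c \<bullet> v) f}) =
      (\<Sum>v\<in>?V. card {e \<in> ?E. crosses c (c \<bullet> v) e}) + card {v \<in> ?V. crosses c (c \<bullet> v) S}"
    using finV level by (simp add: sum.distrib sum.If_cases Int_def)
  moreover have "(\<Sum>v\<in>?V. card {e \<in> ?E. crosses c (t v) e}) = (\<Sum>v\<in>?V. card {f \<in> ?F. crosses c (t v) f})"
    using gap by (rule sum.cong[OF refl])
  ultimately show ?thesis
    using count[of 1] count[of 2] inner by (simp add: card_faces_of_dim_0)
qed

section \<open>Graphs of polytopes\<close>

lemma polytope_adj_iff:
  fixes S :: "'a::euclidean_space set"
  assumes S: "polytope S"
  shows "polytope_adj S u v \<longleftrightarrow> u \<in> polytope_vertices S \<and> v \<in> polytope_vertices S \<and> u \<noteq> v \<and>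
    (\<exists>e\<in>faces_of_dim S 1. u \<in> e \<and> v \<in> e)"
proof
  assume "polytope_adj S u v"
  then show "u \<in> polytope_vertices S \<and> v \<in> polytope_vertices S \<and> u \<noteq> v \<and>
    (\<exists>e\<in>faces_of_dim S 1. u \<in> e \<and> v \<in> e)"
    unfolding polytope_adj_def edge_of_def faces_of_dim_def by force
next
  assume *: "u \<in> polytope_vertices S \<and> v \<in> polytope_vertices S \<and> u \<noteq> v \<and>
    (\<exists>e\<in>faces_of_dim S 1. u \<in> e \<and> v \<in> e)"
  then obtain e where e: "e face_of S" "aff_dim e = 1" "u \<in> e" "v \<in> e"
    unfolding faces_of_dim_def by auto
  obtain p q where pq: "e = closed_segment p q" "polytope_vertices e = {p, q}"
    using one_dim_polytope_segment[OF face_of_polytope_polytope[OF S e(1)] e(2)] by metis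
  have "{u, v} \<subseteq> {p, q}" using pq polytope_vertices_face[OF e(1)] * e by auto
  then have "{u, v} = {p, q}" using * by auto
  then have "e = closed_segment u v" using pq closed_segment_commute by (metis doubleton_eq_iff)
  then show "polytope_adj S u v" unfolding polytope_adj_def edge_of_def using * e by auto
qed

lemma edge_vertices:
  fixes S :: "'a::euclidean_space set"
  assumes S: "polytope S" and e: "e \<in> faces_of_dim S 1" and v: "v \<in> polytope_vertices S" "v \<in> e"
  obtains w where "polytope_adj S v w" "e = closed_segment v w" "polytope_vertices S \<inter> e = {v, w}"
proof -
  have e': "e face_of S" "aff_dim e = 1" using e unfolding faces_of_dim_def by auto
  obtain p q where pq: "p \<noteq> q" "e = closed_segment p q" "polytope_vertices e = {p, q}"
    using one_dim_polytope_segment[OF face_of_polytope_polytope[OF S e'(1)] e'(2)] by metis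
  have pe: "polytope_vertices e = polytope_vertices S \<inter> e"
    using polytope_vertices_face[OF e'(1)] .
  define w where "w = (if v = p then q else p)"
  have "v \<in> {p, q}" using pq pe v by auto
  then have w: "{v, w} = {p, q}" "v \<noteq> w" unfolding w_def using pq by auto
  then have "e = closed_segment v w" using pq closed_segment_commute by (metis doubleton_eq_iff)
  moreover have "polytope_adj S v w"
  proof -
    have "w \<in> polytope_vertices S" "w \<in> e" using w pe pq(3) by auto
    then show ?thesis unfolding polytope_adj_iff[OF S] using w v e by blast
  qed
  ultimately show ?thesis using that w pe pq by auto
qed

text \<open>
  The segment from \<open>v\<close> to any other vertex passes through the vertex figure at \<open>v\<close>. The vertices of
  the vertex figure lie on the edges at \<open>v\<close>, so the functional does not exceed its value at \<open>v\<close> there, nor further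
  along the segment.
\<close>

lemma edge_local_max_imp_global_max:
  fixes S :: "'a::euclidean_space set"
  assumes S: "polytope S" and v: "v \<in> polytope_vertices S"
    and loc: "\<And>e x. e \<in> faces_of_dim S 1 \<Longrightarrow> v \<in> e \<Longrightarrow> x \<in> e \<Longrightarrow> c \<bullet> x \<le> c \<bullet> v"
    and x: "x \<in> S"
  shows "c \<bullet> x \<le> c \<bullet> v"
proof -
  obtain a b where ab: "cuts_vertex S v a b" using cuts_vertex_exists[OF S v] by blast
  let ?H = "{x. a \<bullet> x = b}"
  let ?T = "S \<inter> ?H"
  have T: "polytope ?T" using polytope_section S by blast
  have "c \<bullet> w \<le> c \<bullet> v" if w: "w \<in> polytope_vertices ?T" for w
  proof -
    have "{w} \<in> faces_of_dim ?T 0" using w unfolding faces_of_dim_0 by auto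
    then obtain e where "e \<in> faces_of_dim S 1" "v \<in> e" "{w} = e \<inter> ?H"
      using vertex_figure_faces[OF S ab, of 0] unfolding bij_betw_def by auto
    then show ?thesis using loc by blast
  qed
  then have onT: "c \<bullet> y \<le> c \<bullet> v" if "y \<in> ?T" for y
    using polytope_vertices_le[OF T _ that] by blast
  have "c \<bullet> w \<le> c \<bullet> v" if w: "w \<in> polytope_vertices S" for w
  proof (cases "w = v")
    case False
    then have wb: "a \<bullet> w < b" and vb: "b < a \<bullet> v" using ab w unfolding cuts_vertex_def by auto
    define s where "s = (a \<bullet> v - b) / (a \<bullet> v - a \<bullet> w)"
    have s: "0 < s" "s < 1" using wb vb unfolding s_def by (auto simp: divide_simps)
    define y where "y = (1 - s) *\<^sub>R v + s *\<^sub>R w"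
    have "v \<in> S" "w \<in> S" using v w polytope_vertices_subset by auto
    then have "y \<in> S" unfolding y_def
      using polytope_imp_convex[OF S] s by (intro convexD) auto
    moreover have "a \<bullet> y = b"
    proof -
      have "a \<bullet> y = a \<bullet> v - s * (a \<bullet> v - a \<bullet> w)"
        unfolding y_def by (simp add: inner_add_right algebra_simps)
      also have "s * (a \<bullet> v - a \<bullet> w) = a \<bullet> v - b" unfolding s_def using wb vb by simp
      finally show ?thesis by simp
    qed
    ultimately have "c \<bullet> y \<le> c \<bullet> v" using onT by auto
    then have "s * (c \<bullet> w - c \<bullet> v) \<le> 0"
      unfolding y_def by (simp add: inner_add_right algebra_simps)
    then show ?thesis using s by (simp add: mult_le_0_iff)
  qed auto
  then show ?thesis using polytope_vertices_le[OF S _ x] by blast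
qed

text \<open>
  If \<open>z\<close> is not in the union \<open>W\<close> of some components, let \<open>c\<close> be a functional whose only maximum over the vertices
  is at \<open>z\<close>. A maximal point of \<open>W\<close> with respect to \<open>c\<close> is a local and hence a global maximum, which is absurd.
\<close>

theorem polytope_graph_connected:
  fixes S :: "'a::euclidean_space set"
  assumes S: "polytope S" and W: "W \<subseteq> polytope_vertices S" "W \<noteq> {}"
    and cl: "\<And>u u'. u \<in> W \<Longrightarrow> polytope_adj S u u' \<Longrightarrow> u' \<in> W"
  shows "W = polytope_vertices S"
proof (rule ccontr)
  assume "W \<noteq> polytope_vertices S"
  then obtain z where z: "z \<in> polytope_vertices S" "z \<notin> W" using W by auto
  obtain c b where c: "cuts_vertex S z c b" using cuts_vertex_exists[OF S z(1)] by blast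
  have "finite W" using W finite_polytope_vertices[OF S] finite_subset by blast
  then obtain u where u: "u \<in> W" "\<And>w. w \<in> W \<Longrightarrow> c \<bullet> w \<le> c \<bullet> u"
    using ex_is_arg_min_if_finite[of W "\<lambda>x. - (c \<bullet> x)"] W(2) unfolding is_arg_min_def
    by (metis linorder_not_less neg_less_iff_less)
  have uV: "u \<in> polytope_vertices S" using u W by auto
  have "c \<bullet> x \<le> c \<bullet> u" if e: "e \<in> faces_of_dim S 1" "u \<in> e" "x \<in> e" for e x
  proof -
    obtain w where w: "polytope_adj S u w" "e = closed_segment u w"
      using edge_vertices[OF S e(1) uV e(2)] by metis
    then have "c \<bullet> w \<le> c \<bullet> u" using u cl by blast
    have "closed_segment u w \<subseteq> {x. c \<bullet> x \<le> c \<bullet> u}"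
      by (rule closed_segment_subset) (use \<open>c \<bullet> w \<le> c \<bullet> u\<close> convex_halfspace_le in auto)
    then show ?thesis using e w by auto
  qed
  then have "c \<bullet> z \<le> c \<bullet> u"
    using edge_local_max_imp_global_max[OF S uV] z polytope_vertices_subset by blast
  moreover have "c \<bullet> u < b" "b < c \<bullet> z" using c uV u z unfolding cuts_vertex_def by auto
  ultimately show False by linarith
qed

section \<open>Faces of a polytope after cutting off disjoint faces\<close>

text \<open>
  One simultaneous cut. The situation occurs twice: for the original polytope and its vertices, and for the
  resulting polytope and the shortened edges.
\<close>

locale cutting =
  fixes P :: "'a::euclidean_space set" and \<F> :: "'a set set" and a :: "'a set \<Rightarrow> 'a" and b :: "'a set \<Rightarrow> real"
  assumes polytope: "polytope P"
    and face: "F \<in> \<F> \<Longrightarrow> F face_of P"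
    and vertex_in: "F \<in> \<F> \<Longrightarrow> v \<in> polytope_vertices P \<Longrightarrow> v \<in> F \<Longrightarrow> a F \<bullet> v > b F"
    and vertex_out: "F \<in> \<F> \<Longrightarrow> v \<in> polytope_vertices P \<Longrightarrow> v \<notin> F \<Longrightarrow> a F \<bullet> v < b F"
    and pieces_disjoint: "F \<in> \<F> \<Longrightarrow> G \<in> \<F> \<Longrightarrow> F \<noteq> G \<Longrightarrow> x \<in> P \<Longrightarrow> a F \<bullet> x \<ge> b F \<Longrightarrow> a G \<bullet> x < b G"
begin

definition H :: "'a set \<Rightarrow> 'a set" where "H F = {x. a F \<bullet> x = b F}"

definition Q :: "'a set" where "Q = P \<inter> (\<Inter>F\<in>\<F>. {x. a F \<bullet> x \<le> b F})"

lemma finite_cut_faces: "finite \<F>"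
  by (rule finite_subset[OF _ finite_polytope_faces[OF polytope]]) (use face in auto)

lemma polytope_Q: "polytope Q"
  unfolding Q_def
  by (intro polytope_Int_polyhedron polytope polyhedron_Inter)
    (auto simp: finite_cut_faces polyhedron_halfspace_le)

lemma Q_subset: "Q \<subseteq> P"
  unfolding Q_def by auto

lemma cut_face_gt:
  assumes "F \<in> \<F>" "x \<in> F" shows "a F \<bullet> x > b F"
proof -
  have "polytope F" using face[OF assms(1)] polytope face_of_polytope_polytope by blast
  then show ?thesis
    using polytope_vertices_gt[of F "b F" "a F" x] vertex_in[OF assms(1)] polytope_vertices_face[OF face[OF assms(1)]] assms(2)
    by blast
qed

lemma Q_disjoint_cut_face: "F \<in> \<F> \<Longrightarrow> x \<in> F \<Longrightarrow> x \<notin> Q"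
  using cut_face_gt unfolding Q_def by force

lemma meets_cut_face:
  assumes F: "F \<in> \<F>" and G: "G face_of P" "x \<in> G" "a F \<bullet> x \<ge> b F"
  shows "G \<inter> F \<noteq> {}"
proof
  assume "G \<inter> F = {}"
  moreover have "polytope_vertices G = polytope_vertices P \<inter> G" by (rule polytope_vertices_face[OF G(1)])
  ultimately have "\<And>v. v \<in> polytope_vertices G \<Longrightarrow> a F \<bullet> v < b F"
    using vertex_out[OF F] by blast
  then have "a F \<bullet> x < b F"
    using polytope_vertices_lt[OF face_of_polytope_polytope[OF polytope G(1)]] G(2) by blast
  then show False using G(3) by linarith
qed

lemma crosses_cut_iff:
  assumes F: "F \<in> \<F>" and G: "G face_of P"
  shows "crosses (a F) (b F) G \<longleftrightarrow> G \<inter> F \<noteq> {} \<and> \<not> G \<subseteq> F"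
proof
  assume c: "crosses (a F) (b F) G"
  then have "G \<inter> F \<noteq> {}"
    using meets_cut_face[OF F G] unfolding crosses_def by (metis less_imp_le)
  moreover have "\<not> G \<subseteq> F"
    using c cut_face_gt[OF F] unfolding crosses_def by fastforce
  ultimately show "G \<inter> F \<noteq> {} \<and> \<not> G \<subseteq> F" by blast
next
  assume *: "G \<inter> F \<noteq> {} \<and> \<not> G \<subseteq> F"
  have pG: "polytope G" using G polytope face_of_polytope_polytope by blast
  have vG: "polytope_vertices G = polytope_vertices P \<inter> G" using G polytope_vertices_face by blast
  have "\<not> polytope_vertices G \<subseteq> F"
  proof
    assume "polytope_vertices G \<subseteq> F"
    then have "convex hull (polytope_vertices G) \<subseteq> F"
      using face[OF F] face_of_imp_convex by (intro hull_minimal) blast+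
    then show False using polytope_eq_hull_vertices[OF pG] * by auto
  qed
  then obtain w where "w \<in> G" "w \<in> polytope_vertices P" "w \<notin> F" using vG by auto
  then have "w \<in> G" "a F \<bullet> w < b F" using vertex_out[OF F] by auto
  moreover obtain u where "u \<in> G \<inter> F" using * by blast
  then have "u \<in> G" "a F \<bullet> u > b F" using cut_face_gt[OF F] by auto
  ultimately show "crosses (a F) (b F) G" unfolding crosses_def by blast
qed

text \<open>
  The cutting sections survive in full, because a section lies in a closed piece and so is disjoint
  from all the other pieces.
\<close>

lemma section_subset_Q:
  assumes "F \<in> \<F>" shows "P \<inter> H F \<subseteq> Q"
proof
  fix x assume x: "x \<in> P \<inter> H F"
  have "a G \<bullet> x \<le> b G" if "G \<in> \<F>" for G
    using pieces_disjoint[OF assms that, of x] x unfolding H_def by force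
  then show "x \<in> Q" using x unfolding Q_def by auto
qed

lemma section_face_of_Q:
  assumes "F \<in> \<F>" shows "P \<inter> H F face_of Q"
proof -
  have "P \<inter> H F = Q \<inter> {x. a F \<bullet> x = b F}"
    using section_subset_Q[OF assms] Q_subset unfolding H_def by auto
  moreover have "Q \<inter> {x. a F \<bullet> x = b F} face_of Q"
    by (rule face_of_Int_supporting_hyperplane_le)
      (use assms polytope_imp_convex[OF polytope_Q] in \<open>auto simp: Q_def\<close>)
  ultimately show ?thesis by simp
qed

lemma kept_face: "G face_of P \<Longrightarrow> G \<inter> Q face_of Q"
  using face_of_slice[of G P Q] polytope_imp_convex[OF polytope_Q] Q_subset
  by (simp add: Int_absorb1)

lemma new_face: "G face_of P \<Longrightarrow> F \<in> \<F> \<Longrightarrow> G \<inter> H F face_of Q"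
  using section_face[of G P "a F" "b F"] section_face_of_Q[of F] face_of_trans
  unfolding H_def by blast

lemma sections_disjoint:
  "F \<in> \<F> \<Longrightarrow> F' \<in> \<F> \<Longrightarrow> x \<in> P \<Longrightarrow> x \<in> H F \<Longrightarrow> x \<in> H F' \<Longrightarrow> F = F'"
  using pieces_disjoint[of F F' x] unfolding H_def by force

text \<open>
  If the hyperplane of \<open>F\<close> crosses \<open>G\<close>, start at a point of \<open>G\<close> on this hyperplane. It satisfies the other
  inequalities strictly, and they remain strict on a short move within \<open>G\<close> to the inner side.
\<close>

lemma kept_face_strict_point:
  assumes G: "G face_of P" "G \<noteq> {}" and nF: "\<And>F. F \<in> \<F> \<Longrightarrow> \<not> G \<subseteq> F"
  obtains x where "x \<in> G" "\<And>F. F \<in> \<F> \<Longrightarrow> a F \<bullet> x < b F"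
proof (cases "\<exists>F\<in>\<F>. G \<inter> F \<noteq> {}")
  case False
  obtain x where "x \<in> G" using G by auto
  moreover have "a F \<bullet> x < b F" if "F \<in> \<F>" for F
    using meets_cut_face[OF that G(1) \<open>x \<in> G\<close>] False that by force
  ultimately show ?thesis using that by blast
next
  case True
  then obtain F where F: "F \<in> \<F>" "G \<inter> F \<noteq> {}" by blast
  then have cr: "crosses (a F) (b F) G" using crosses_cut_iff[OF _ G(1)] nF by blast
  have cG: "convex G" using G face_of_imp_convex by blast
  obtain y where y: "y \<in> G" "a F \<bullet> y = b F"
    using crosses_rel_interior[OF cG cr] rel_interior_subset by blast
  obtain w where w: "w \<in> G" "a F \<bullet> w < b F" using cr unfolding crosses_def by blast
  let ?U = "\<Inter>F'\<in>\<F> - {F}. {x. a F' \<bullet> x < b F'}"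
  have "open ?U" using finite_cut_faces by (intro open_INT) (auto simp: open_halfspace_lt)
  have "y \<in> P" using y G face_of_imp_subset by blast
  then have "y \<in> ?U" using pieces_disjoint[OF F(1), of _ y] y by force
  define g where "g t = (1 - t) *\<^sub>R y + t *\<^sub>R w" for t :: real
  have "(g \<longlongrightarrow> (1 - 0) *\<^sub>R y + 0 *\<^sub>R w) (at_right 0)"
    unfolding g_def by (intro tendsto_intros)
  then have lim: "(g \<longlongrightarrow> y) (at_right 0)" by simp
  then have "\<forall>\<^sub>F t in at_right 0. g t \<in> ?U"
    by (rule topological_tendstoD) fact+
  moreover have "\<forall>\<^sub>F t in at_right (0::real). t < 1 \<and> 0 < t"
    unfolding eventually_at_right_field by (intro exI[of _ 1]) auto
  ultimately have "\<forall>\<^sub>F t in at_right 0. g t \<in> ?U \<and> t < 1 \<and> 0 < t"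
    by (rule eventually_conj)
  then obtain t where t: "g t \<in> ?U" "t < 1" "0 < t"
    using eventually_happens'[OF trivial_limit_at_right_real] by blast
  have "g t \<in> G" unfolding g_def using t y w by (intro convexD[OF cG]) auto
  moreover have "a F' \<bullet> g t < b F'" if "F' \<in> \<F>" for F'
  proof (cases "F' = F")
    case True
    have "a F \<bullet> g t = b F + t * (a F \<bullet> w - b F)"
      unfolding g_def using y by (simp add: inner_add_right algebra_simps)
    then show ?thesis using w t True by (simp add: mult_pos_neg)
  next
    case False
    then show ?thesis using t that by auto
  qed
  ultimately show ?thesis using that by blast
qed

lemma aff_dim_kept_face:
  assumes G: "G face_of P" "G \<noteq> {}" and nF: "\<And>F. F \<in> \<F> \<Longrightarrow> \<not> G \<subseteq> F"
  shows "aff_dim (G \<inter> Q) = aff_dim G"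
proof -
  obtain x where x: "x \<in> G" "\<And>F. F \<in> \<F> \<Longrightarrow> a F \<bullet> x < b F"
    using kept_face_strict_point[OF assms] by blast
  let ?U = "\<Inter>F\<in>\<F>. {x. a F \<bullet> x < b F}"
  have "open ?U" using finite_cut_faces by (intro open_INT) (auto simp: open_halfspace_lt)
  then have "aff_dim (G \<inter> ?U) = aff_dim G"
    using x G by (intro aff_dim_convex_Int_open face_of_imp_convex[OF G(1)]) auto
  moreover have "G \<inter> ?U \<subseteq> G \<inter> Q"
    using G(1) face_of_imp_subset unfolding Q_def by fastforce
  ultimately show ?thesis
    using aff_dim_subset[of "G \<inter> ?U" "G \<inter> Q"] aff_dim_subset[of "G \<inter> Q" G] by auto
qed

lemma aff_dim_new_face:
  assumes "G face_of P" "F \<in> \<F>" "G \<inter> F \<noteq> {}" "\<not> G \<subseteq> F"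
  shows "aff_dim (G \<inter> H F) = aff_dim G - 1"
  using aff_dim_section[of G "a F" "b F"] crosses_cut_iff[OF assms(2,1)] assms face_of_imp_convex
  unfolding H_def by blast

lemma kept_subset_imp_subset:
  assumes G: "G face_of P" "G \<noteq> {}" "\<And>F. F \<in> \<F> \<Longrightarrow> \<not> G \<subseteq> F" and G': "G' face_of P" "G \<inter> Q \<subseteq> G'"
  shows "G \<subseteq> G'"
proof -
  have "G \<inter> Q \<subseteq> G \<inter> G'" using G' by auto
  then have "aff_dim G \<le> aff_dim (G \<inter> G')"
    using aff_dim_kept_face[OF G] aff_dim_subset by metis
  moreover have "aff_dim (G \<inter> G') \<le> aff_dim G" by (simp add: aff_dim_subset)
  ultimately have "G \<inter> G' = G"
    using face_subset_aff_dim_eq[OF face_of_Int[OF G(1) G'(1)] G(1)] by simp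
  then show ?thesis by blast
qed

lemma new_subset_imp_subset:
  assumes "G face_of P" "F \<in> \<F>" "G \<inter> F \<noteq> {}" "\<not> G \<subseteq> F" "G' face_of P" "G \<inter> H F \<subseteq> G'"
  shows "G \<subseteq> G'"
  using section_subset_face[OF assms(1,5)] crosses_cut_iff[OF assms(2,1)] assms
  unfolding H_def by blast

text \<open>
  Let \<open>x\<close> be a relative interior point of a face \<open>K\<close> of \<open>Q\<close>. If \<open>x\<close> is on the hyperplane of some \<open>F\<close>, then \<open>K\<close> is a face of
  the section of \<open>P\<close> by it. Otherwise \<open>P\<close> and \<open>Q\<close> coincide near \<open>x\<close>, and \<open>K\<close> is cut out of the carrier of \<open>x\<close> in \<open>P\<close>.
\<close>

lemma faces_of_dim_Q:
  assumes k: "0 \<le> k"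
  shows "faces_of_dim Q k =
    {G \<inter> Q | G. G \<in> faces_of_dim P k \<and> (\<forall>F\<in>\<F>. \<not> G \<subseteq> F)} \<union>
    {G \<inter> H F | G F. G \<in> faces_of_dim P (k + 1) \<and> F \<in> \<F> \<and> G \<inter> F \<noteq> {} \<and> \<not> G \<subseteq> F}"
    (is "_ = ?A \<union> ?B")
proof (intro equalityI subsetI)
  fix K assume "K \<in> faces_of_dim Q k"
  then have K: "K face_of Q" "aff_dim K = k" unfolding faces_of_dim_def by auto
  then have "K \<noteq> {}" using k by auto
  then obtain x where x: "x \<in> rel_interior K"
    using face_of_imp_convex[OF K(1)] rel_interior_eq_empty by blast
  then have xQ: "x \<in> K" "x \<in> Q" "x \<in> P"
    using K rel_interior_subset face_of_imp_subset Q_subset by blast+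
  show "K \<in> ?A \<union> ?B"
  proof (cases "\<exists>F\<in>\<F>. x \<in> H F")
    case True
    then obtain F where F: "F \<in> \<F>" "x \<in> H F" by blast
    have "K \<subseteq> P \<inter> H F"
      using face_subset_if_rel_interior_meets[OF K(1) section_face_of_Q[OF F(1)] x] xQ F by blast
    then have "K face_of P \<inter> H F"
      using K(1) section_subset_Q[OF F(1)] face_of_subset by blast
    then obtain G where G: "G face_of P" "K = G \<inter> H F" "G \<subseteq> H F \<or> crosses (a F) (b F) G"
      using section_face_cases[OF polytope _ \<open>K \<noteq> {}\<close>] unfolding H_def by metis
    have "\<not> G \<subseteq> H F"
    proof
      assume "G \<subseteq> H F"
      have "polytope G" "G \<noteq> {}"
        using G \<open>K \<noteq> {}\<close> face_of_polytope_polytope[OF polytope] by auto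
      then obtain v where "v \<in> polytope_vertices G" using polytope_vertex_exists by blast
      then have "v \<in> polytope_vertices P" "a F \<bullet> v = b F"
        using polytope_vertices_face[OF G(1)] \<open>G \<subseteq> H F\<close> unfolding H_def by auto
      then show False using vertex_in[OF F(1)] vertex_out[OF F(1)] by (metis less_irrefl)
    qed
    then have cr: "G \<inter> F \<noteq> {} \<and> \<not> G \<subseteq> F" using G crosses_cut_iff[OF F(1)] by blast
    then have "aff_dim G = k + 1" using aff_dim_new_face[OF G(1) F(1)] G K by simp
    then have "G \<in> faces_of_dim P (k + 1)" using G unfolding faces_of_dim_def by simp
    then have "K \<in> ?B" using G F cr by blast
    then show ?thesis by blast
  next
    case False
    then have st: "a F \<bullet> x < b F" if "F \<in> \<F>" for F
      using xQ(2) that unfolding Q_def H_def by (force simp: order_less_le)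
    obtain G where G: "G face_of P" "x \<in> rel_interior G"
      using polytope_carrier_face[OF polytope xQ(3)] by blast
    let ?S = "\<Inter>F\<in>\<F>. {x. a F \<bullet> x \<le> b F}" and ?U = "\<Inter>F\<in>\<F>. {x. a F \<bullet> x < b F}"
    have "open ?U" using finite_cut_faces by (intro open_INT) (auto simp: open_halfspace_lt)
    moreover have "?U \<subseteq> ?S" by (auto simp: less_imp_le)
    ultimately have "?U \<subseteq> interior ?S" by (rule interior_maximal[rotated])
    then have "x \<in> interior ?S" using st by blast
    then have xS: "x \<in> rel_interior ?S" using interior_subset_rel_interior by blast
    have cS: "convex ?S" by (intro convex_INT convex_halfspace_le)
    have "rel_interior (G \<inter> ?S) = rel_interior G \<inter> rel_interior ?S"
      by (rule convex_rel_interior_inter_two[OF face_of_imp_convex[OF G(1)] cS]) (use G xS in blast)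
    moreover have "G \<inter> ?S = G \<inter> Q" using face_of_imp_subset[OF G(1)] unfolding Q_def by blast
    ultimately have "x \<in> rel_interior (G \<inter> Q)" using G xS by auto
    then have KG: "K = G \<inter> Q" using face_of_eq[OF K(1) kept_face[OF G(1)]] x by blast
    have xG: "x \<in> G" using G rel_interior_subset by blast
    have nF: "\<not> G \<subseteq> F" if "F \<in> \<F>" for F
      using cut_face_gt[OF that, of x] st[OF that] xG by force
    have "G \<noteq> {}" using xG by blast
    then have "aff_dim (G \<inter> Q) = aff_dim G" by (rule aff_dim_kept_face[OF G(1)]) (rule nF)
    then have "aff_dim G = k" using K KG by simp
    then have "G \<in> faces_of_dim P k" using G unfolding faces_of_dim_def by simp
    then have "K = G \<inter> Q \<and> G \<in> faces_of_dim P k \<and> (\<forall>F\<in>\<F>. \<not> G \<subseteq> F)"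
      using KG nF by simp
    then have "K \<in> ?A" by (intro CollectI exI)
    then show ?thesis by (rule UnI1)
  qed
next
  fix K assume "K \<in> ?A \<union> ?B"
  then show "K \<in> faces_of_dim Q k"
  proof
    assume "K \<in> ?A"
    then obtain G where G: "G face_of P" "aff_dim G = k" "\<forall>F\<in>\<F>. \<not> G \<subseteq> F" "K = G \<inter> Q"
      unfolding faces_of_dim_def by auto
    then have "G \<noteq> {}" using k by auto
    then have "aff_dim K = k" using G aff_dim_kept_face[OF G(1)] by blast
    then show ?thesis using G kept_face unfolding faces_of_dim_def by blast
  next
    assume "K \<in> ?B"
    then obtain G F where G: "G face_of P" "aff_dim G = k + 1" "F \<in> \<F>" "G \<inter> F \<noteq> {}" "\<not> G \<subseteq> F" "K = G \<inter> H F"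
      unfolding faces_of_dim_def by auto
    then have "aff_dim K = k" using aff_dim_new_face[OF G(1,3,4,5)] by simp
    then show ?thesis using G new_face unfolding faces_of_dim_def by blast
  qed
qed

end

lemma cut_off_cutting:
  fixes P :: "'a::euclidean_space set"
  assumes "polytope P" "cut_off P \<F> R"
  obtains a b where "cutting P \<F> a b" "R = cutting.Q P \<F> a b"
proof -
  obtain a b where v: "\<forall>F\<in>\<F>. \<forall>v \<in> polytope_vertices P.
           (v \<in> F \<longrightarrow> a F \<bullet> v > b F) \<and> (v \<notin> F \<longrightarrow> a F \<bullet> v < b F)"
    and d: "\<forall>F\<in>\<F>. \<forall>G\<in>\<F>. F \<noteq> G \<longrightarrow>
           disjnt (P \<inter> {x. a F \<bullet> x \<ge> b F}) (P \<inter> {x. a G \<bullet> x \<ge> b G})"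
    and R: "R = P \<inter> (\<Inter>F\<in>\<F>. {x. a F \<bullet> x \<le> b F})"
    using assms(2) unfolding cut_off_def by blast
  have c: "cutting P \<F> a b"
  proof
    fix F G x assume "F \<in> \<F>" "G \<in> \<F>" "F \<noteq> G" "x \<in> P" "a F \<bullet> x \<ge> b F"
    moreover have "disjnt (P \<inter> {x. a F \<bullet> x \<ge> b F}) (P \<inter> {x. a G \<bullet> x \<ge> b G})"
      using d \<open>F \<in> \<F>\<close> \<open>G \<in> \<F>\<close> \<open>F \<noteq> G\<close> by blast
    ultimately have "\<not> a G \<bullet> x \<ge> b G" unfolding disjnt_def by blast
    then show "a G \<bullet> x < b G" by simp
  qed (use assms v in \<open>auto simp: cut_off_def\<close>)
  then show ?thesis using that R cutting.Q_def[OF c] by blast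
qed

section \<open>The flags of a polytope as the vertices of its truncation\<close>

definition flags :: "'a::euclidean_space set \<Rightarrow> ('a \<times> 'a set \<times> 'a set) set" where
  "flags P = {(v, e, f). v \<in> polytope_vertices P \<and> e \<in> faces_of_dim P 1 \<and> f \<in> faces_of_dim P 2 \<and>
     v \<in> e \<and> e \<subseteq> f}"

text \<open>
  The two successive cuts. The second family of hyperplanes is indexed by the shortened edges.
\<close>

locale vertex_edge_cut =
  V: cutting P "{{v} | v. v \<in> polytope_vertices P}" a1 b1 +
  E: cutting "cutting.Q P {{v} | v. v \<in> polytope_vertices P} a1 b1"
    "{e \<inter> cutting.Q P {{v} | v. v \<in> polytope_vertices P} a1 b1 | e. e edge_of P}" a2 b2
  for P :: "'a::euclidean_space set" and a1 b1 a2 b2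
begin

abbreviation "P' \<equiv> V.Q"
abbreviation "Q \<equiv> E.Q"

definition hv :: "'a \<Rightarrow> 'a set" where "hv v = V.H {v}"
definition he :: "'a set \<Rightarrow> 'a set" where "he e = E.H (e \<inter> P')"

lemma P'_subset: "P' \<subseteq> P" by (rule V.Q_subset)
lemma Q_subset_P': "Q \<subseteq> P'" by (rule E.Q_subset)

lemma face_not_in_vertex:
  assumes "G \<in> faces_of_dim P k" "k \<ge> 1"
  shows "G face_of P" "aff_dim G = k" "G \<noteq> {}" "\<And>v. \<not> G \<subseteq> {v}"
    "\<And>F. F \<in> {{v} | v. v \<in> polytope_vertices P} \<Longrightarrow> \<not> G \<subseteq> F"
proof -
  show *: "G face_of P" "aff_dim G = k" using assms unfolding faces_of_dim_def by auto
  show "G \<noteq> {}" using * assms by auto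
  show **: "\<not> G \<subseteq> {v}" for v using * assms aff_dim_subset[of G "{v}"] by auto
  show "\<And>F. F \<in> {{v} | v. v \<in> polytope_vertices P} \<Longrightarrow> \<not> G \<subseteq> F" using ** by blast
qed

lemma vertex_notin_P': "v \<in> polytope_vertices P \<Longrightarrow> v \<notin> P'"
  using V.Q_disjoint_cut_face[of "{v}" v] by blast

lemma hv_subset: "v \<in> polytope_vertices P \<Longrightarrow> P \<inter> hv v \<subseteq> P'"
  unfolding hv_def by (rule V.section_subset_Q) blast

lemma hv_disjoint:
  "v \<in> polytope_vertices P \<Longrightarrow> v' \<in> polytope_vertices P \<Longrightarrow> x \<in> P \<Longrightarrow> x \<in> hv v \<Longrightarrow> x \<in> hv v' \<Longrightarrow> v = v'"
  using V.sections_disjoint[of "{v}" "{v'}" x] unfolding hv_def by blast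

lemma face_meets_hv:
  assumes "v \<in> polytope_vertices P" "G face_of P" "x \<in> G" "x \<in> hv v"
  shows "v \<in> G"
  using V.meets_cut_face[of "{v}" G x] assms unfolding hv_def V.H_def by fastforce

lemma new_face_dim:
  assumes "v \<in> polytope_vertices P" "G \<in> faces_of_dim P k" "k \<ge> 1" "v \<in> G"
  shows "G \<inter> hv v \<in> faces_of_dim P' (k - 1)"
  using V.new_face[of G "{v}"] V.aff_dim_new_face[of G "{v}"] face_not_in_vertex[OF assms(2,3)] assms
  unfolding hv_def faces_of_dim_def by blast

lemma kept_face_dim:
  assumes "G \<in> faces_of_dim P k" "k \<ge> 1"
  shows "G \<inter> P' \<in> faces_of_dim P' k"
  using V.kept_face[of G] V.aff_dim_kept_face[of G] face_not_in_vertex[OF assms] assms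
  unfolding faces_of_dim_def by blast

lemma P'_new_subset:
  assumes "v \<in> polytope_vertices P" "G \<in> faces_of_dim P k" "k \<ge> 1" "v \<in> G" "G' face_of P"
    "G \<inter> hv v \<subseteq> G'"
  shows "G \<subseteq> G'"
  using V.new_subset_imp_subset[of G "{v}" G'] face_not_in_vertex[OF assms(2,3)] assms
  unfolding hv_def by blast

lemma P'_kept_subset:
  assumes "G \<in> faces_of_dim P k" "k \<ge> 1" "G' face_of P" "G \<inter> P' \<subseteq> G'"
  shows "G \<subseteq> G'"
  using V.kept_subset_imp_subset[of G G'] face_not_in_vertex[OF assms(1,2)] assms by blast

lemma faces_of_dim_P':
  assumes "k \<ge> 0"
  shows "K \<in> faces_of_dim P' k \<longleftrightarrow>
    (\<exists>G \<in> faces_of_dim P k. k \<ge> 1 \<and> K = G \<inter> P') \<or>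
    (\<exists>G \<in> faces_of_dim P (k + 1). \<exists>v \<in> polytope_vertices P. v \<in> G \<and> K = G \<inter> hv v)" (is "_ \<longleftrightarrow> ?A \<or> ?B")
proof
  assume "K \<in> faces_of_dim P' k"
  then consider G where "G \<in> faces_of_dim P k" "\<forall>F\<in>{{v} | v. v \<in> polytope_vertices P}. \<not> G \<subseteq> F" "K = G \<inter> P'"
    | G v where "G \<in> faces_of_dim P (k + 1)" "v \<in> polytope_vertices P" "G \<inter> {v} \<noteq> {}" "K = G \<inter> V.H {v}"
    unfolding V.faces_of_dim_Q[OF assms] by blast
  then show "?A \<or> ?B"
  proof cases
    case (1 G)
    have "k \<noteq> 0"
    proof
      assume "k = 0"
      then have "G \<in> faces_of_dim P 0" using 1 by simp
      then obtain v where "v \<in> polytope_vertices P" "G = {v}" unfolding faces_of_dim_0 by auto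
      then show False using 1 by blast
    qed
    then show ?thesis using 1 assms by auto
  next
    case (2 G v)
    then show ?thesis unfolding hv_def by blast
  qed
next
  assume "?A \<or> ?B"
  then show "K \<in> faces_of_dim P' k"
    using kept_face_dim new_face_dim[of _ _ "k + 1"] assms by auto
qed

text \<open>
  A face that meets \<open>e\<close> without containing it does so in a vertex of \<open>P\<close>, and these are no longer present in \<open>P'\<close>.
\<close>

lemma edge_meets_face:
  assumes e: "e \<in> faces_of_dim P 1" and G: "G face_of P" and x: "x \<in> e" "x \<in> P'" "x \<in> G"
  shows "e \<subseteq> G"
proof (rule ccontr)
  assume "\<not> e \<subseteq> G"
  have e': "e face_of P" "aff_dim e = 1" using e unfolding faces_of_dim_def by auto
  have eG: "e \<inter> G face_of P" using face_of_Int e' G by blast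
  then have "e \<inter> G face_of e" using face_of_face[OF e'(1)] by blast
  then have "aff_dim (e \<inter> G) < aff_dim e"
    using face_of_aff_dim_lt[of e "e \<inter> G"] \<open>\<not> e \<subseteq> G\<close> face_of_imp_convex[OF e'(1)] by blast
  moreover have "e \<inter> G \<noteq> {}" using x by blast
  then have "aff_dim (e \<inter> G) \<noteq> -1" by (simp add: aff_dim_empty)
  ultimately have "aff_dim (e \<inter> G) = 0" using e'(2) aff_dim_geq[of "e \<inter> G"] by linarith
  then have "e \<inter> G \<in> faces_of_dim P 0" using eG unfolding faces_of_dim_def by blast
  then obtain v where "v \<in> polytope_vertices P" "e \<inter> G = {v}" unfolding faces_of_dim_0 by auto
  moreover have "x \<in> e \<inter> G" using x by blast
  ultimately have "x \<in> polytope_vertices P" by simp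
  then show False using x vertex_notin_P' by blast
qed

lemma shortened_edge_inj:
  assumes "e \<in> faces_of_dim P 1" "e' \<in> faces_of_dim P 1" "e \<inter> P' = e' \<inter> P'"
  shows "e = e'"
  using P'_kept_subset[of e 1 e'] P'_kept_subset[of e' 1 e] assms face_not_in_vertex(1)[of _ 1] by auto

lemma edge_of_iff: "e edge_of S \<longleftrightarrow> e \<in> faces_of_dim S 1"
  unfolding edge_of_def faces_of_dim_def by auto

lemma shortened_edge_mem: "e \<in> faces_of_dim P 1 \<Longrightarrow> e \<inter> P' \<in> {e \<inter> P' | e. e edge_of P}"
  by (auto simp: edge_of_iff)

lemma he_disjoint:
  assumes "e \<in> faces_of_dim P 1" "e' \<in> faces_of_dim P 1" "x \<in> P'" "x \<in> he e" "x \<in> he e'"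
  shows "e = e'"
  using E.sections_disjoint[OF shortened_edge_mem shortened_edge_mem, of e e' x] assms shortened_edge_inj
  unfolding he_def by blast

text \<open>
  For a face \<open>L\<close> of \<open>P'\<close>, this is the condition under which cutting off the shortened edge of \<open>e\<close> creates a new face in \<open>L\<close>.
\<close>

abbreviation "crosses_edge L e \<equiv> L \<inter> (e \<inter> P') \<noteq> {} \<and> \<not> L \<subseteq> e \<inter> P'"

text \<open>
  Distinct shortened edges are disjoint, so that the cut of one edge does not affect another one.
\<close>

lemma crosses_edge_edge:
  assumes "e \<in> faces_of_dim P 1" "e' \<in> faces_of_dim P 1"
  shows "\<not> crosses_edge (e' \<inter> P') e"
proof
  assume c: "crosses_edge (e' \<inter> P') e"
  then obtain x where "x \<in> e" "x \<in> P'" "x \<in> e'" by blast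
  then have "e \<subseteq> e'" using edge_meets_face assms face_not_in_vertex(1)[OF assms(2)] by auto
  moreover have "e' \<subseteq> e"
    using edge_meets_face[of e' e x] \<open>x \<in> e\<close> \<open>x \<in> P'\<close> \<open>x \<in> e'\<close> assms face_not_in_vertex(1)[OF assms(1)] by auto
  ultimately show False using c by blast
qed

text \<open>
  The face of \<open>P'\<close> that cutting off \<open>v\<close> creates in \<open>G\<close> meets a shortened edge only in the endpoint near \<open>v\<close>.
\<close>

lemma crosses_edge_new:
  assumes e: "e \<in> faces_of_dim P 1" and v: "v \<in> polytope_vertices P" and G: "G \<in> faces_of_dim P k" "k \<ge> 2" "v \<in> G"
  shows "crosses_edge (G \<inter> hv v) e \<longleftrightarrow> v \<in> e \<and> e \<subseteq> G"
proof
  have eP: "e face_of P" "G face_of P" using e G unfolding faces_of_dim_def by auto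
  {
    assume "crosses_edge (G \<inter> hv v) e"
    then obtain x where x: "x \<in> G" "x \<in> hv v" "x \<in> e" "x \<in> P'" by blast
    then show "v \<in> e \<and> e \<subseteq> G" using face_meets_hv[OF v eP(1)] edge_meets_face[OF e eP(2)] by blast
  }
  assume *: "v \<in> e \<and> e \<subseteq> G"
  have 0: "e \<inter> hv v \<in> faces_of_dim P' 0" using new_face_dim[OF v e] * by simp
  then have "e \<inter> hv v \<noteq> {}" unfolding faces_of_dim_def by auto
  moreover have "e \<inter> hv v \<subseteq> P'" using hv_subset[OF v] face_of_imp_subset[OF eP(1)] by blast
  ultimately have 1: "(G \<inter> hv v) \<inter> (e \<inter> P') \<noteq> {}" using * by blast
  have "\<not> G \<inter> hv v \<subseteq> e \<inter> P'"
  proof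
    assume "G \<inter> hv v \<subseteq> e \<inter> P'"
    then have "G \<inter> hv v \<subseteq> e \<inter> hv v" by blast
    then have "aff_dim (G \<inter> hv v) \<le> aff_dim (e \<inter> hv v)" by (rule aff_dim_subset)
    moreover have "G \<inter> hv v \<in> faces_of_dim P' (k - 1)" using new_face_dim[OF v G(1)] G by simp
    ultimately show False using 0 G unfolding faces_of_dim_def by simp
  qed
  with 1 show "crosses_edge (G \<inter> hv v) e" by blast
qed

lemma crosses_edge_kept:
  assumes e: "e \<in> faces_of_dim P 1" and G: "G \<in> faces_of_dim P k" "k \<ge> 2"
  shows "crosses_edge (G \<inter> P') e \<longleftrightarrow> e \<subseteq> G"
proof
  have eP: "e face_of P" "G face_of P" using e G unfolding faces_of_dim_def by auto
  {
    assume "crosses_edge (G \<inter> P') e"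
    then show "e \<subseteq> G" using edge_meets_face[OF e eP(2)] by blast
  }
  assume *: "e \<subseteq> G"
  have "e \<inter> P' \<in> faces_of_dim P' 1" using kept_face_dim[OF e] by simp
  then have "e \<inter> P' \<noteq> {}" unfolding faces_of_dim_def by auto
  moreover have "\<not> G \<inter> P' \<subseteq> e \<inter> P'"
  proof
    assume "G \<inter> P' \<subseteq> e \<inter> P'"
    then have "G \<subseteq> e" using P'_kept_subset[OF G(1) _ eP(1)] G(2) by auto
    then show False using aff_dim_subset[of G e] G e unfolding faces_of_dim_def by simp
  qed
  ultimately show "crosses_edge (G \<inter> P') e" using * by blast
qed

lemma faces_of_dim_Q_new:
  "L \<in> faces_of_dim P' (k + 1) \<Longrightarrow> e \<in> faces_of_dim P 1 \<Longrightarrow> crosses_edge L e \<Longrightarrow> k \<ge> 0 \<Longrightarrow>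
    L \<inter> he e \<in> faces_of_dim Q k"
  using shortened_edge_mem[of e] unfolding he_def E.faces_of_dim_Q by blast

lemma faces_of_dim_Q_kept:
  assumes "L \<in> faces_of_dim P' k" "\<And>e. e \<in> faces_of_dim P 1 \<Longrightarrow> \<not> L \<subseteq> e \<inter> P'" "k \<ge> 0"
  shows "L \<inter> Q \<in> faces_of_dim Q k"
proof -
  have "\<forall>F\<in>{e \<inter> P' | e. e edge_of P}. \<not> L \<subseteq> F" using assms(2) by (auto simp: edge_of_iff)
  then show ?thesis using assms(1) unfolding E.faces_of_dim_Q[OF assms(3)] by blast
qed

lemma faces_of_dim_Q_cases:
  assumes "K \<in> faces_of_dim Q k" "k \<ge> 0"
  obtains (kept) L where "L \<in> faces_of_dim P' k" "\<And>e. e \<in> faces_of_dim P 1 \<Longrightarrow> \<not> L \<subseteq> e \<inter> P'" "K = L \<inter> Q"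
  | (new) L e where "L \<in> faces_of_dim P' (k + 1)" "e \<in> faces_of_dim P 1" "crosses_edge L e" "K = L \<inter> he e"
proof -
  consider (1) L where "L \<in> faces_of_dim P' k" "\<forall>F\<in>{e \<inter> P' | e. e edge_of P}. \<not> L \<subseteq> F" "K = L \<inter> Q"
    | (2) L F where "L \<in> faces_of_dim P' (k + 1)" "F \<in> {e \<inter> P' | e. e edge_of P}"
      "L \<inter> F \<noteq> {}" "\<not> L \<subseteq> F" "K = L \<inter> E.H F"
    using assms(1) unfolding E.faces_of_dim_Q[OF assms(2)] by blast
  then show ?thesis
  proof cases
    case 1
    have "\<not> L \<subseteq> e \<inter> P'" if "e \<in> faces_of_dim P 1" for e
      using 1(2) shortened_edge_mem[OF that] by (rule bspec)
    then show ?thesis by (rule kept[OF 1(1) _ 1(3)])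
  next
    case 2
    then obtain e where e: "F = e \<inter> P'" "e edge_of P" by blast
    then have "e \<in> faces_of_dim P 1" by (simp add: edge_of_iff)
    then show ?thesis by (rule new[OF 2(1)]) (use 2 e in \<open>auto simp: he_def\<close>)
  qed
qed

lemma Q_new_subset:
  assumes "L face_of P'" "e \<in> faces_of_dim P 1" "crosses_edge L e" "L' face_of P'" "L \<inter> he e \<subseteq> L'"
  shows "L \<subseteq> L'"
  using E.new_subset_imp_subset[OF assms(1) shortened_edge_mem[OF assms(2)]] assms unfolding he_def by blast

text \<open>
  The flag \<open>(v, e, f)\<close> gives a singleton: cutting off \<open>v\<close> turns \<open>f\<close> into a segment, one of
  whose endpoints is on \<open>e\<close>, and cutting off \<open>e\<close> truncates this segment there.
\<close>

fun cell :: "'a \<times> 'a set \<times> 'a set \<Rightarrow> 'a set" where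
  "cell (v, e, f) = f \<inter> hv v \<inter> he e"

lemma flag_facts:
  assumes "(v, e, f) \<in> flags P"
  shows "v \<in> polytope_vertices P" "e \<in> faces_of_dim P 1" "f \<in> faces_of_dim P 2" "v \<in> e" "v \<in> f" "e \<subseteq> f"
    "f \<inter> hv v \<in> faces_of_dim P' 1" "f \<inter> hv v face_of P'" "crosses_edge (f \<inter> hv v) e"
    "cell (v, e, f) \<in> faces_of_dim Q 0"
proof -
  show *: "v \<in> polytope_vertices P" "e \<in> faces_of_dim P 1" "f \<in> faces_of_dim P 2" "v \<in> e" "e \<subseteq> f"
    using assms unfolding flags_def by auto
  then show "v \<in> f" by blast
  then show L: "f \<inter> hv v \<in> faces_of_dim P' 1" using new_face_dim[of v f 2] * by simp
  then show "f \<inter> hv v face_of P'" unfolding faces_of_dim_def by blast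
  show c: "crosses_edge (f \<inter> hv v) e" using crosses_edge_new[of e v f 2] * by auto
  show "cell (v, e, f) \<in> faces_of_dim Q 0" using faces_of_dim_Q_new[of _ 0 e] L c * by simp
qed

text \<open>
  No vertex of \<open>P'\<close> survives the second cut, since each of them is an endpoint of a shortened edge. So a vertex of \<open>Q\<close>
  is the trace of a cut on an edge of \<open>P'\<close>. This edge is not a shortened one, so it was created within
  a 2-face by cutting off a vertex.
\<close>

lemma vertices_of_Q_are_cells: "faces_of_dim Q 0 = cell ` flags P"
proof (intro equalityI subsetI)
  fix K assume "K \<in> faces_of_dim Q 0"
  then show "K \<in> cell ` flags P"
  proof (cases rule: faces_of_dim_Q_cases[OF _ order_refl, consumes 1, case_names kept new])
    case (kept L)
    then obtain e v where e: "e \<in> faces_of_dim P 1" "v \<in> polytope_vertices P" "v \<in> e" "L = e \<inter> hv v"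
      using faces_of_dim_P'[of 0 L] by auto
    then have "L \<subseteq> e \<inter> P'"
      using hv_subset[OF e(2)] face_not_in_vertex(1)[OF e(1)] face_of_imp_subset by fastforce
    then show ?thesis using kept(2)[OF e(1)] by blast
  next
    case (new L e)
    then consider e' where "e' \<in> faces_of_dim P 1" "L = e' \<inter> P'"
      | f v where "f \<in> faces_of_dim P 2" "v \<in> polytope_vertices P" "v \<in> f" "L = f \<inter> hv v"
      using faces_of_dim_P'[of 1 L] by auto
    then show ?thesis
    proof cases
      case 1
      then show ?thesis using crosses_edge_edge new by blast
    next
      case (2 f v)
      then have "v \<in> e \<and> e \<subseteq> f" using crosses_edge_new[OF new(2) 2(2,1)] new(3) by simp
      then have "(v, e, f) \<in> flags P" using new(2) 2 unfolding flags_def by blast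
      moreover have "K = cell (v, e, f)" using new 2 by simp
      ultimately show ?thesis by blast
    qed
  qed
next
  fix K assume "K \<in> cell ` flags P"
  then show "K \<in> faces_of_dim Q 0" using flag_facts(10) by force
qed

text \<open>
  The edges of \<open>Q\<close> are of three types: along the edge of type \<open>v, f\<close> of this lemma the edge \<open>e\<close> of a flag changes,
  along the type \<open>e, f\<close> the vertex changes, and along the type \<open>v, e, F\<close>, where \<open>F\<close> is a
  facet, the 2-face changes.
\<close>

lemma edge_of_Q_vertex_face:
  assumes "v \<in> polytope_vertices P" "f \<in> faces_of_dim P 2" "v \<in> f"
  shows "f \<inter> hv v \<inter> Q \<in> faces_of_dim Q 1"
proof (rule faces_of_dim_Q_kept)
  show L: "f \<inter> hv v \<in> faces_of_dim P' 1" using new_face_dim[of v f 2] assms by simp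
  show "\<not> f \<inter> hv v \<subseteq> e \<inter> P'" if e: "e \<in> faces_of_dim P 1" for e
  proof
    assume sub: "f \<inter> hv v \<subseteq> e \<inter> P'"
    have "f \<inter> hv v \<noteq> {}" using L unfolding faces_of_dim_def by auto
    then have "crosses_edge (f \<inter> hv v) e"
      using crosses_edge_new[OF e assms(1,2)] sub edge_meets_face[OF e face_not_in_vertex(1)[OF assms(2)]]
        face_meets_hv[OF assms(1) face_not_in_vertex(1)[OF e]] assms(3) by auto
    then show False using sub by blast
  qed
qed simp

lemma edge_of_Q_edge_face:
  assumes "e \<in> faces_of_dim P 1" "f \<in> faces_of_dim P 2" "e \<subseteq> f"
  shows "f \<inter> P' \<inter> he e \<in> faces_of_dim Q 1"
  using faces_of_dim_Q_new[of "f \<inter> P'" 1 e] kept_face_dim[of f 2] crosses_edge_kept[of e f 2] assms by simp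

lemma edge_of_Q_vertex_edge_facet:
  assumes "v \<in> polytope_vertices P" "e \<in> faces_of_dim P 1" "F \<in> faces_of_dim P 3" "v \<in> e" "e \<subseteq> F"
  shows "F \<inter> hv v \<inter> he e \<in> faces_of_dim Q 1"
  using faces_of_dim_Q_new[of "F \<inter> hv v" 1 e] new_face_dim[of v F 3] crosses_edge_new[of e v F 3] assms by auto

lemma edge_of_Q_cases:
  assumes "K \<in> faces_of_dim Q 1"
  obtains (vf) v f where "v \<in> polytope_vertices P" "f \<in> faces_of_dim P 2" "v \<in> f" "K = f \<inter> hv v \<inter> Q"
  | (ef) e f where "e \<in> faces_of_dim P 1" "f \<in> faces_of_dim P 2" "e \<subseteq> f" "K = f \<inter> P' \<inter> he e"
  | (veF) v e F where "v \<in> polytope_vertices P" "e \<in> faces_of_dim P 1" "F \<in> faces_of_dim P 3" "v \<in> e" "e \<subseteq> F"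
      "K = F \<inter> hv v \<inter> he e"
proof (cases rule: faces_of_dim_Q_cases[OF assms zero_le_one, case_names kept new])
  case (kept L)
  then consider e' where "e' \<in> faces_of_dim P 1" "L = e' \<inter> P'"
    | f v where "f \<in> faces_of_dim P 2" "v \<in> polytope_vertices P" "v \<in> f" "L = f \<inter> hv v"
    using faces_of_dim_P'[of 1 L] by auto
  then show ?thesis using kept vf by cases blast+
next
  case (new L e)
  then consider f where "f \<in> faces_of_dim P 2" "L = f \<inter> P'"
    | F v where "F \<in> faces_of_dim P 3" "v \<in> polytope_vertices P" "v \<in> F" "L = F \<inter> hv v"
    using faces_of_dim_P'[of 2 L] by auto
  then show ?thesis
  proof cases
    case 1
    then show ?thesis using ef new crosses_edge_kept[of e _ 2] by auto
  next
    case 2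
    then show ?thesis using veF new crosses_edge_new[of e _ _ 3] by auto
  qed
qed

lemma cell_nonempty: assumes "t \<in> flags P" shows "cell t \<noteq> {}"
proof -
  have "aff_dim (cell t) = 0" using flag_facts(10) assms unfolding faces_of_dim_def by (cases t) blast
  then show ?thesis by auto
qed

lemma cell_subset_P': assumes "t \<in> flags P" shows "cell t \<subseteq> P'"
  using flag_facts(10) assms face_of_imp_subset Q_subset_P' unfolding faces_of_dim_def
  by (cases t) blast

lemma cell_in_hv:
  assumes t: "(v, e, f) \<in> flags P" and v': "v' \<in> polytope_vertices P" and s: "cell (v, e, f) \<subseteq> hv v'"
  shows "v = v'"
proof -
  obtain x where "x \<in> cell (v, e, f)" using cell_nonempty[OF t] by blast
  then show ?thesis
    using hv_disjoint[OF flag_facts(1)[OF t] v', of x] s cell_subset_P'[OF t] P'_subset by auto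
qed

lemma cell_in_he:
  assumes t: "(v, e, f) \<in> flags P" and e': "e' \<in> faces_of_dim P 1" and s: "cell (v, e, f) \<subseteq> he e'"
  shows "e = e'"
proof -
  obtain x where "x \<in> cell (v, e, f)" using cell_nonempty[OF t] by blast
  then show ?thesis
    using he_disjoint[OF flag_facts(2)[OF t] e', of x] s cell_subset_P'[OF t] by auto
qed

text \<open>
  The two cuts are undone one after the other: a face that contains the trace of a crossing hyperplane on another face
  contains that other face.
\<close>

lemma cell_in_face:
  assumes t: "(v, e, f) \<in> flags P" and G: "G face_of P" and s: "cell (v, e, f) \<subseteq> G"
  shows "f \<subseteq> G"
proof -
  have "f \<inter> hv v \<inter> he e \<subseteq> G \<inter> P'" using s cell_subset_P'[OF t] by auto
  then have "f \<inter> hv v \<subseteq> G \<inter> P'"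
    using Q_new_subset[OF flag_facts(8,2,9)[OF t]] V.kept_face[OF G] by blast
  then show ?thesis using P'_new_subset[OF flag_facts(1,3)[OF t] _ flag_facts(5)[OF t] G] by auto
qed

lemma cell_in_2face:
  assumes t: "(v, e, f) \<in> flags P" and G: "G \<in> faces_of_dim P 2" and s: "cell (v, e, f) \<subseteq> G"
  shows "f = G"
  using cell_in_face[OF t _ s] face_subset_aff_dim_eq[of f P G] G flag_facts(3)[OF t]
  unfolding faces_of_dim_def by auto

lemma cell_inj: "inj_on cell (flags P)"
proof (rule inj_onI)
  fix s t assume s: "s \<in> flags P" and t: "t \<in> flags P" and eq: "cell s = cell t"
  obtain v e f v' e' f' where st: "s = (v, e, f)" "t = (v', e', f')" by (cases s, cases t) auto
  have "cell (v, e, f) \<subseteq> hv v'" "cell (v, e, f) \<subseteq> he e'" "cell (v, e, f) \<subseteq> f'"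
    using eq st by auto
  then show "s = t"
    using cell_in_hv[of v e f v'] cell_in_he[of v e f e'] cell_in_2face[of v e f f'] s t st flag_facts(1-3) by auto
qed

lemma edges_of_Q_at_cell:
  assumes t: "(v, e, f) \<in> flags P"
  shows "{K \<in> faces_of_dim Q 1. cell (v, e, f) \<subseteq> K} =
    {f \<inter> hv v \<inter> Q, f \<inter> P' \<inter> he e} \<union> (\<lambda>F. F \<inter> hv v \<inter> he e) ` {F \<in> faces_of_dim P 3. f \<subseteq> F}"
    (is "?L = ?R")
proof (intro equalityI subsetI)
  note tf = flag_facts[OF t]
  have cQ: "cell (v, e, f) \<subseteq> Q" using tf(10) face_of_imp_subset unfolding faces_of_dim_def by blast
  fix K
  {
    assume "K \<in> ?L"
    then have K: "K \<in> faces_of_dim Q 1" and sub: "cell (v, e, f) \<subseteq> K" by auto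
    show "K \<in> ?R" using K
    proof (cases rule: edge_of_Q_cases)
      case (vf v' f')
      then have "v = v'" "f = f'" using cell_in_hv[OF t vf(1)] cell_in_2face[OF t vf(2)] sub by blast+
      then show ?thesis using vf by blast
    next
      case (ef e' f')
      then have "e = e'" "f = f'" using cell_in_he[OF t ef(1)] cell_in_2face[OF t ef(2)] sub by blast+
      then show ?thesis using ef by blast
    next
      case (veF v' e' F)
      have "F face_of P" using veF unfolding faces_of_dim_def by blast
      then have "v = v'" "e = e'" "f \<subseteq> F"
        using cell_in_hv[OF t veF(1)] cell_in_he[OF t veF(2)] cell_in_face[OF t _] sub veF(6) by blast+
      then show ?thesis using veF by blast
    qed
  }
  assume "K \<in> ?R"
  then consider "K = f \<inter> hv v \<inter> Q" | "K = f \<inter> P' \<inter> he e"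
    | F where "F \<in> faces_of_dim P 3" "f \<subseteq> F" "K = F \<inter> hv v \<inter> he e" by blast
  then show "K \<in> ?L"
  proof cases
    case 1
    then show ?thesis using edge_of_Q_vertex_face[OF tf(1,3,5)] cQ by auto
  next
    case 2
    then show ?thesis using edge_of_Q_edge_face[OF tf(2,3,6)] cell_subset_P'[OF t] by auto
  next
    case 3
    then show ?thesis using edge_of_Q_vertex_edge_facet[OF tf(1,2) 3(1) tf(4)] tf(6) by auto
  qed
qed

text \<open>
  There is one edge of each of the first two types, and one edge of the third type for each of the two facets
  that contain \<open>f\<close>; what remains is that these four are distinct.
\<close>

lemma card_edges_of_Q_at_cell:
  assumes t: "(v, e, f) \<in> flags P" and d: "aff_dim P = 4"
  shows "card {K \<in> faces_of_dim Q 1. cell (v, e, f) \<subseteq> K} = 4"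
proof -
  note tf = flag_facts[OF t]
  let ?F = "{F \<in> faces_of_dim P 3. f \<subseteq> F}"
  let ?g = "\<lambda>F. F \<inter> hv v \<inter> he e"
  have vF: "v \<in> F" "e \<subseteq> F" if "F \<in> ?F" for F using that tf by auto
  have FL: "F \<inter> hv v face_of P'" "crosses_edge (F \<inter> hv v) e" "F face_of P" if "F \<in> ?F" for F
    using new_face_dim[of v F 3] crosses_edge_new[of e v F 3] tf that vF[OF that] unfolding faces_of_dim_def by auto
  have c2: "card ?F = 2"
    using ridge_in_two_facets[OF V.polytope, of f] d tf(3) by simp
  have inj: "inj_on ?g ?F"
  proof (rule inj_onI)
    have sub: "F \<subseteq> F'" if "F \<in> ?F" "F' \<in> ?F" "?g F = ?g F'" for F F'
    proof -
      have "F \<inter> hv v \<subseteq> F' \<inter> hv v"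
        using Q_new_subset[OF FL(1)[OF that(1)] tf(2) FL(2)[OF that(1)] FL(1)[OF that(2)]] that by blast
      then show ?thesis
        using P'_new_subset[OF tf(1), of F 3 F'] vF that FL by auto
    qed
    fix F F' assume "F \<in> ?F" "F' \<in> ?F" "?g F = ?g F'"
    then show "F = F'" using sub[of F F'] sub[of F' F] by auto
  qed
  \<comment> \<open>The edge in \<open>f \<inter> hv v\<close> has a point off the hyperplane of \<open>e\<close>, and the edge in \<open>f \<inter> P'\<close> has
    one off the hyperplane of \<open>v\<close>.\<close>
  have n1: "\<not> f \<inter> hv v \<inter> Q \<subseteq> he e"
  proof -
    have ne: "f \<inter> hv v \<noteq> {}" using tf(7) unfolding faces_of_dim_def by auto
    have nF: "\<not> f \<inter> hv v \<subseteq> F" if F: "F \<in> {e \<inter> P' |e. e edge_of P}" for F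
    proof
      assume s: "f \<inter> hv v \<subseteq> F"
      obtain e' where e': "e' \<in> faces_of_dim P 1" "F = e' \<inter> P'" using F by (auto simp: edge_of_iff)
      then have "crosses_edge (f \<inter> hv v) e'"
        using crosses_edge_new[OF e'(1) tf(1,3)] s ne tf(5)
          edge_meets_face[OF e'(1) face_not_in_vertex(1)[OF tf(3)]]
          face_meets_hv[OF tf(1) face_not_in_vertex(1)[OF e'(1)]] by auto
      then show False using s e' by blast
    qed
    obtain x where x: "x \<in> f \<inter> hv v" "\<And>F. F \<in> {e \<inter> P' |e. e edge_of P} \<Longrightarrow> a2 F \<bullet> x < b2 F"
      using E.kept_face_strict_point[OF tf(8) ne nF] by blast
    have "x \<in> P'" using x tf(8) face_of_imp_subset by blast
    then have "x \<in> Q" using x(2) unfolding E.Q_def by (auto intro: less_imp_le)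
    moreover have "x \<notin> he e" using x(2)[of "e \<inter> P'"] tf(2) edge_of_iff
      unfolding he_def E.H_def by force
    ultimately show ?thesis using x by blast
  qed
  have n2: "\<not> f \<inter> P' \<inter> he e \<subseteq> hv v"
  proof
    assume s: "f \<inter> P' \<inter> he e \<subseteq> hv v"
    have L: "f \<inter> P' face_of P'" "crosses_edge (f \<inter> P') e"
      using kept_face_dim[OF tf(3)] crosses_edge_kept[OF tf(2,3)] tf(6) unfolding faces_of_dim_def by auto
    have "P \<inter> hv v face_of P'" using V.section_face_of_Q[of "{v}"] tf(1) unfolding hv_def by blast
    then have "f \<inter> P' \<subseteq> P \<inter> hv v"
      using Q_new_subset[OF L(1) tf(2) L(2)] s P'_subset by blast
    moreover obtain x where x: "x \<in> f" "\<And>F. F \<in> {{v} |v. v \<in> polytope_vertices P} \<Longrightarrow> a1 F \<bullet> x < b1 F"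
    proof -
      note fv = face_not_in_vertex[OF tf(3)]
      have "\<not> f \<subseteq> F" if "F \<in> {{v} |v. v \<in> polytope_vertices P}" for F using fv(5)[OF _ that] by simp
      then show ?thesis using V.kept_face_strict_point[of f] fv(1,3) that by auto
    qed
    moreover have "x \<in> P'" using x face_not_in_vertex(1)[OF tf(3)] face_of_imp_subset
      unfolding V.Q_def by (fastforce intro: less_imp_le)
    ultimately have "x \<in> hv v" by blast
    then show False using x(2)[of "{v}"] tf(1) unfolding hv_def V.H_def by auto
  qed
  have d1: "f \<inter> hv v \<inter> Q \<noteq> f \<inter> P' \<inter> he e" using n1 by blast
  have d2: "f \<inter> hv v \<inter> Q \<notin> ?g ` ?F" using n1 by blast
  have d3: "f \<inter> P' \<inter> he e \<notin> ?g ` ?F" using n2 by blast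
  have fin: "finite (?g ` ?F)" using finite_faces_of_dim[OF V.polytope] by simp
  have "card (insert (f \<inter> hv v \<inter> Q) (insert (f \<inter> P' \<inter> he e) (?g ` ?F))) = card (?g ` ?F) + 2"
    using d1 d2 d3 fin by simp
  then show ?thesis
    unfolding edges_of_Q_at_cell[OF t] using card_image[OF inj] c2 by simp
qed

end

lemma faces_of_dim_of_face:
  "F face_of P \<Longrightarrow> {f \<in> faces_of_dim F k. R f} = {f \<in> faces_of_dim P k. R f \<and> f \<subseteq> F}"
  unfolding faces_of_dim_def by (auto simp: face_of_face)

context vertex_edge_cut
begin

definition pt :: "'a \<times> 'a set \<times> 'a set \<Rightarrow> 'a" where "pt t = the_elem (cell t)"

lemma cell_eq: assumes "t \<in> flags P" shows "cell t = {pt t}"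
proof -
  have "aff_dim (cell t) = 0" using flag_facts(10) assms unfolding faces_of_dim_def by (cases t) blast
  then obtain x where "cell t = {x}" by (auto simp: aff_dim_eq_0)
  then show ?thesis unfolding pt_def by simp
qed

lemma pt_bij: "bij_betw pt (flags P) (polytope_vertices Q)"
  unfolding bij_betw_def
proof
  show "inj_on pt (flags P)"
    using cell_inj cell_eq by (auto simp: inj_on_def)
  have "(\<lambda>v. {v}) ` pt ` flags P = (\<lambda>v. {v}) ` polytope_vertices Q"
    unfolding faces_of_dim_0[symmetric] vertices_of_Q_are_cells using cell_eq by (auto simp: image_iff)
  then show "pt ` flags P = polytope_vertices Q"
    by (rule inj_image_eq_iff[THEN iffD1, rotated]) (auto intro: injI)
qed

lemma pt_vertex: "t \<in> flags P \<Longrightarrow> pt t \<in> polytope_vertices Q"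
  using pt_bij unfolding bij_betw_def by blast

lemma pt_in_iff: "t \<in> flags P \<Longrightarrow> pt t \<in> K \<longleftrightarrow> cell t \<subseteq> K"
  using cell_eq by auto

lemma finite_flags: "finite (flags P)"
  using pt_bij finite_polytope_vertices[OF E.polytope_Q] bij_betw_finite by blast

theorem simple_truncation:
  assumes d: "aff_dim P = 4"
  shows "simple_polytope 4 Q"
  unfolding simple_polytope_def
proof (intro conjI ballI)
  show "polytope Q" by (rule E.polytope_Q)
  have PP: "P \<in> faces_of_dim P 4"
    using d V.polytope face_of_refl polytope_imp_convex unfolding faces_of_dim_def by blast
  have "P \<inter> P' = P'" using P'_subset by auto
  then have P': "P' face_of P'" "aff_dim P' = 4"
    using kept_face_dim[OF PP] unfolding faces_of_dim_def by auto
  have nF: "\<not> P' \<subseteq> F" if F: "F \<in> {e \<inter> P' |e. e edge_of P}" for F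
  proof
    assume s: "P' \<subseteq> F"
    obtain e where "F = e \<inter> P'" "e edge_of P" using F by blast
    then show False using s aff_dim_subset[of P' e] P' unfolding edge_of_def by auto
  qed
  have "P' \<noteq> {}" using P' by auto
  then have "aff_dim (P' \<inter> Q) = 4" using E.aff_dim_kept_face[OF P'(1) _ nF] P'(2) by simp
  moreover have "P' \<inter> Q = Q" using Q_subset_P' by auto
  ultimately show "aff_dim Q = int 4" by simp
  fix w assume "w \<in> polytope_vertices Q"
  then obtain t where t: "t \<in> flags P" "w = pt t" using pt_bij unfolding bij_betw_def by blast
  obtain v e f where vef: "t = (v, e, f)" by (cases t)
  have "{K. K edge_of Q \<and> w \<in> K} = {K \<in> faces_of_dim Q 1. cell t \<subseteq> K}"
    using pt_in_iff[OF t(1)] t(2) by (auto simp: edge_of_iff)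
  then show "card {K. K edge_of Q \<and> w \<in> K} = 4"
    using card_edges_of_Q_at_cell[OF _ d, of v e f] t vef by simp
qed

lemma flags_adjacent_along_edge:
  assumes "(v, e, f) \<in> flags P" "(w, e, f) \<in> flags P" "v \<noteq> w"
  shows "polytope_adj Q (pt (v, e, f)) (pt (w, e, f))"
proof -
  have "pt (v, e, f) \<noteq> pt (w, e, f)"
    using assms pt_bij unfolding bij_betw_def inj_on_def by blast
  moreover have "pt (u, e, f) \<in> f \<inter> P' \<inter> he e" if "(u, e, f) \<in> flags P" for u
    using pt_in_iff[OF that] cell_subset_P'[OF that] by auto
  moreover have "f \<inter> P' \<inter> he e \<in> faces_of_dim Q 1"
    using edge_of_Q_edge_face flag_facts[OF assms(1)] by blast
  ultimately show ?thesis
    unfolding polytope_adj_iff[OF E.polytope_Q] using pt_vertex assms by blast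
qed

text \<open>
  Among the three types of edges, only the one that runs along \<open>e\<close> within \<open>f\<close> leaves the hyperplane of \<open>v\<close>.
\<close>

lemma flags_adjacent_cases:
  assumes s: "(v, e, f) \<in> flags P" and t: "(v', e', f') \<in> flags P"
    and adj: "polytope_adj Q (pt (v, e, f)) (pt (v', e', f'))"
  shows "v = v' \<or> (e = e' \<and> f = f')"
proof -
  obtain K where K: "K \<in> faces_of_dim Q 1" "cell (v, e, f) \<subseteq> K" "cell (v', e', f') \<subseteq> K"
    using adj unfolding polytope_adj_iff[OF E.polytope_Q] pt_in_iff[OF s] pt_in_iff[OF t] by blast
  have "K \<in> {f \<inter> hv v \<inter> Q, f \<inter> P' \<inter> he e} \<union> (\<lambda>F. F \<inter> hv v \<inter> he e) ` {F \<in> faces_of_dim P 3. f \<subseteq> F}"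
    using edges_of_Q_at_cell[OF s] K by blast
  then have "K \<subseteq> hv v \<or> K \<subseteq> f \<inter> he e" by blast
  then show ?thesis
  proof
    assume "K \<subseteq> hv v"
    then show ?thesis using cell_in_hv[OF t flag_facts(1)[OF s]] K(3) by blast
  next
    assume "K \<subseteq> f \<inter> he e"
    then have "cell (v', e', f') \<subseteq> he e" "cell (v', e', f') \<subseteq> f" using K(3) by blast+
    then show ?thesis
      using cell_in_he[OF t flag_facts(2)[OF s]] cell_in_2face[OF t flag_facts(3)[OF s]] by blast
  qed
qed

definition cluster :: "'a \<Rightarrow> 'a set" where
  "cluster v = pt ` {t \<in> flags P. fst t = v}"

text \<open>
  The cluster of \<open>v\<close> is the vertex set of the face in which the hyperplane of \<open>v\<close> meets \<open>Q\<close>, and the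
  graph of a face is connected.
\<close>

lemma cluster_connected:
  assumes v: "v \<in> polytope_vertices P" and W: "W \<subseteq> cluster v" "W \<noteq> {}"
    and cl: "\<And>x y. x \<in> W \<Longrightarrow> y \<in> cluster v \<Longrightarrow> polytope_adj Q x y \<Longrightarrow> y \<in> W"
  shows "W = cluster v"
proof -
  let ?R = "Q \<inter> hv v"
  have "P \<inter> hv v face_of P'" using V.section_face_of_Q[of "{v}"] v unfolding hv_def by blast
  then have "P \<inter> hv v \<inter> Q face_of Q" by (rule E.kept_face)
  moreover have "P \<inter> hv v \<inter> Q = ?R" using Q_subset_P' P'_subset by blast
  ultimately have RQ: "?R face_of Q" by simp
  have pR: "polytope ?R" using face_of_polytope_polytope[OF E.polytope_Q RQ] .
  have vR: "polytope_vertices ?R = cluster v"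
  proof -
    have "pt t \<in> hv v \<longleftrightarrow> fst t = v" if "t \<in> flags P" for t
      using cell_in_hv[of "fst t" "fst (snd t)" "snd (snd t)" v] that v pt_in_iff[OF that]
      by (cases t) auto
    then have "cluster v = pt ` flags P \<inter> hv v" unfolding cluster_def by auto
    then show ?thesis
      using pt_bij polytope_vertices_face[OF RQ] polytope_vertices_subset[of Q]
      unfolding bij_betw_def by blast
  qed
  have "W = polytope_vertices ?R"
  proof (rule polytope_graph_connected[OF pR])
    show "W \<subseteq> polytope_vertices ?R" "W \<noteq> {}" using W vR by auto
    fix x y assume x: "x \<in> W" and a: "polytope_adj ?R x y"
    then have y: "y \<in> cluster v" using vR unfolding polytope_adj_def by blast
    have "polytope_adj Q x y"
      using a polytope_vertices_face[OF RQ] face_of_trans[OF _ RQ]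
      unfolding polytope_adj_def edge_of_def by blast
    then show "y \<in> W" using cl x y by blast
  qed
  then show ?thesis using vR by simp
qed

end

lemma vertex_edge_truncation_locale:
  fixes P :: "'a::euclidean_space set"
  assumes "polytope P" "vertex_edge_truncation P R"
  obtains a1 b1 a2 b2 where "vertex_edge_cut P a1 b1 a2 b2"
    "R = cutting.Q (cutting.Q P {{v} | v. v \<in> polytope_vertices P} a1 b1)
      {e \<inter> cutting.Q P {{v} | v. v \<in> polytope_vertices P} a1 b1 | e. e edge_of P} a2 b2"
proof -
  let ?\<V> = "{{v} | v. v \<in> polytope_vertices P}"
  obtain P' where P': "cut_off P ?\<V> P'" "cut_off P' {e \<inter> P' | e. e edge_of P} R"
    using assms unfolding vertex_edge_truncation_def by blast
  obtain a1 b1 where 1: "cutting P ?\<V> a1 b1" "P' = cutting.Q P ?\<V> a1 b1"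
    using cut_off_cutting[OF assms(1) P'(1)] by blast
  have "polytope P'" using cutting.polytope_Q[OF 1(1)] 1(2) by simp
  then obtain a2 b2 where 2: "cutting P' {e \<inter> P' | e. e edge_of P} a2 b2"
      "R = cutting.Q P' {e \<inter> P' | e. e edge_of P} a2 b2"
    using cut_off_cutting[OF _ P'(2)] by blast
  have "vertex_edge_cut P a1 b1 a2 b2"
    using 1 2 unfolding vertex_edge_cut_def by simp
  then show ?thesis using that 1 2 by simp
qed

section \<open>Facets of a combinatorial cube at a vertex\<close>

text \<open>
  Combinatorial equivalence speaks of inclusions only. So facets, and below vertices, have to be
  recognized without mentioning dimensions.
\<close>

lemma facet_iff_coatom:
  fixes S :: "'a::euclidean_space set"
  assumes S: "polytope S" "aff_dim S \<ge> 1"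
  shows "G facet_of S \<longleftrightarrow> G face_of S \<and> G \<noteq> S \<and> (\<forall>G'. G' face_of S \<longrightarrow> G \<subseteq> G' \<longrightarrow> G' = G \<or> G' = S)"
proof
  have cS: "convex S" using S polytope_imp_convex by blast
  {
    assume G: "G facet_of S"
    then have Gf: "G face_of S" "aff_dim G = aff_dim S - 1" unfolding facet_of_def by auto
    have "G' = G \<or> G' = S" if "G' face_of S" "G \<subseteq> G'" for G'
    proof (rule disjCI)
      assume "G' \<noteq> S"
      then have "aff_dim G' < aff_dim S" using face_of_aff_dim_lt[OF cS] that by blast
      moreover have "aff_dim G \<le> aff_dim G'" using that by (simp add: aff_dim_subset)
      ultimately show "G' = G"
        using face_subset_aff_dim_eq[OF Gf(1) that] Gf(2) by simp
    qed
    moreover have "G \<noteq> S" using G facet_of_irrefl by blast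
    ultimately show "G face_of S \<and> G \<noteq> S \<and> (\<forall>G'. G' face_of S \<longrightarrow> G \<subseteq> G' \<longrightarrow> G' = G \<or> G' = S)"
      using Gf by blast
  }
  assume G: "G face_of S \<and> G \<noteq> S \<and> (\<forall>G'. G' face_of S \<longrightarrow> G \<subseteq> G' \<longrightarrow> G' = G \<or> G' = S)"
  have "\<exists>F. F facet_of S \<and> G \<subseteq> F"
  proof (cases "G = {}")
    case True
    then show ?thesis using polytope_facet_exists[OF S(1)] S(2) by (metis empty_subsetI zero_less_one less_le_trans)
  next
    case False
    then show ?thesis
      using face_of_polyhedron_subset_facet[OF polytope_imp_polyhedron[OF S(1)]] G by metis
  qed
  then obtain F where "F facet_of S" "G \<subseteq> F" by blast
  then show "G facet_of S" using G facet_of_imp_face_of facet_of_irrefl by metis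
qed

lemma vertex_iff_atom:
  fixes S :: "'a::euclidean_space set"
  assumes S: "polytope S"
  shows "(\<exists>v. v \<in> polytope_vertices S \<and> G = {v}) \<longleftrightarrow>
    G face_of S \<and> G \<noteq> {} \<and> (\<forall>G'. G' face_of S \<longrightarrow> G' \<subseteq> G \<longrightarrow> G' = {} \<or> G' = G)"
proof
  assume "\<exists>v. v \<in> polytope_vertices S \<and> G = {v}"
  then obtain v where "v \<in> polytope_vertices S" "G = {v}" by blast
  moreover from this have "{v} face_of S" by (simp add: singleton_face_iff)
  ultimately show "G face_of S \<and> G \<noteq> {} \<and> (\<forall>G'. G' face_of S \<longrightarrow> G' \<subseteq> G \<longrightarrow> G' = {} \<or> G' = G)"
    by blast
next
  assume G: "G face_of S \<and> G \<noteq> {} \<and> (\<forall>G'. G' face_of S \<longrightarrow> G' \<subseteq> G \<longrightarrow> G' = {} \<or> G' = G)"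
  then have Gf: "G face_of S" "G \<noteq> {}" by auto
  then obtain v where "v \<in> polytope_vertices G"
    using polytope_vertex_exists[OF face_of_polytope_polytope[OF S]] by blast
  then have v: "v \<in> polytope_vertices S" "{v} \<subseteq> G" using polytope_vertices_face[OF Gf(1)] by auto
  then have "{v} = G" using G singleton_face_iff by blast
  then show "\<exists>v. v \<in> polytope_vertices S \<and> G = {v}" using v by blast
qed

lemma unit_cube_vertex_coords:
  assumes "c \<in> polytope_vertices (cbox 0 (1::real^'n))"
  shows "c $ i = 0 \<or> c $ i = 1"
proof (rule ccontr)
  assume n: "\<not> ?thesis"
  have c: "c extreme_point_of (cbox 0 1)" using assms unfolding polytope_vertices_def by simp
  then have cC: "\<And>j. 0 \<le> c $ j \<and> c $ j \<le> 1" unfolding extreme_point_of_def by (simp add: mem_box_cart)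
  define p where "p s = (\<chi> j. if j = i then s else c $ j)" for s :: real
  have pC: "p s \<in> cbox 0 1" if "0 \<le> s" "s \<le> 1" for s
    using that cC unfolding p_def by (simp add: mem_box_cart)
  have "c = (1 - c $ i) *\<^sub>R p 0 + (c $ i) *\<^sub>R p 1"
    unfolding p_def by (auto simp: vec_eq_iff algebra_simps)
  moreover have "p 0 \<noteq> p 1" unfolding p_def by (auto simp: vec_eq_iff)
  moreover have "0 < c $ i" "c $ i < 1" using n cC[of i] by auto
  ultimately have "c \<in> open_segment (p 0) (p 1)" unfolding in_segment by blast
  then show False using c pC[of 0] pC[of 1] unfolding extreme_point_of_def by auto
qed

lemma aff_dim_unit_cube: "aff_dim (cbox 0 (1::real^'n)) = int CARD('n)"
proof -
  have "(\<chi> i. 1 / 2) \<in> interior (cbox 0 (1::real^'n))" by (simp add: interior_cbox mem_box_cart)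
  then have "aff_dim (cbox 0 (1::real^'n)) = int (DIM(real^'n))"
    using aff_dim_nonempty_interior by blast
  then show ?thesis by simp
qed

text \<open>
  The facets at \<open>c\<close> are the sets \<open>g i\<close> on which the \<open>i\<close>-th coordinate is that of \<open>c\<close>. To see that there are no others, let
  \<open>a\<close> be the normal vector of a facet through \<open>c\<close>. Moving from \<open>c\<close> along one edge of the cube shows that no term
  \<open>a\<^sub>j (x\<^sub>j - c\<^sub>j)\<close> is positive on the cube. On the facet these terms add up to \<open>0\<close>, so they all vanish
  there; if \<open>a\<^sub>i \<noteq> 0\<close>, then \<open>x\<^sub>i = c\<^sub>i\<close>.
\<close>

lemma unit_cube_facets_at_vertex:
  assumes c: "c \<in> polytope_vertices (cbox 0 (1::real^'n))"
  shows "card {G. G facet_of (cbox 0 (1::real^'n)) \<and> c \<in> G} = CARD('n)"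
proof -
  let ?C = "cbox 0 (1::real^'n)"
  have c01: "\<And>i. c $ i = 0 \<or> c $ i = 1" using unit_cube_vertex_coords[OF c] .
  have cC: "c \<in> ?C" using c polytope_vertices_subset by blast
  have pC: "polytope ?C" by (rule polytope_interval)
  have cvx: "convex ?C" by (rule convex_box)
  define g where "g i = {x \<in> ?C. x $ i = c $ i}" for i
  define p where "p i = (\<chi> j. if j = i then 1 - c $ j else c $ j)" for i
  have pg: "p i \<in> ?C" "p i \<in> g j \<longleftrightarrow> i \<noteq> j" for i j
  proof -
    show "p i \<in> ?C" using c01 unfolding p_def by (auto simp: mem_box_cart) (metis order_refl zero_le_one)+
    then show "p i \<in> g j \<longleftrightarrow> i \<noteq> j" unfolding g_def p_def using c01[of i] by auto
  qed
  have gface: "g i face_of ?C" for i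
  proof -
    have eq: "g i = ?C \<inter> {x. axis i 1 \<bullet> x = c $ i}"
      unfolding g_def by (auto simp: cart_eq_inner_axis inner_commute)
    have ax: "axis i 1 \<bullet> x = x $ i" for x :: "real^'n" by (simp add: cart_eq_inner_axis inner_commute)
    show ?thesis
    proof (cases "c $ i = 0")
      case True
      then show ?thesis unfolding eq
        by (intro face_of_Int_supporting_hyperplane_ge cvx) (simp add: ax mem_box_cart)
    next
      case False
      then have "c $ i = 1" using c01 by blast
      then show ?thesis unfolding eq
        by (intro face_of_Int_supporting_hyperplane_le cvx) (simp add: ax mem_box_cart)
    qed
  qed
  have cg: "c \<in> g i" for i using cC unfolding g_def by simp
  have facet_sub: "\<exists>i. G \<subseteq> g i" if G: "G facet_of ?C" "c \<in> G" for G
  proof -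
    obtain a b where a: "a \<noteq> 0" "?C \<subseteq> {x. a \<bullet> x \<le> b}" "G = ?C \<inter> {x. a \<bullet> x = b}"
      using facet_of_polyhedron[OF polytope_imp_polyhedron[OF pC] G(1)] by metis
    obtain i where i: "a $ i \<noteq> 0" using a(1) by (auto simp: vec_eq_iff)
    have ac: "a \<bullet> c = b" using a(3) G(2) by auto
    \<comment> \<open>The point \<open>p j\<close> is the other endpoint of the cube edge at \<open>c\<close> in direction \<open>j\<close>.\<close>
    have sgn: "a $ j * (1 - 2 * c $ j) \<le> 0" for j
    proof -
      have "a \<bullet> p j \<le> b" using a(2) pg(1) by blast
      moreover have "a \<bullet> p j - a \<bullet> c = (\<Sum>k\<in>UNIV. if k = j then a $ j * (1 - 2 * c $ j) else 0)"
        unfolding inner_vec_def sum_subtractf[symmetric] p_def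
        by (intro sum.cong) (auto simp: algebra_simps)
      ultimately show ?thesis using ac by simp
    qed
    have le: "a $ j * (x $ j - c $ j) \<le> 0" if "x \<in> ?C" for x j
    proof -
      have "0 \<le> x $ j" "x $ j \<le> 1" using that by (auto simp: mem_box_cart)
      then show ?thesis using c01[of j] sgn[of j] by (auto simp: mult_le_0_iff)
    qed
    have "x \<in> g i" if "x \<in> G" for x
    proof -
      have xC: "x \<in> ?C" "a \<bullet> x = b" using that a(3) by auto
      then have "(\<Sum>j\<in>UNIV. a $ j * (x $ j - c $ j)) = 0"
        using ac unfolding inner_vec_def by (simp add: algebra_simps sum_subtractf)
      then have "a $ i * (x $ i - c $ i) = 0"
        using sum_nonneg_eq_0_iff[of UNIV "\<lambda>j. - (a $ j * (x $ j - c $ j))"] le[OF xC(1)]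
        by (simp add: sum_negf)
      then show ?thesis using i xC unfolding g_def by auto
    qed
    then show ?thesis by blast
  qed
  have dC: "aff_dim ?C \<ge> 1" by (simp add: aff_dim_unit_cube Suc_le_eq)
  have gprop: "g i \<noteq> ?C" for i using pg by blast
  have eqg: "\<exists>i. G = g i" if G: "G facet_of ?C" "c \<in> G" for G
    using facet_sub[OF that] G(1) gface gprop unfolding facet_iff_coatom[OF pC dC] by metis
  have gfacet: "g i facet_of ?C" for i
  proof -
    obtain G where G: "G facet_of ?C" "g i \<subseteq> G"
      using face_of_polyhedron_subset_facet[OF polytope_imp_polyhedron[OF pC] gface _ gprop] cg by blast
    then obtain j where "G = g j" using eqg cg by blast
    then have "i = j" using pg(2)[of j i] pg(2)[of j j] G by blast
    then show ?thesis using G \<open>G = g j\<close> by simp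
  qed
  have "{G. G facet_of ?C \<and> c \<in> G} = range g" using eqg gfacet cg by blast
  moreover have "inj g" using pg(2) by (metis injI)
  ultimately show ?thesis by (simp add: card_image)
qed

lemma combinatorial_3_cube_simple:
  fixes F :: "'a::euclidean_space set"
  assumes F: "combinatorial_3_cube F" and v: "v \<in> polytope_vertices F"
  shows "card {f \<in> faces_of_dim F 2. v \<in> f} = 3"
proof -
  let ?C = "cbox 0 (1::real^3)"
  have pF: "polytope F" "aff_dim F = 3" and eq: "combinatorially_equivalent F ?C"
    using F unfolding combinatorial_3_cube_def by auto
  have pC: "polytope ?C" by (rule polytope_interval)
  have dC: "aff_dim ?C = 3" by (simp add: aff_dim_unit_cube)
  obtain \<phi> where bij: "bij_betw \<phi> {G. G face_of F} {G. G face_of ?C}"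
    and sub: "\<And>G G'. G face_of F \<Longrightarrow> G' face_of F \<Longrightarrow> (G \<subseteq> G' \<longleftrightarrow> \<phi> G \<subseteq> \<phi> G')"
    using eq unfolding combinatorially_equivalent_def by blast
  have fC: "\<phi> G face_of ?C" if "G face_of F" for G using bij that unfolding bij_betw_def by blast
  have pre: "\<exists>G. G face_of F \<and> K = \<phi> G" if "K face_of ?C" for K
    using bij that unfolding bij_betw_def by blast
  have inj: "\<phi> G = \<phi> G' \<longleftrightarrow> G = G'" if "G face_of F" "G' face_of F" for G G'
    using sub[OF that] sub[OF that(2,1)] by auto
  have FF: "F face_of F" and CC: "?C face_of ?C"
    using pF pC polytope_imp_convex face_of_refl by blast+
  have bot: "\<phi> {} = {}"
  proof -
    obtain G where G: "G face_of F" "{} = \<phi> G" using pre[of "{}"] by auto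
    then have "\<phi> {} \<subseteq> \<phi> G" using sub[of "{}" G] by auto
    then show ?thesis using G by auto
  qed
  have top: "\<phi> F = ?C"
  proof -
    obtain G where G: "G face_of F" "?C = \<phi> G" using pre[OF CC] by blast
    then have "\<phi> G \<subseteq> \<phi> F" using sub[OF G(1) FF] face_of_imp_subset by blast
    then show ?thesis using G(2) face_of_imp_subset[OF fC[OF FF]] by blast
  qed
  have facet: "G facet_of F \<longleftrightarrow> \<phi> G facet_of ?C" if G: "G face_of F" for G
  proof -
    have "(\<forall>G'. G' face_of F \<longrightarrow> G \<subseteq> G' \<longrightarrow> G' = G \<or> G' = F) \<longleftrightarrow>
        (\<forall>K. K face_of ?C \<longrightarrow> \<phi> G \<subseteq> K \<longrightarrow> K = \<phi> G \<or> K = ?C)"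
      using pre fC sub[OF G] inj[OF _ G] inj[OF _ FF] top by metis
    moreover have "G \<noteq> F \<longleftrightarrow> \<phi> G \<noteq> ?C" using inj[OF G FF] top by simp
    ultimately show ?thesis
      using G fC[OF G] facet_iff_coatom[OF pF(1), of G] facet_iff_coatom[OF pC, of "\<phi> G"] pF(2) dC by simp
  qed
  have vF: "{v} face_of F" using v singleton_face_iff by blast
  have "\<phi> {v} face_of ?C \<and> \<phi> {v} \<noteq> {} \<and> (\<forall>K. K face_of ?C \<longrightarrow> K \<subseteq> \<phi> {v} \<longrightarrow> K = {} \<or> K = \<phi> {v})"
  proof (intro conjI allI impI)
    show "\<phi> {v} face_of ?C" using fC vF by blast
    show "\<phi> {v} \<noteq> {}" using inj[OF vF, of "{}"] bot by auto
    fix K assume "K face_of ?C" "K \<subseteq> \<phi> {v}"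
    then obtain G where "G face_of F" "K = \<phi> G" "\<phi> G \<subseteq> \<phi> {v}" using pre by blast
    then have "G \<subseteq> {v}" using sub[OF _ vF] by blast
    then have "G = {} \<or> G = {v}" by blast
    then show "K = {} \<or> K = \<phi> {v}" using \<open>K = \<phi> G\<close> bot by auto
  qed
  then obtain c where c: "c \<in> polytope_vertices ?C" "\<phi> {v} = {c}"
    using vertex_iff_atom[OF pC, of "\<phi> {v}"] by blast
  have mem: "v \<in> G \<longleftrightarrow> c \<in> \<phi> G" if "G face_of F" for G
    using sub[OF vF that] c by simp
  have "bij_betw \<phi> {G. G facet_of F \<and> v \<in> G} {K. K facet_of ?C \<and> c \<in> K}"
  proof (rule bij_betw_subset[OF bij, THEN bij_betw_cong[THEN iffD1, rotated]])
    show "\<phi> ` {G. G facet_of F \<and> v \<in> G} = {K. K facet_of ?C \<and> c \<in> K}"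
    proof (intro equalityI subsetI)
      fix K assume "K \<in> \<phi> ` {G. G facet_of F \<and> v \<in> G}"
      then show "K \<in> {K. K facet_of ?C \<and> c \<in> K}" using facet mem facet_of_imp_face_of by blast
    next
      fix K assume K: "K \<in> {K. K facet_of ?C \<and> c \<in> K}"
      then obtain G where "G face_of F" "K = \<phi> G" using pre facet_of_imp_face_of by blast
      then show "K \<in> \<phi> ` {G. G facet_of F \<and> v \<in> G}" using K facet mem by blast
    qed
  qed (auto dest: facet_of_imp_face_of)
  then have "card {G. G facet_of F \<and> v \<in> G} = 3"
    using bij_betw_same_card unit_cube_facets_at_vertex[OF c(1)] by fastforce
  moreover have "{f \<in> faces_of_dim F 2. v \<in> f} = {G. G facet_of F \<and> v \<in> G}"
    using pF(2) unfolding faces_of_dim_def facet_of_def by auto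
  ultimately show ?thesis by simp
qed

section \<open>Counting flags\<close>

lemma vertex_figure_euler:
  fixes P :: "'a::euclidean_space set"
  assumes P: "polytope P" "aff_dim P = 4" and v: "v \<in> polytope_vertices P"
  shows "card {e \<in> faces_of_dim P 1. v \<in> e} + card {F \<in> faces_of_dim P 3. v \<in> F} =
    card {f \<in> faces_of_dim P 2. v \<in> f} + 2"
proof -
  obtain a b where c: "cuts_vertex P v a b" using cuts_vertex_exists[OF P(1) v] by blast
  let ?R = "P \<inter> {x. a \<bullet> x = b}"
  have "P face_of P" using P polytope_imp_convex face_of_refl by blast
  moreover have "v \<in> P" "P \<noteq> {v}" using v polytope_vertices_subset P by (blast, auto)
  ultimately have "aff_dim ?R = 3" using aff_dim_vertex_figure[OF P(1) c] P(2) by simp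
  then have "card (faces_of_dim ?R 0) + card (faces_of_dim ?R 2) = card (faces_of_dim ?R 1) + 2"
    by (rule euler_formula_3_polytope[OF polytope_section[OF P(1)]])
  moreover have "card {G \<in> faces_of_dim P (k + 1). v \<in> G} = card (faces_of_dim ?R k)" if "k \<ge> 0" for k
    using bij_betw_same_card[OF vertex_figure_faces[OF P(1) c that]] .
  ultimately show ?thesis
    using \<open>\<And>k. 0 \<le> k \<Longrightarrow> card {G \<in> faces_of_dim P (k + 1). v \<in> G} = card (faces_of_dim ?R k)\<close>[of 0]
      \<open>\<And>k. 0 \<le> k \<Longrightarrow> card {G \<in> faces_of_dim P (k + 1). v \<in> G} = card (faces_of_dim ?R k)\<close>[of 1]
      \<open>\<And>k. 0 \<le> k \<Longrightarrow> card {G \<in> faces_of_dim P (k + 1). v \<in> G} = card (faces_of_dim ?R k)\<close>[of 2]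
    by simp
qed

lemma card_cube_neighbours:
  assumes x: "x \<in> cube_vertices m"
  shows "card {y \<in> cube_vertices m. cube_adj m x y} = m"
proof -
  define fl where "fl i = x[i := \<not> x ! i]" for i
  have lx: "length x = m" using x unfolding cube_vertices_def by simp
  have "{y \<in> cube_vertices m. cube_adj m x y} = fl ` {..<m}"
  proof (intro equalityI subsetI)
    fix y assume "y \<in> {y \<in> cube_vertices m. cube_adj m x y}"
    then have y: "length y = m" "card {i. i < m \<and> x ! i \<noteq> y ! i} = 1"
      unfolding cube_vertices_def cube_adj_def by auto
    then obtain i where i: "{i. i < m \<and> x ! i \<noteq> y ! i} = {i}" using card_1_singletonE by blast
    then have "i < m" "x ! i \<noteq> y ! i" "\<And>j. j < m \<Longrightarrow> j \<noteq> i \<Longrightarrow> x ! j = y ! j" by auto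
    then have "y = fl i" unfolding fl_def using y lx
      by (intro nth_equalityI) (auto simp: nth_list_update)
    then show "y \<in> fl ` {..<m}" using \<open>i < m\<close> by blast
  next
    fix y assume "y \<in> fl ` {..<m}"
    then obtain i where i: "i < m" "y = fl i" by blast
    have "{j. j < m \<and> x ! j \<noteq> fl i ! j} = {i}"
      unfolding fl_def using i lx by (auto simp: nth_list_update)
    then show "y \<in> {y \<in> cube_vertices m. cube_adj m x y}"
      using i lx unfolding cube_vertices_def cube_adj_def fl_def by simp
  qed
  moreover have "inj_on fl {..<m}"
  proof (rule inj_onI)
    fix i j assume ij: "i \<in> {..<m}" "j \<in> {..<m}" "fl i = fl j"
    show "i = j"
    proof (rule ccontr)
      assume "i \<noteq> j"
      then have "fl i ! i = (\<not> x ! i)" "fl j ! i = x ! i" unfolding fl_def using ij lx by auto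
      then show False using ij by simp
    qed
  qed
  ultimately show ?thesis by (simp add: card_image)
qed

lemma card_edges_at_vertex:
  fixes P :: "'a::euclidean_space set"
  assumes P: "polytope P" and v: "v \<in> polytope_vertices P"
  shows "card {e \<in> faces_of_dim P 1. v \<in> e} = card {w. polytope_adj P v w}"
proof -
  have "bij_betw (closed_segment v) {w. polytope_adj P v w} {e \<in> faces_of_dim P 1. v \<in> e}"
    unfolding bij_betw_def
  proof
    show "inj_on (closed_segment v) {w. polytope_adj P v w}"
    proof (rule inj_onI)
      fix w w' assume *: "w \<in> {w. polytope_adj P v w}" "w' \<in> {w. polytope_adj P v w}"
        "closed_segment v w = closed_segment v w'"
      have "{x. x extreme_point_of closed_segment v u} = {v, u}" for u
        by (auto simp: extreme_point_of_segment)
      then have "{v, w} = {v, w'}" using *(3) by metis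
      moreover have "v \<noteq> w" "v \<noteq> w'" using * unfolding polytope_adj_def by auto
      ultimately show "w = w'" by (metis doubleton_eq_iff)
    qed
    show "closed_segment v ` {w. polytope_adj P v w} = {e \<in> faces_of_dim P 1. v \<in> e}"
    proof (intro equalityI subsetI)
      fix e assume "e \<in> closed_segment v ` {w. polytope_adj P v w}"
      then show "e \<in> {e \<in> faces_of_dim P 1. v \<in> e}"
        unfolding polytope_adj_def edge_of_def faces_of_dim_def by auto
    next
      fix e assume "e \<in> {e \<in> faces_of_dim P 1. v \<in> e}"
      then show "e \<in> closed_segment v ` {w. polytope_adj P v w}"
        using edge_vertices[OF P _ v, of e] by (metis (no_types, lifting) image_eqI mem_Collect_eq)
    qed
  qed
  then show ?thesis using bij_betw_same_card by metis
qed

text \<open>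
  With \<open>E\<close> and \<open>F\<close> for the numbers of 2-faces and facets at \<open>v\<close>: double counting gives \<open>2 E = 3 F\<close>, as a 2-face is in two facets and a
  facet, being a 3-cube, has three 2-faces at \<open>v\<close>. Euler's formula for the vertex figure reads \<open>m + F = E + 2\<close>.
  Each 2-face at \<open>v\<close> has two edges at \<open>v\<close>, so there are \<open>2 E\<close> flags.
\<close>

lemma card_flags_at_vertex:
  fixes P :: "'a::euclidean_space set"
  assumes nc: "neighborly_cubical_4_polytope m P" and v: "v \<in> polytope_vertices P"
  shows "card {t \<in> flags P. fst t = v} = 6 * m - 12"
proof -
  have P: "polytope P" "aff_dim P = 4"
    and iso: "graph_isomorphic (polytope_vertices P) (polytope_adj P) (cube_vertices m) (cube_adj m)"
    and cub: "\<And>F. F facet_of P \<Longrightarrow> combinatorial_3_cube F"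
    using nc unfolding neighborly_cubical_4_polytope_def by auto
  let ?E = "{e \<in> faces_of_dim P 1. v \<in> e}" and ?F2 = "{f \<in> faces_of_dim P 2. v \<in> f}"
    and ?F3 = "{F \<in> faces_of_dim P 3. v \<in> F}"
  have fin: "finite ?E" "finite ?F2" "finite ?F3" using finite_faces_of_dim[OF P(1)] by auto
  have "card ?E = m"
  proof -
    obtain \<phi> where bij: "bij_betw \<phi> (polytope_vertices P) (cube_vertices m)"
      and adj: "\<And>u w. u \<in> polytope_vertices P \<Longrightarrow> w \<in> polytope_vertices P \<Longrightarrow>
        polytope_adj P u w \<longleftrightarrow> cube_adj m (\<phi> u) (\<phi> w)"
      using iso unfolding graph_isomorphic_def by blast
    have "bij_betw \<phi> {w. polytope_adj P v w} {y \<in> cube_vertices m. cube_adj m (\<phi> v) y}"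
    proof (rule bij_betw_subset[OF bij, THEN bij_betw_cong[THEN iffD1, rotated]])
      show "\<phi> ` {w. polytope_adj P v w} = {y \<in> cube_vertices m. cube_adj m (\<phi> v) y}"
      proof (intro equalityI subsetI)
        fix y assume "y \<in> \<phi> ` {w. polytope_adj P v w}"
        then obtain w where "y = \<phi> w" "polytope_adj P v w" "w \<in> polytope_vertices P"
          unfolding polytope_adj_def by blast
        then show "y \<in> {y \<in> cube_vertices m. cube_adj m (\<phi> v) y}"
          using adj[OF v] bij unfolding bij_betw_def by blast
      next
        fix y assume y: "y \<in> {y \<in> cube_vertices m. cube_adj m (\<phi> v) y}"
        then obtain w where "y = \<phi> w" "w \<in> polytope_vertices P"
          using bij unfolding bij_betw_def by blast
        then show "y \<in> \<phi> ` {w. polytope_adj P v w}" using adj[OF v] y by blast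
      qed
    qed (auto simp: polytope_adj_def)
    then have "card {w. polytope_adj P v w} = card {y \<in> cube_vertices m. cube_adj m (\<phi> v) y}"
      by (rule bij_betw_same_card)
    moreover have "\<phi> v \<in> cube_vertices m" using bij v unfolding bij_betw_def by blast
    ultimately show ?thesis using card_cube_neighbours card_edges_at_vertex[OF P(1) v] by simp
  qed
  moreover have "card ?E + card ?F3 = card ?F2 + 2"
    by (rule vertex_figure_euler[OF P v])
  moreover have "2 * card ?F2 = 3 * card ?F3"
  proof -
    have "card {F \<in> ?F3. f \<subseteq> F} = 2" if f: "f \<in> ?F2" for f
    proof -
      have "{F \<in> ?F3. f \<subseteq> F} = {F \<in> faces_of_dim P 3. f \<subseteq> F}" using f by auto
      then show ?thesis using ridge_in_two_facets[OF P(1), of f] f P(2) by simp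
    qed
    then have "(\<Sum>f\<in>?F2. card {F \<in> ?F3. f \<subseteq> F}) = card ?F2 * 2" by simp
    moreover have "card {f \<in> ?F2. f \<subseteq> F} = 3" if F: "F \<in> ?F3" for F
    proof -
      have "F face_of P" "F facet_of P" using F P(2) unfolding faces_of_dim_def facet_of_def by auto
      then have "{f \<in> ?F2. f \<subseteq> F} = {f \<in> faces_of_dim F 2. v \<in> f}"
        using faces_of_dim_of_face[of F P 2 "\<lambda>f. v \<in> f"] by auto
      moreover have "v \<in> polytope_vertices F"
        using polytope_vertices_face[OF \<open>F face_of P\<close>] v F by blast
      ultimately show ?thesis
        using combinatorial_3_cube_simple[OF cub[OF \<open>F facet_of P\<close>]] by simp
    qed
    then have "(\<Sum>F\<in>?F3. card {f \<in> ?F2. f \<subseteq> F}) = card ?F3 * 3" by simp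
    ultimately show ?thesis using sum_card_incidence[OF fin(2,3), of "(\<subseteq>)"] by simp
  qed
  moreover have "card {t \<in> flags P. fst t = v} = 2 * card ?F2"
  proof -
    have "{t \<in> flags P. fst t = v} = (\<lambda>(f, e). (v, e, f)) ` (SIGMA f:?F2. {e \<in> ?E. e \<subseteq> f})"
      unfolding flags_def using v by (force simp: image_iff)
    moreover have "inj_on (\<lambda>(f, e). (v, e, f)) (SIGMA f:?F2. {e \<in> ?E. e \<subseteq> f})"
      by (auto simp: inj_on_def)
    ultimately have "card {t \<in> flags P. fst t = v} = card (SIGMA f:?F2. {e \<in> ?E. e \<subseteq> f})"
      by (simp add: card_image)
    also have "\<dots> = (\<Sum>f\<in>?F2. card {e \<in> ?E. e \<subseteq> f})" by (intro card_SigmaI fin ballI finite_subset[OF _ fin(1)]) auto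
    also have "\<dots> = (\<Sum>f\<in>?F2. 2)"
    proof (rule sum.cong[OF refl])
      fix f assume f: "f \<in> ?F2"
      then have ff: "f face_of P" "aff_dim f = 2" unfolding faces_of_dim_def by auto
      then have "{e \<in> ?E. e \<subseteq> f} = {e \<in> faces_of_dim f 1. v \<in> e}"
        using faces_of_dim_of_face[of f P 1 "\<lambda>e. v \<in> e"] by auto
      moreover have "v \<in> polytope_vertices f" using polytope_vertices_face[OF ff(1)] v f by blast
      ultimately show "card {e \<in> ?E. e \<subseteq> f} = 2"
        using polygon_two_edges_at_vertex[OF face_of_polytope_polytope[OF P(1) ff(1)] ff(2)] by simp
    qed
    finally show ?thesis by simp
  qed
  ultimately show ?thesis by linarith
qed

lemma card_cube_vertices: "card (cube_vertices m) = 2 ^ m" "finite (cube_vertices m)"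
proof -
  have "cube_vertices m = {x. set x \<subseteq> (UNIV :: bool set) \<and> length x = m}"
    unfolding cube_vertices_def by auto
  then show "card (cube_vertices m) = 2 ^ m" "finite (cube_vertices m)"
    using card_lists_length_eq[of "UNIV :: bool set" m] finite_lists_length_eq[of "UNIV :: bool set" m]
    by auto
qed

section \<open>Vertex isoperimetry in the cube\<close>

definition exits :: "nat \<Rightarrow> bool list set \<Rightarrow> bool list \<Rightarrow> nat" where
  "exits m A x = card {i. i < m \<and> x[i := \<not> x ! i] \<notin> A}"

text \<open>
  The numerical inequality behind the induction on the dimension of the cube, where \<open>x\<close> and \<open>y\<close> are the densities
  of a set in two opposite facets of the cube. The function \<open>x (1 - x)\<close> is concave, and its concavity has to be made up for by
  the gain under the square root. It is, because \<open>x (1 - x) + (x - y)\<^sup>2 / 4 \<le> 1\<close>.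
\<close>

lemma two_point_inequality:
  fixes x y :: real
  assumes "0 \<le> y" "y \<le> x" "x \<le> 1"
  shows "(x + y) * (2 - (x + y)) \<le> 2 * (sqrt ((x * (1 - x))\<^sup>2 + (x - y)\<^sup>2) + y * (1 - y))"
proof -
  define J d where "J = x * (1 - x)" and "d = x - y"
  have J: "0 \<le> J" "J \<le> 1 / 4"
  proof -
    show "0 \<le> J" unfolding J_def using assms by simp
    have "0 \<le> (x - 1 / 2)\<^sup>2" by simp
    then show "J \<le> 1 / 4" unfolding J_def by (simp add: power2_eq_square algebra_simps)
  qed
  have d: "0 \<le> d" "d \<le> 1" unfolding d_def using assms by auto
  have "(J + d\<^sup>2 / 2)\<^sup>2 = J\<^sup>2 + d\<^sup>2 * (J + d\<^sup>2 / 4)"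
    by (simp add: power2_eq_square algebra_simps)
  also have "\<dots> \<le> J\<^sup>2 + d\<^sup>2 * 1"
  proof -
    have "d\<^sup>2 \<le> 1" using d by (simp add: power_le_one)
    then have "J + d\<^sup>2 / 4 \<le> 1" using J by linarith
    then show ?thesis by (intro add_left_mono mult_left_mono) auto
  qed
  finally have "J + d\<^sup>2 / 2 \<le> sqrt (J\<^sup>2 + d\<^sup>2)" by (simp add: real_le_rsqrt)
  moreover have "(x + y) * (2 - (x + y)) = 2 * (J + d\<^sup>2 / 2 + y * (1 - y))"
    unfolding J_def d_def by (simp add: power2_eq_square field_simps)
  ultimately show ?thesis unfolding J_def[symmetric] d_def[symmetric] by simp
qed

text \<open>
  The triangle inequality for the vectors with components \<open>sqrt (h y)\<close> and \<open>0\<close> or \<open>1\<close>.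
\<close>

lemma minkowski_sqrt_sum:
  fixes h :: "'a \<Rightarrow> real"
  assumes "finite B" "\<And>y. y \<in> B \<Longrightarrow> 0 \<le> h y"
  shows "sqrt ((\<Sum>y\<in>B. sqrt (h y))\<^sup>2 + (real (card {y \<in> B. R y}))\<^sup>2) \<le>
    (\<Sum>y\<in>B. sqrt (h y + (if R y then 1 else 0)))"
proof -
  let ?z = "\<lambda>y. Complex (sqrt (h y)) (if R y then 1 else 0)"
  have "(\<Sum>y\<in>B. if R y then 1 else 0) = real (card {y \<in> B. R y})"
    using assms(1) by (simp add: sum.If_cases Int_def)
  then have "sqrt ((\<Sum>y\<in>B. sqrt (h y))\<^sup>2 + (real (card {y \<in> B. R y}))\<^sup>2) = cmod (\<Sum>y\<in>B. ?z y)"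
    by (simp add: cmod_def Re_sum Im_sum)
  also have "\<dots> \<le> (\<Sum>y\<in>B. cmod (?z y))" by (rule norm_sum)
  also have "\<dots> = (\<Sum>y\<in>B. sqrt (h y + (if R y then 1 else 0)))"
    using assms(2) by (intro sum.cong) (auto simp: cmod_def)
  finally show ?thesis .
qed

lemma exits_Cons:
  "exits (Suc m) A (b # y) = exits m {z. b # z \<in> A} y + (if (\<not> b) # y \<in> A then 0 else 1)"
proof -
  have "{i. i < Suc m \<and> (b # y)[i := \<not> (b # y) ! i] \<notin> A} =
    (if (\<not> b) # y \<in> A then {} else {0}) \<union> Suc ` {i. i < m \<and> y[i := \<not> y ! i] \<notin> {z. b # z \<in> A}}"
    by (auto simp: less_Suc_eq_0_disj)
  then show ?thesis unfolding exits_def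
    by (subst (asm) card_Un_disjoint[symmetric] | simp add: card_Un_disjoint card_image)+
qed

text \<open>
  Induction on the dimension. Split \<open>A\<close> by the first coordinate into \<open>S True\<close> and \<open>S False\<close>. The points of the larger part
  that are missing in the smaller part gain an exit, and their density is at least the difference of the two
  densities. So Minkowski's inequality and \<open>two_point_inequality\<close> give the induction step. The square root is what makes the
  induction work and what later yields \<open>\<surd>m\<close>; the inequality is a variant for sets, with exits counted at points of
  \<open>A\<close> only, of inequalities of Talagrand and Bobkov.
\<close>

theorem cube_surface_inequality:
  assumes "A \<subseteq> cube_vertices m"
  shows "real (card A) * (2 ^ m - real (card A)) \<le> 2 ^ m * (\<Sum>x\<in>A. sqrt (real (exits m A x)))"
  using assms
proof (induction m arbitrary: A)
  case 0
  then have "A = {} \<or> A = {[]}" unfolding cube_vertices_def by auto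
  then show ?case by auto
next
  case (Suc m)
  define S where "S b = {y. b # y \<in> A}" for b
  have Sc: "S b \<subseteq> cube_vertices m" for b using Suc.prems unfolding S_def cube_vertices_def by auto
  have finS: "finite (S b)" for b using Sc card_cube_vertices(2) finite_subset by blast
  have A: "A = (#) True ` S True \<union> (#) False ` S False"
  proof (intro equalityI subsetI)
    fix x assume x: "x \<in> A"
    then obtain b y where "x = b # y" using Suc.prems unfolding cube_vertices_def
      by (cases x) auto
    then show "x \<in> (#) True ` S True \<union> (#) False ` S False" using x unfolding S_def by (cases b) auto
  qed (auto simp: S_def)
  have dis: "(#) True ` S True \<inter> (#) False ` S False = {}" by auto
  have cardA: "card A = card (S True) + card (S False)"
    by (subst A, subst card_Un_disjoint) (auto simp: finS card_image)
  define T where "T b = (\<Sum>y\<in>S b. sqrt (real (exits m (S b) y) + (if y \<notin> S (\<not> b) then 1 else 0)))" for b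
  have sumA: "(\<Sum>x\<in>A. sqrt (real (exits (Suc m) A x))) = T True + T False"
  proof -
    have ex: "real (exits (Suc m) A (b # y)) = real (exits m (S b) y) + (if y \<notin> S (\<not> b) then 1 else 0)" for b y
      unfolding exits_Cons S_def by simp
    have "(\<Sum>x\<in>A. sqrt (real (exits (Suc m) A x))) =
        (\<Sum>x\<in>(#) True ` S True. sqrt (real (exits (Suc m) A x))) +
        (\<Sum>x\<in>(#) False ` S False. sqrt (real (exits (Suc m) A x)))"
      by (subst A, rule sum.union_disjoint) (use finS dis in auto)
    also have "\<dots> = T True + T False"
      unfolding T_def by (simp add: sum.reindex ex)
    finally show ?thesis .
  qed
  have step: "(real (card (S b)) + real (card (S (\<not> b)))) * (2 * 2 ^ m - (real (card (S b)) + real (card (S (\<not> b))))) \<le>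
      2 * 2 ^ m * (T b + T (\<not> b))" if le: "card (S (\<not> b)) \<le> card (S b)" for b
  proof -
    define N :: real where "N = 2 ^ m"
    define x y where "x = real (card (S b)) / N" and "y = real (card (S (\<not> b))) / N"
    have N: "N > 0" unfolding N_def by simp
    have xy: "0 \<le> y" "y \<le> x" "x \<le> 1"
    proof -
      show "0 \<le> y" "y \<le> x" unfolding x_def y_def using N le by (auto simp: divide_right_mono)
      have "card (S b) \<le> 2 ^ m" using card_mono[OF card_cube_vertices(2) Sc] card_cube_vertices(1) by metis
      then have "real (card (S b)) \<le> N" unfolding N_def
        by (metis of_nat_le_iff of_nat_numeral of_nat_power)
      then show "x \<le> 1" unfolding x_def using N by simp
    qed
    have card_eq: "real (card (S b)) = N * x" "real (card (S (\<not> b))) = N * y"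
      unfolding x_def y_def using N by auto
    define U where "U b = (\<Sum>y\<in>S b. sqrt (real (exits m (S b) y)))" for b
    have U: "N * (x * (1 - x)) \<le> U b" "N * (y * (1 - y)) \<le> U (\<not> b)"
    proof -
      have "N * x * (N - N * x) \<le> N * U b"
        using Suc.IH[OF Sc[of b]] unfolding U_def N_def[symmetric] card_eq .
      then have "N * (N * (x * (1 - x))) \<le> N * U b" by (simp add: algebra_simps)
      then show "N * (x * (1 - x)) \<le> U b" using N by simp
      have "N * y * (N - N * y) \<le> N * U (\<not> b)"
        using Suc.IH[OF Sc[of "\<not> b"]] unfolding U_def N_def[symmetric] card_eq .
      then have "N * (N * (y * (1 - y))) \<le> N * U (\<not> b)" by (simp add: algebra_simps)
      then show "N * (y * (1 - y)) \<le> U (\<not> b)" using N by simp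
    qed
    have "real (card (S b)) - real (card (S (\<not> b))) \<le> real (card {y \<in> S b. y \<notin> S (\<not> b)})"
    proof -
      have "card (S b) \<le> card {y \<in> S b. y \<notin> S (\<not> b)} + card (S (\<not> b))"
        by (rule order_trans[OF card_mono card_Un_le]) (use finS in auto)
      then show ?thesis by linarith
    qed
    then have D: "N * (x - y) \<le> real (card {y \<in> S b. y \<notin> S (\<not> b)})"
      unfolding card_eq by (simp add: algebra_simps)
    have "sqrt ((N * (x * (1 - x)))\<^sup>2 + (N * (x - y))\<^sup>2) \<le>
        sqrt ((U b)\<^sup>2 + (real (card {y \<in> S b. y \<notin> S (\<not> b)}))\<^sup>2)"
      using U(1) D N xy by (intro real_sqrt_le_mono add_mono power_mono) auto
    also have "\<dots> \<le> T b"
      unfolding U_def T_def by (rule minkowski_sqrt_sum) (auto simp: finS)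
    finally have "N * sqrt ((x * (1 - x))\<^sup>2 + (x - y)\<^sup>2) \<le> T b"
    proof -
      assume *: "sqrt ((N * (x * (1 - x)))\<^sup>2 + (N * (x - y))\<^sup>2) \<le> T b"
      have "(N * (x * (1 - x)))\<^sup>2 + (N * (x - y))\<^sup>2 = N\<^sup>2 * ((x * (1 - x))\<^sup>2 + (x - y)\<^sup>2)"
        by (simp add: power_mult_distrib distrib_left)
      then show ?thesis using * N by (simp add: real_sqrt_mult)
    qed
    moreover have "U (\<not> b) \<le> T (\<not> b)"
      unfolding U_def T_def by (intro sum_mono real_sqrt_le_mono) auto
    ultimately have "N * (sqrt ((x * (1 - x))\<^sup>2 + (x - y)\<^sup>2) + y * (1 - y)) \<le> T b + T (\<not> b)"
      using U(2) by (simp add: distrib_left)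
    then have "2 * N * (N * (sqrt ((x * (1 - x))\<^sup>2 + (x - y)\<^sup>2) + y * (1 - y))) \<le> 2 * N * (T b + T (\<not> b))"
      using N by (intro mult_left_mono) auto
    moreover have "N * N * ((x + y) * (2 - (x + y))) \<le>
        N * N * (2 * (sqrt ((x * (1 - x))\<^sup>2 + (x - y)\<^sup>2) + y * (1 - y)))"
      using two_point_inequality[OF xy] N by (intro mult_left_mono) auto
    ultimately have "N * N * ((x + y) * (2 - (x + y))) \<le> 2 * N * (T b + T (\<not> b))"
      by (simp add: algebra_simps)
    moreover have "(N * x + N * y) * (2 * N - (N * x + N * y)) = N * N * ((x + y) * (2 - (x + y)))"
      by (simp add: algebra_simps)
    ultimately show ?thesis unfolding card_eq N_def[symmetric] by simp
  qed
  show ?case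
  proof (cases "card (S False) \<le> card (S True)")
    case True
    then show ?thesis using step[of True] unfolding cardA sumA by simp
  next
    case False
    then show ?thesis using step[of False] unfolding cardA sumA by (simp add: add.commute)
  qed
qed

text \<open>
  Apply \<open>cube_surface_inequality\<close> to \<open>A \<union> C\<close>: exits exist only at points of \<open>C\<close>, where there are at most \<open>m\<close>.
\<close>

theorem cube_separator_lower_bound:
  assumes un: "A \<union> B \<union> C = cube_vertices m" and dis: "A \<inter> B = {}" "A \<inter> C = {}" "B \<inter> C = {}"
    and sep: "\<And>x y. x \<in> A \<Longrightarrow> y \<in> B \<Longrightarrow> \<not> cube_adj m x y"
  shows "(real (card A) + real (card C)) * real (card B) \<le> 2 ^ m * (sqrt (real m) * real (card C))"
proof -
  let ?D = "A \<union> C"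
  have fin: "finite A" "finite B" "finite C"
    using un card_cube_vertices(2)[of m] by (metis finite_Un)+
  have "card (cube_vertices m) = card ?D + card B"
    using fin dis un by (subst card_Un_disjoint[symmetric]) (auto intro: arg_cong[where f = card])
  moreover have cD: "card ?D = card A + card C" using fin dis by (simp add: card_Un_disjoint)
  ultimately have cB: "2 ^ m - real (card ?D) = real (card B)"
    using card_cube_vertices(1)[of m] by (metis add_diff_cancel_left' of_nat_add of_nat_numeral of_nat_power)
  have A0: "exits m ?D x = 0" if x: "x \<in> A" for x
  proof -
    have lx: "length x = m" using x un unfolding cube_vertices_def by auto
    have "x[i := \<not> x ! i] \<in> ?D" if i: "i < m" for i
    proof -
      have "{j. j < m \<and> x ! j \<noteq> x[i := \<not> x ! i] ! j} = {i}"
        using i lx by (auto simp: nth_list_update)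
      then have "cube_adj m x (x[i := \<not> x ! i])" unfolding cube_adj_def by simp
      then have "x[i := \<not> x ! i] \<notin> B" using sep x by blast
      moreover have "x[i := \<not> x ! i] \<in> cube_vertices m" using lx unfolding cube_vertices_def by simp
      ultimately show ?thesis using un by blast
    qed
    then show ?thesis unfolding exits_def by simp
  qed
  have ex: "exits m ?D x \<le> m" for x
    unfolding exits_def using card_mono[of "{..<m}" "{i. i < m \<and> x[i := \<not> x ! i] \<notin> ?D}"] by auto
  have "(\<Sum>x\<in>?D. sqrt (real (exits m ?D x))) =
      (\<Sum>x\<in>A. sqrt (real (exits m ?D x))) + (\<Sum>x\<in>C. sqrt (real (exits m ?D x)))"
    using fin dis by (intro sum.union_disjoint) auto
  also have "\<dots> = (\<Sum>x\<in>C. sqrt (real (exits m ?D x)))" using A0 by simp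
  also have "\<dots> \<le> (\<Sum>x\<in>C. sqrt (real m))"
    using ex by (intro sum_mono real_sqrt_le_mono) simp
  also have "\<dots> = sqrt (real m) * real (card C)" by simp
  finally have "2 ^ m * (\<Sum>x\<in>?D. sqrt (real (exits m ?D x))) \<le> 2 ^ m * (sqrt (real m) * real (card C))"
    by (rule mult_left_mono) simp
  moreover have "real (card ?D) * (2 ^ m - real (card ?D)) \<le> 2 ^ m * (\<Sum>x\<in>?D. sqrt (real (exits m ?D x)))"
    by (rule cube_surface_inequality) (use un in auto)
  ultimately have "real (card ?D) * real (card B) \<le> 2 ^ m * (sqrt (real m) * real (card C))"
    unfolding cB by linarith
  then show ?thesis unfolding cD by simp
qed

lemma card_cube_half:
  assumes "i < m"
  shows "2 * card {x \<in> cube_vertices m. x ! i = b} = 2 ^ m"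
proof -
  let ?H = "\<lambda>b. {x \<in> cube_vertices m. x ! i = b}"
  have fin: "finite (?H b)" for b using card_cube_vertices(2)[of m] by simp
  have "bij_betw (\<lambda>x. x[i := \<not> x ! i]) (?H b) (?H (\<not> b))"
    by (rule bij_betw_byWitness[where f' = "\<lambda>x. x[i := \<not> x ! i]"])
      (use assms in \<open>auto simp: cube_vertices_def nth_list_update intro!: nth_equalityI split: if_splits\<close>)
  then have "card (?H b) = card (?H (\<not> b))" by (rule bij_betw_same_card)
  moreover have "card (?H b \<union> ?H (\<not> b)) = card (?H b) + card (?H (\<not> b))"
    using fin by (intro card_Un_disjoint) auto
  moreover have "?H b \<union> ?H (\<not> b) = cube_vertices m" by auto
  ultimately show ?thesis using card_cube_vertices(1)[of m] by simp
qed

section \<open>Separators of the truncated polytope\<close>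

lemma edge_in_two_face:
  fixes P :: "'a::euclidean_space set"
  assumes P: "polytope P" "aff_dim P = 4" and e: "e \<in> faces_of_dim P 1"
  obtains f where "f \<in> faces_of_dim P 2" "e \<subseteq> f"
proof -
  have e': "e face_of P" "aff_dim e = 1" using e unfolding faces_of_dim_def by auto
  have ne: "e \<noteq> {}" "e \<noteq> P" using e' P by auto
  obtain F where F: "F facet_of P" "e \<subseteq> F"
    using face_of_polyhedron_subset_facet[OF polytope_imp_polyhedron[OF P(1)] e'(1) ne] .
  have Ff: "F face_of P" "aff_dim F = 3" using F P unfolding facet_of_def by auto
  have eF: "e face_of F" "e \<noteq> F" using e' F Ff face_of_face[OF Ff(1)] by auto
  obtain f where f: "f facet_of F" "e \<subseteq> f"
    using face_of_polyhedron_subset_facet[OF polytope_imp_polyhedron[OF face_of_polytope_polytope[OF P(1) Ff(1)]] eF(1) ne(1) eF(2)] .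
  have "f face_of P" "aff_dim f = 2" using f Ff face_of_trans unfolding facet_of_def by auto
  then show ?thesis using that f unfolding faces_of_dim_def by blast
qed

lemma card_flags:
  fixes P :: "'a::euclidean_space set"
  assumes nc: "neighborly_cubical_4_polytope m P" and V: "V \<subseteq> polytope_vertices P" and fin: "finite (flags P)"
  shows "card {t \<in> flags P. fst t \<in> V} = card V * (6 * m - 12)"
proof -
  have "polytope P" using nc unfolding neighborly_cubical_4_polytope_def by blast
  then have fV: "finite V" using V finite_polytope_vertices finite_subset by blast
  have "{t \<in> flags P. fst t \<in> V} = (\<Union>v\<in>V. {t \<in> flags P. fst t = v})" by auto
  also have "card \<dots> = (\<Sum>v\<in>V. card {t \<in> flags P. fst t = v})"
    using fV fin by (intro card_UN_disjoint) auto
  also have "\<dots> = (\<Sum>v\<in>V. 6 * m - 12)"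
    using card_flags_at_vertex[OF nc] V by (intro sum.cong) auto
  finally show ?thesis by simp
qed

lemma card_cubical_vertices:
  assumes "neighborly_cubical_4_polytope m P"
  shows "card (polytope_vertices P) = 2 ^ m"
  using assms bij_betw_same_card card_cube_vertices(1)
  unfolding neighborly_cubical_4_polytope_def graph_isomorphic_def by metis

context vertex_edge_cut
begin

lemma card_vertices_Q:
  assumes nc: "neighborly_cubical_4_polytope m P"
  shows "card (polytope_vertices Q) = (6 * m - 12) * 2 ^ m"
proof -
  have "{t \<in> flags P. fst t \<in> polytope_vertices P} = flags P" unfolding flags_def by auto
  then have "card (flags P) = 2 ^ m * (6 * m - 12)"
    using card_flags[OF nc order_refl finite_flags] card_cubical_vertices[OF nc] by simp
  then show ?thesis using bij_betw_same_card[OF pt_bij] by simp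
qed

lemma card_cluster:
  assumes "neighborly_cubical_4_polytope m P" "v \<in> polytope_vertices P"
  shows "card (cluster v) = 6 * m - 12"
proof -
  have "inj_on pt {t \<in> flags P. fst t = v}"
    using pt_bij unfolding bij_betw_def by (rule inj_on_subset[OF conjunct1]) auto
  then show ?thesis
    unfolding cluster_def using card_flags_at_vertex[OF assms] by (simp add: card_image)
qed

lemma vertices_Q_eq_clusters: "polytope_vertices Q = (\<Union>v\<in>polytope_vertices P. cluster v)"
proof -
  have "fst t \<in> polytope_vertices P" if "t \<in> flags P" for t using that unfolding flags_def by auto
  then have "pt ` flags P = (\<Union>v\<in>polytope_vertices P. cluster v)" unfolding cluster_def by auto
  then show ?thesis using pt_bij unfolding bij_betw_def by simp
qed

lemma clusters_disjoint:
  assumes "x \<in> cluster v" "x \<in> cluster w" shows "v = w"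
proof -
  obtain s t where s: "s \<in> flags P" "fst s = v" "x = pt s" and t: "t \<in> flags P" "fst t = w" "x = pt t"
    using assms unfolding cluster_def by auto
  then have "s = t" using pt_bij unfolding bij_betw_def inj_on_def by auto
  then show ?thesis using s t by simp
qed

lemma finite_cluster: "finite (cluster v)"
  unfolding cluster_def using finite_flags by simp

text \<open>
  The cube vertices whose cluster meets \<open>C\<close> form a separator \<open>C'\<close> of the cube graph with \<open>card C' \<le> card C\<close>. Its parts have, together
  with \<open>C'\<close>, at least the density \<open>c\<close>, because all clusters have the same size.
\<close>

lemma separator_lower_bound:
  assumes nc: "neighborly_cubical_4_polytope m P" and m: "m \<ge> 4" and c: "0 < c"
    and sep: "separator c (polytope_vertices Q) (polytope_adj Q) C"
  shows "c\<^sup>2 / 2 * (2 ^ m / sqrt (real m)) \<le> real (card C)"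
proof -
  let ?V = "polytope_vertices P"
  define k where "k = 6 * m - 12"
  define N :: real where "N = 2 ^ m"
  have k: "k > 0" using m unfolding k_def by simp
  have N: "N > 0" unfolding N_def by simp
  have P: "polytope P" "aff_dim P = 4"
    and iso: "graph_isomorphic ?V (polytope_adj P) (cube_vertices m) (cube_adj m)"
    using nc unfolding neighborly_cubical_4_polytope_def by auto
  have finV: "finite ?V" using finite_polytope_vertices[OF P(1)] .
  obtain A B where un: "A \<union> B \<union> C = polytope_vertices Q" and dis: "A \<inter> B = {}" "A \<inter> C = {}" "B \<inter> C = {}"
    and cA: "c * real (card (polytope_vertices Q)) \<le> real (card A)" and AB: "card A \<le> card B"
    and no: "\<And>a b. a \<in> A \<Longrightarrow> b \<in> B \<Longrightarrow> \<not> polytope_adj Q a b \<and> \<not> polytope_adj Q b a"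
    using sep unfolding separator_def by blast
  have cardQ: "real (card (polytope_vertices Q)) = real k * N"
    using card_vertices_Q[OF nc] unfolding k_def N_def by simp
  have finQ: "finite (polytope_vertices Q)" using finite_polytope_vertices[OF E.polytope_Q] .
  define A' where "A' = {v \<in> ?V. cluster v \<subseteq> A}"
  define B' where "B' = {v \<in> ?V. cluster v \<subseteq> B}"
  define C' where "C' = {v \<in> ?V. cluster v \<inter> C \<noteq> {}}"
  have fin: "finite A'" "finite B'" "finite C'" unfolding A'_def B'_def C'_def using finV by auto
  have ne: "cluster v \<noteq> {}" if "v \<in> ?V" for v
    using card_cluster[OF nc that] k unfolding k_def by auto
  have cl_sub: "cluster v \<subseteq> A \<union> B \<union> C" if "v \<in> ?V" for v
    using un vertices_Q_eq_clusters that by blast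
  \<comment> \<open>A cluster induces a connected subgraph, so it cannot meet both sides while avoiding the separator.\<close>
  have un': "A' \<union> B' \<union> C' = ?V"
  proof -
    have "v \<in> A' \<union> B' \<union> C'" if v: "v \<in> ?V" for v
    proof (cases "cluster v \<inter> C = {} \<and> cluster v \<inter> A \<noteq> {}")
      case True
      have "cluster v \<inter> A = cluster v"
      proof (rule cluster_connected[OF v])
        fix x y assume "x \<in> cluster v \<inter> A" "y \<in> cluster v" "polytope_adj Q x y"
        then show "y \<in> cluster v \<inter> A" using no[of x y] cl_sub[OF v] True by blast
      qed (use True in auto)
      then show ?thesis using v unfolding A'_def by blast
    next
      case False
      then show ?thesis using v cl_sub[OF v] unfolding B'_def C'_def by blast
    qed
    then show ?thesis unfolding A'_def B'_def C'_def by blast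
  qed
  have dis': "A' \<inter> B' = {}" "A' \<inter> C' = {}" "B' \<inter> C' = {}"
    using ne dis unfolding A'_def B'_def C'_def by blast+
  have no': "\<not> polytope_adj P v w" if v: "v \<in> A'" and w: "w \<in> B'" for v w
  proof
    assume adj: "polytope_adj P v w"
    then have vw: "v \<in> ?V" "w \<in> ?V" "v \<noteq> w" and "\<exists>e\<in>faces_of_dim P 1. v \<in> e \<and> w \<in> e"
      unfolding polytope_adj_iff[OF P(1)] by auto
    then obtain e where e: "e \<in> faces_of_dim P 1" "v \<in> e" "w \<in> e" by blast
    obtain f where "f \<in> faces_of_dim P 2" "e \<subseteq> f" using edge_in_two_face[OF P e(1)] .
    then have fl: "(v, e, f) \<in> flags P" "(w, e, f) \<in> flags P" unfolding flags_def using vw e by auto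
    then have "pt (v, e, f) \<in> cluster v" "pt (w, e, f) \<in> cluster w" unfolding cluster_def by auto
    then show False
      using flags_adjacent_along_edge[OF fl vw(3)] no v w unfolding A'_def B'_def by blast
  qed
  have cC: "card C' \<le> card C"
  proof -
    have "\<forall>v\<in>C'. \<exists>x. x \<in> cluster v \<inter> C" unfolding C'_def by blast
    then obtain g where g: "\<And>v. v \<in> C' \<Longrightarrow> g v \<in> cluster v \<inter> C" by metis
    have "inj_on g C'" using g clusters_disjoint by (metis Int_iff inj_onI)
    moreover have "g ` C' \<subseteq> C" using g by blast
    moreover have "finite C" using un finQ by (metis finite_Un)
    ultimately show ?thesis by (rule card_inj_on_le)
  qed
  have big: "c * N \<le> real (card X') + real (card C')"
    if X: "X \<subseteq> polytope_vertices Q" "c * (real k * N) \<le> real (card X)"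
      and cov: "\<And>v. v \<in> ?V \<Longrightarrow> cluster v \<inter> X \<noteq> {} \<Longrightarrow> v \<in> X' \<union> C'" and sub: "X' \<subseteq> ?V" for X X'
  proof -
    have fX: "finite X'" using sub finV finite_subset by blast
    have "X \<subseteq> (\<Union>v\<in>X' \<union> C'. cluster v)"
    proof
      fix x assume x: "x \<in> X"
      then obtain v where "v \<in> ?V" "x \<in> cluster v" using X(1) vertices_Q_eq_clusters by auto
      then show "x \<in> (\<Union>v\<in>X' \<union> C'. cluster v)" using cov x by blast
    qed
    then have "card X \<le> card (\<Union>v\<in>X' \<union> C'. cluster v)"
      by (rule card_mono[rotated]) (use fX fin finite_cluster in auto)
    also have "\<dots> \<le> (\<Sum>v\<in>X' \<union> C'. card (cluster v))"
      by (rule card_UN_le) (use fX fin in auto)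
    also have "\<dots> = (\<Sum>v\<in>X' \<union> C'. k)"
      using card_cluster[OF nc] sub unfolding k_def C'_def by (intro sum.cong) auto
    also have "\<dots> \<le> (card X' + card C') * k" by (simp add: card_Un_le)
    finally have "real (card X) \<le> (real (card X') + real (card C')) * real k"
      by (metis of_nat_add of_nat_le_iff of_nat_mult)
    then have "real k * (c * N) \<le> real k * (real (card X') + real (card C'))"
      using X(2) by (simp add: mult.commute mult.left_commute)
    then show ?thesis using k by simp
  qed
  have bigA: "c * N \<le> real (card A') + real (card C')"
  proof (rule big)
    show "A \<subseteq> polytope_vertices Q" using un by blast
    show "c * (real k * N) \<le> real (card A)" using cA cardQ by simp
    show "A' \<subseteq> ?V" unfolding A'_def by blast
    fix v assume v: "v \<in> ?V" "cluster v \<inter> A \<noteq> {}"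
    then have "v \<notin> B'" using dis unfolding B'_def by blast
    then show "v \<in> A' \<union> C'" using un' v by blast
  qed
  have bigB: "c * N \<le> real (card B') + real (card C')"
  proof (rule big)
    show "B \<subseteq> polytope_vertices Q" using un by blast
    show "c * (real k * N) \<le> real (card B)" using cA cardQ AB by simp
    show "B' \<subseteq> ?V" unfolding B'_def by blast
    fix v assume v: "v \<in> ?V" "cluster v \<inter> B \<noteq> {}"
    then have "v \<notin> A'" using dis unfolding A'_def by blast
    then show "v \<in> B' \<union> C'" using un' v by blast
  qed
  obtain \<phi> where bij: "bij_betw \<phi> ?V (cube_vertices m)"
    and adj: "\<And>u w. u \<in> ?V \<Longrightarrow> w \<in> ?V \<Longrightarrow> polytope_adj P u w \<longleftrightarrow> cube_adj m (\<phi> u) (\<phi> w)"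
    using iso unfolding graph_isomorphic_def by blast
  have inj: "inj_on \<phi> ?V" and im: "\<phi> ` ?V = cube_vertices m" using bij unfolding bij_betw_def by auto
  have sub: "A' \<subseteq> ?V" "B' \<subseteq> ?V" "C' \<subseteq> ?V" unfolding A'_def B'_def C'_def by auto
  have card_im: "card (\<phi> ` A') = card A'" "card (\<phi> ` B') = card B'" "card (\<phi> ` C') = card C'"
    using inj_on_subset[OF inj] sub by (auto intro: card_image)
  have "(real (card (\<phi> ` A')) + real (card (\<phi> ` C'))) * real (card (\<phi> ` B')) \<le>
      2 ^ m * (sqrt (real m) * real (card (\<phi> ` C')))"
  proof (rule cube_separator_lower_bound)
    show "\<phi> ` A' \<union> \<phi> ` B' \<union> \<phi> ` C' = cube_vertices m" using un' im by (simp add: image_Un[symmetric])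
    show "\<phi> ` A' \<inter> \<phi> ` B' = {}" "\<phi> ` A' \<inter> \<phi> ` C' = {}" "\<phi> ` B' \<inter> \<phi> ` C' = {}"
      using dis' inj_on_image_Int[OF inj] sub by (metis image_empty)+
    show "\<not> cube_adj m x y" if "x \<in> \<phi> ` A'" "y \<in> \<phi> ` B'" for x y
      using that no' adj sub by blast
  qed
  then have main: "(real (card A') + real (card C')) * real (card B') \<le> N * (sqrt (real m) * real (card C'))"
    unfolding card_im N_def .
  define s where "s = sqrt (real m)"
  have s: "s \<ge> 1" unfolding s_def using m by simp
  define z where "z = real (card C')"
  have "card (polytope_vertices Q) > 0" using card_vertices_Q[OF nc] k unfolding k_def by simp
  moreover have "card A \<le> card (polytope_vertices Q)" using un finQ by (intro card_mono) auto
  ultimately have "c * real (card (polytope_vertices Q)) \<le> 1 * real (card (polytope_vertices Q))"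
    using cA by linarith
  then have c1: "c \<le> 1" using \<open>card (polytope_vertices Q) > 0\<close> by (simp only: mult_le_cancel_right_pos of_nat_0_less_iff)
  \<comment> \<open>As \<open>c * N - z\<close> may be negative, the bound for \<open>B'\<close> has to be used before the one for \<open>A'\<close>.\<close>
  have "(c * N) * (c * N - z) \<le> (c * N) * real (card B')"
    using bigB c N unfolding z_def by (intro mult_left_mono) auto
  also have "\<dots> \<le> (real (card A') + real (card C')) * real (card B')"
    using bigA by (intro mult_right_mono) auto
  also have "\<dots> \<le> N * (s * z)" using main unfolding s_def z_def .
  finally have "N * (c\<^sup>2 * N) \<le> N * ((s + c) * z)"
    by (simp add: power2_eq_square algebra_simps)
  then have "c\<^sup>2 * N \<le> (s + c) * z" using N by simp
  also have "\<dots> \<le> (2 * s) * z" using s c1 unfolding z_def by (intro mult_right_mono) auto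
  also have "\<dots> \<le> (2 * s) * real (card C)" using cC s unfolding z_def by (intro mult_left_mono) auto
  finally show ?thesis
    unfolding N_def[symmetric] s_def[symmetric] using s by (simp add: field_simps)
qed

text \<open>
  The separator consists of the flags on the \<open>False\<close> side of the \<open>i\<close>-th coordinate whose edge leads to the
  \<open>True\<close> side. No flag has this property for two coordinates, so for some \<open>i\<close> the number of these flags is at most the \<open>m\<close>-th part of all
  flags. The larger part is exactly one half of all vertices, and the other part falls short of
  one half by the size of the separator.
\<close>

lemma separator_upper_bound:
  assumes nc: "neighborly_cubical_4_polytope m P" and m: "m \<ge> 4" and c: "c + 1 / real m \<le> 1 / 2"
  obtains C where "separator c (polytope_vertices Q) (polytope_adj Q) C"
    "real m * real (card C) \<le> real ((6 * m - 12) * 2 ^ m)"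
proof -
  let ?V = "polytope_vertices P"
  define n where "n = (6 * m - 12) * 2 ^ m"
  have P: "polytope P" "aff_dim P = 4"
    and iso: "graph_isomorphic ?V (polytope_adj P) (cube_vertices m) (cube_adj m)"
    using nc unfolding neighborly_cubical_4_polytope_def by auto
  obtain \<phi> where bij: "bij_betw \<phi> ?V (cube_vertices m)"
    and adj: "\<And>u w. u \<in> ?V \<Longrightarrow> w \<in> ?V \<Longrightarrow> polytope_adj P u w \<longleftrightarrow> cube_adj m (\<phi> u) (\<phi> w)"
    using iso unfolding graph_isomorphic_def by blast
  define turns where "turns i t \<longleftrightarrow> \<not> \<phi> (fst t) ! i \<and> (\<exists>w \<in> ?V. w \<in> fst (snd t) \<and> \<phi> w ! i)"
    for i and t :: "'a \<times> 'a set \<times> 'a set"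
  define D where "D i = {t \<in> flags P. turns i t}" for i
  have one: "card {i \<in> {..<m}. turns i t} \<le> 1" if t: "t \<in> flags P" for t
  proof -
    obtain v e f where vef: "t = (v, e, f)" by (cases t)
    then have ve: "v \<in> ?V" "e \<in> faces_of_dim P 1" "v \<in> e" using t unfolding flags_def by auto
    obtain w where w: "polytope_adj P v w" "?V \<inter> e = {v, w}"
      using edge_vertices[OF P(1) ve(2,1,3)] by metis
    then have "w \<in> ?V" unfolding polytope_adj_def by blast
    then have "card {i. i < m \<and> \<phi> v ! i \<noteq> \<phi> w ! i} = 1"
      using adj ve w unfolding cube_adj_def by blast
    moreover have "{i \<in> {..<m}. turns i t} \<subseteq> {i. i < m \<and> \<phi> v ! i \<noteq> \<phi> w ! i}"
    proof
      fix i assume i: "i \<in> {i \<in> {..<m}. turns i t}"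
      then obtain u where "u \<in> ?V" "u \<in> e" "\<phi> u ! i" "\<not> \<phi> v ! i"
        unfolding turns_def vef by auto
      moreover have "u \<in> {v, w}" "u \<noteq> v" using calculation w(2) by auto
      ultimately show "i \<in> {i. i < m \<and> \<phi> v ! i \<noteq> \<phi> w ! i}" using i by simp
    qed
    ultimately show ?thesis by (metis card_mono card.infinite one_neq_zero)
  qed
  have n: "card (flags P) = n"
    using card_vertices_Q[OF nc] bij_betw_same_card[OF pt_bij] unfolding n_def by simp
  have "(\<Sum>i<m. card (D i)) = (\<Sum>t\<in>flags P. card {i \<in> {..<m}. turns i t})"
    unfolding D_def by (rule sum_card_incidence) (auto simp: finite_flags)
  also have "\<dots> \<le> (\<Sum>t\<in>flags P. 1)" by (rule sum_mono) (rule one)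
  finally have total: "(\<Sum>i<m. card (D i)) \<le> n" using n by simp
  have "\<exists>i<m. m * card (D i) \<le> n"
  proof (rule ccontr)
    assume "\<not> ?thesis"
    then have gt: "n < m * card (D i)" if "i < m" for i using that by force
    have "(\<Sum>i<m. n) < (\<Sum>i<m. m * card (D i))"
      by (rule sum_strict_mono) (use gt m in \<open>auto simp: lessThan_empty_iff\<close>)
    then have "m * n < m * (\<Sum>i<m. card (D i))" by (simp add: sum_distrib_left)
    then show False using total by simp
  qed
  then obtain i where i: "i < m" "m * card (D i) \<le> n" by blast
  define half where "half b = {t \<in> flags P. \<phi> (fst t) ! i = b}" for b
  have Dh: "D i \<subseteq> half False" unfolding D_def half_def turns_def by auto
  have fl: "half True \<union> half False = flags P" "half True \<inter> half False = {}"
    unfolding half_def by auto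
  have fin: "finite (half b)" "finite (D i)" for b
    unfolding half_def D_def using finite_flags by auto
  have half_card: "2 * card (half b) = n" for b
  proof -
    let ?W = "{v \<in> ?V. \<phi> v ! i = b}"
    have "half b = {t \<in> flags P. fst t \<in> ?W}" unfolding half_def flags_def by auto
    then have "card (half b) = card ?W * (6 * m - 12)"
      using card_flags[OF nc, of ?W] finite_flags by simp
    moreover have "\<phi> ` ?W = {x \<in> cube_vertices m. x ! i = b}"
      using bij unfolding bij_betw_def by auto
    then have "card ?W = card {x \<in> cube_vertices m. x ! i = b}"
      using bij card_image[OF inj_on_subset[of \<phi> ?V ?W]] unfolding bij_betw_def by auto
    ultimately have "2 * card (half b) = (2 * card {x \<in> cube_vertices m. x ! i = b}) * (6 * m - 12)"
      by simp
    then show ?thesis unfolding card_cube_half[OF i(1)] n_def by simp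
  qed
  have inj: "inj_on pt (flags P)" and img: "pt ` flags P = polytope_vertices Q"
    using pt_bij unfolding bij_betw_def by auto
  have card_pt: "card (pt ` T) = card T" if "T \<subseteq> flags P" for T
    using inj_on_subset[OF inj that] by (rule card_image)
  have pt_dis: "pt ` S \<inter> pt ` T = {}" if "S \<subseteq> flags P" "T \<subseteq> flags P" "S \<inter> T = {}" for S T
    using inj_on_image_Int[OF inj that(1,2)] that(3) by simp
  let ?A = "pt ` (half False - D i)" and ?B = "pt ` half True" and ?C = "pt ` D i"
  have subs: "half False - D i \<subseteq> flags P" "half True \<subseteq> flags P" "D i \<subseteq> flags P"
    unfolding half_def D_def by auto
  have cQ: "card (polytope_vertices Q) = n" using card_vertices_Q[OF nc] unfolding n_def .
  have cB: "2 * real (card ?B) = real n"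
    unfolding card_pt[OF subs(2)] using half_card[of True] by (metis of_nat_mult of_nat_numeral)
  have "card (half False) = card (half False - D i) + card (D i)"
    using Dh fin by (metis card_Diff_subset card_mono le_add_diff_inverse2)
  then have cA: "2 * (real (card ?A) + real (card ?C)) = real n"
    unfolding card_pt[OF subs(1)] card_pt[OF subs(3)]
    using half_card[of False] by (metis of_nat_add of_nat_mult of_nat_numeral)
  have cC: "real m * real (card ?C) \<le> real n"
    unfolding card_pt[OF subs(3)] using i(2) by (metis of_nat_le_iff of_nat_mult)
  have m0: "real m > 0" using m by simp
  have cCm: "real (card ?C) \<le> real n / real m" using cC m0 by (simp add: field_simps)
  have "separator c (polytope_vertices Q) (polytope_adj Q) ?C"
    unfolding separator_def
  proof (intro exI conjI ballI)
    show "?A \<union> ?B \<union> ?C = polytope_vertices Q"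
      unfolding img[symmetric] fl(1)[symmetric] using Dh by blast
    show "?A \<inter> ?B = {}" "?A \<inter> ?C = {}" "?B \<inter> ?C = {}"
      by (intro pt_dis subs; use fl Dh in blast)+
    have "(c + 1 / real m) * real n \<le> 1 / 2 * real n" by (rule mult_right_mono[OF c]) simp
    then have cn: "c * real n + real n / real m \<le> real n / 2" by (simp add: distrib_right)
    then show "c * real (card (polytope_vertices Q)) \<le> real (card ?A)"
      unfolding cQ using cA[unfolded distrib_left] cCm by linarith
    have "0 \<le> real (card ?C)" by simp
    then have "real (card ?A) \<le> real (card ?B)" using cA[unfolded distrib_left] cB by linarith
    then show "card ?A \<le> card ?B" by simp
    have "0 \<le> real n / real m" by simp
    then have "real (card ?B) \<le> real n - c * real n" using cn cB by linarith
    then show "real (card ?B) \<le> (1 - c) * real (card (polytope_vertices Q))"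
      unfolding cQ left_diff_distrib by simp
    fix x y assume x: "x \<in> ?A" and y: "y \<in> ?B"
    obtain v e f where s: "x = pt (v, e, f)" "(v, e, f) \<in> half False" "(v, e, f) \<notin> D i" using x by auto
    obtain v' e' f' where t: "y = pt (v', e', f')" "(v', e', f') \<in> half True" using y by auto
    have st: "(v, e, f) \<in> flags P" "(v', e', f') \<in> flags P" "\<not> \<phi> v ! i" "\<phi> v' ! i"
      using s t unfolding half_def by auto
    have ne: "e \<noteq> e'"
    proof
      assume "e = e'"
      then have "turns i (v, e, f)" using st unfolding turns_def flags_def by auto
      then show False using s st unfolding D_def by blast
    qed
    have "v \<noteq> v'" using st by auto
    then show "\<not> polytope_adj Q x y" "\<not> polytope_adj Q y x"
      using flags_adjacent_cases[OF st(1,2)] flags_adjacent_cases[OF st(2,1)] ne s t by auto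
  qed
  then show ?thesis using that[of ?C] cC unfolding n_def by blast
qed

end

lemma vertex_count_bounds:
  fixes m :: nat
  assumes m: "m \<ge> 4"
  defines "n \<equiv> real ((6 * m - 12) * 2 ^ m)"
  shows "n \<le> 6 * real m * 2 ^ m" "real m * ln 2 \<le> ln n" "0 < ln n" "ln n \<le> 7 * real m" "0 < n"
proof -
  have k: "1 \<le> real (6 * m - 12)" "real (6 * m - 12) \<le> 6 * real m" using m by auto
  have n: "n = real (6 * m - 12) * 2 ^ m" unfolding n_def by simp
  show "n \<le> 6 * real m * 2 ^ m" unfolding n using k by (intro mult_right_mono) auto
  have ln_n: "ln n = ln (real (6 * m - 12)) + real m * ln 2"
    unfolding n using k by (simp add: ln_mult ln_realpow)
  have "0 \<le> ln (real (6 * m - 12))" using k by simp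
  then show 1: "real m * ln 2 \<le> ln n" unfolding ln_n by simp
  have "0 < real m * ln 2" using m by simp
  then show "0 < ln n" using 1 by linarith
  have "ln (real (6 * m - 12)) \<le> real (6 * m - 12) - 1" using k by (intro ln_le_minus_one) auto
  moreover have "real m * ln 2 \<le> real m * 1"
    using ln_2_less_1 by (intro mult_left_mono) auto
  ultimately show "ln n \<le> 7 * real m" unfolding ln_n using k by linarith
  show "0 < n" unfolding n using k by simp
qed

theorem theorem1:
  "(\<forall>m\<ge>4. \<forall>P Q :: 'a::euclidean_space set.
      neighborly_cubical_4_polytope m P \<and> vertex_edge_truncation P Q \<longrightarrow>
        simple_polytope 4 Q \<and>
        finite (polytope_vertices Q) \<and> card (polytope_vertices Q) = (6 * m - 12) * 2 ^ m) \<and>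
   (\<forall>c::real. 0 < c \<and> c < 1 / 2 \<longrightarrow>
      (\<exists>K>0. \<forall>\<^sub>F m in sequentially. \<forall>P Q :: 'a set.
         neighborly_cubical_4_polytope m P \<and> vertex_edge_truncation P Q \<longrightarrow>
           (let n = real ((6 * m - 12) * 2 ^ m) in
            \<forall>C. separator c (polytope_vertices Q) (polytope_adj Q) C \<longrightarrow>
                real (card C) \<ge> K * (n / ln n powr (3 / 2)))) \<and>
      (\<exists>L>0. \<forall>\<^sub>F m in sequentially. \<forall>P Q :: 'a set.
         neighborly_cubical_4_polytope m P \<and> vertex_edge_truncation P Q \<longrightarrow>
           (let n = real ((6 * m - 12) * 2 ^ m) in
            \<exists>C. separator c (polytope_vertices Q) (polytope_adj Q) C \<and>
                real (card C) \<le> L * (n / ln n))))"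
proof (intro conjI allI impI)
  fix m :: nat and P Q :: "'a set"
  assume m: "m \<ge> 4" and "neighborly_cubical_4_polytope m P \<and> vertex_edge_truncation P Q"
  then have nc: "neighborly_cubical_4_polytope m P" and tr: "vertex_edge_truncation P Q" by auto
  have P: "polytope P" "aff_dim P = 4" using nc unfolding neighborly_cubical_4_polytope_def by auto
  obtain a1 b1 a2 b2 where cut: "vertex_edge_cut P a1 b1 a2 b2"
    "Q = cutting.Q (cutting.Q P {{v} | v. v \<in> polytope_vertices P} a1 b1)
      {e \<inter> cutting.Q P {{v} | v. v \<in> polytope_vertices P} a1 b1 | e. e edge_of P} a2 b2"
    using vertex_edge_truncation_locale[OF P(1) tr] .
  interpret vertex_edge_cut P a1 b1 a2 b2 by (rule cut(1))
  show S: "simple_polytope 4 Q" unfolding cut(2) by (rule simple_truncation[OF P(2)])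
  show "finite (polytope_vertices Q)"
    using S finite_polytope_vertices unfolding simple_polytope_def by blast
  show "card (polytope_vertices Q) = (6 * m - 12) * 2 ^ m"
    unfolding cut(2) by (rule card_vertices_Q[OF nc])
next
  fix c :: real
  assume "0 < c \<and> c < 1 / 2"
  then have c: "0 < c" "c < 1 / 2" by auto
  \<comment> \<open>By \<open>n \<le> 6 m 2\<^sup>m\<close> and \<open>ln n \<ge> m ln 2\<close>, this choice makes \<open>K n / (ln n) powr (3 / 2)\<close> at most \<open>c\<^sup>2 / 2\<close> times \<open>2\<^sup>m / \<surd>m\<close>,
    the lower bound for the size of a separator.\<close>
  define K where "K = c\<^sup>2 / 12 * ln 2 powr (3 / 2)"
  have "K > 0" unfolding K_def using c by simp
  moreover have "\<forall>P Q :: 'a set.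
         neighborly_cubical_4_polytope m P \<and> vertex_edge_truncation P Q \<longrightarrow>
           (let n = real ((6 * m - 12) * 2 ^ m) in
            \<forall>C. separator c (polytope_vertices Q) (polytope_adj Q) C \<longrightarrow>
                real (card C) \<ge> K * (n / ln n powr (3 / 2)))" if m: "m \<ge> 4" for m
    unfolding Let_def
  proof (intro allI impI)
    fix P Q C :: "'a set"
    assume "neighborly_cubical_4_polytope m P \<and> vertex_edge_truncation P Q"
      and sep: "separator c (polytope_vertices Q) (polytope_adj Q) C"
    then have nc: "neighborly_cubical_4_polytope m P" and tr: "vertex_edge_truncation P Q" by auto
    have P: "polytope P" using nc unfolding neighborly_cubical_4_polytope_def by auto
    obtain a1 b1 a2 b2 where cut: "vertex_edge_cut P a1 b1 a2 b2"
      "Q = cutting.Q (cutting.Q P {{v} | v. v \<in> polytope_vertices P} a1 b1)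
        {e \<inter> cutting.Q P {{v} | v. v \<in> polytope_vertices P} a1 b1 | e. e edge_of P} a2 b2"
      using vertex_edge_truncation_locale[OF P tr] .
    have lower: "c\<^sup>2 / 2 * (2 ^ m / sqrt (real m)) \<le> real (card C)"
      using vertex_edge_cut.separator_lower_bound[OF cut(1) nc m c(1)] sep unfolding cut(2) .
    let ?n = "real ((6 * m - 12) * 2 ^ m)"
    note nb = vertex_count_bounds[OF m]
    have m0: "real m > 0" using m by simp
    have pw: "(real m * ln 2) powr (3 / 2) \<le> ln ?n powr (3 / 2)"
      using nb(2) by (intro powr_mono2) auto
    have pos: "(real m * ln 2) powr (3 / 2) > 0" using m0 by simp
    have "?n / ln ?n powr (3 / 2) \<le> (6 * real m * 2 ^ m) / (real m * ln 2) powr (3 / 2)"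
      using nb(1,5) pw pos by (intro frac_le) auto
    also have "(real m * ln 2) powr (3 / 2) = real m * sqrt (real m) * ln 2 powr (3 / 2)"
    proof -
      have "real m powr (3 / 2) = real m powr (1 + 1 / 2)" by simp
      also have "\<dots> = real m * sqrt (real m)"
        unfolding powr_add using m0 by (simp add: powr_half_sqrt)
      finally show ?thesis by (simp add: powr_mult)
    qed
    finally have "K * (?n / ln ?n powr (3 / 2)) \<le>
        K * ((6 * real m * 2 ^ m) / (real m * sqrt (real m) * ln 2 powr (3 / 2)))"
      using \<open>K > 0\<close> by (intro mult_left_mono) auto
    also have "\<dots> = c\<^sup>2 / 2 * (2 ^ m / sqrt (real m))"
      unfolding K_def using m0 by (simp add: field_simps)
    finally show "real (card C) \<ge> K * (?n / ln ?n powr (3 / 2))" using lower by linarith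
  qed
  ultimately show "\<exists>K>0. \<forall>\<^sub>F m in sequentially. \<forall>P Q :: 'a set.
         neighborly_cubical_4_polytope m P \<and> vertex_edge_truncation P Q \<longrightarrow>
           (let n = real ((6 * m - 12) * 2 ^ m) in
            \<forall>C. separator c (polytope_vertices Q) (polytope_adj Q) C \<longrightarrow>
                real (card C) \<ge> K * (n / ln n powr (3 / 2)))"
    unfolding eventually_sequentially by blast
next
  fix c :: real
  assume "0 < c \<and> c < 1 / 2"
  then have c: "0 < 1 / 2 - c" by auto
  \<comment> \<open>The bound on \<open>m\<close> guarantees that a separator of size at most \<open>n / m\<close> leaves at least \<open>c n\<close> of each half;
    the constant \<open>7\<close> is from \<open>ln n \<le> 7 m\<close>.\<close>
  have "\<forall>P Q :: 'a set.
         neighborly_cubical_4_polytope m P \<and> vertex_edge_truncation P Q \<longrightarrow>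
           (let n = real ((6 * m - 12) * 2 ^ m) in
            \<exists>C. separator c (polytope_vertices Q) (polytope_adj Q) C \<and>
                real (card C) \<le> 7 * (n / ln n))" if m: "m \<ge> max 4 (nat \<lceil>1 / (1 / 2 - c)\<rceil>)" for m
    unfolding Let_def
  proof (intro allI impI)
    fix P Q :: "'a set"
    assume "neighborly_cubical_4_polytope m P \<and> vertex_edge_truncation P Q"
    then have nc: "neighborly_cubical_4_polytope m P" and tr: "vertex_edge_truncation P Q" by auto
    have P: "polytope P" using nc unfolding neighborly_cubical_4_polytope_def by auto
    obtain a1 b1 a2 b2 where cut: "vertex_edge_cut P a1 b1 a2 b2"
      "Q = cutting.Q (cutting.Q P {{v} | v. v \<in> polytope_vertices P} a1 b1)
        {e \<inter> cutting.Q P {{v} | v. v \<in> polytope_vertices P} a1 b1 | e. e edge_of P} a2 b2"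
      using vertex_edge_truncation_locale[OF P tr] .
    have m4: "m \<ge> 4" using m by simp
    have m0: "real m > 0" using m4 by simp
    have "1 / (1 / 2 - c) \<le> real m" using m by linarith
    then have "1 / real m \<le> 1 / 2 - c" using m0 c by (simp add: field_simps)
    then have "c + 1 / real m \<le> 1 / 2" by simp
    then obtain C where C: "separator c (polytope_vertices Q) (polytope_adj Q) C"
      "real m * real (card C) \<le> real ((6 * m - 12) * 2 ^ m)"
      by (rule vertex_edge_cut.separator_upper_bound[OF cut(1) nc m4, of c, folded cut(2)])
    let ?n = "real ((6 * m - 12) * 2 ^ m)"
    note nb = vertex_count_bounds[OF m4]
    have "real (card C) * ln ?n \<le> real (card C) * (7 * real m)"
      using nb(4) by (intro mult_left_mono) auto
    also have "\<dots> \<le> 7 * ?n" using C(2) by (simp add: mult.commute mult.left_commute)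
    finally have "real (card C) \<le> 7 * (?n / ln ?n)" using nb(3) by (simp add: pos_le_divide_eq)
    then show "\<exists>C. separator c (polytope_vertices Q) (polytope_adj Q) C \<and> real (card C) \<le> 7 * (?n / ln ?n)"
      using C(1) by blast
  qed
  then show "\<exists>L>0. \<forall>\<^sub>F m in sequentially. \<forall>P Q :: 'a set.
         neighborly_cubical_4_polytope m P \<and> vertex_edge_truncation P Q \<longrightarrow>
           (let n = real ((6 * m - 12) * 2 ^ m) in
            \<exists>C. separator c (polytope_vertices Q) (polytope_adj Q) C \<and>
                real (card C) \<le> L * (n / ln n))"
    unfolding eventually_sequentially by (intro exI[of _ "7::real"] conjI) (simp, blast)
qed

end
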